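(* Let $(X,d_X)$ be a finite metric space with $|X|=n$ and doubling dimension $\alpha_X$, and let $0<\epsilon<1$ be fixed. Consider a game with two players Alice and Bob, in which Alice knows $\mu\in\mathcal{P}_X$ and Bob knows $\nu\in\mathcal{P}_X$ (the metric $(X,d_X)$ being fixed and available to both). There exists a (randomized) communication protocol with communication complexity $\tilde O(n^{\epsilon})$ through which Alice and Bob can output a number $D$ satisfying $$EMD_X(\mu,\nu)\le D\le O\!\left(\frac{\alpha_X}{\epsilon}\right)EMD_X(\mu,\nu)$$ with probability at least $2/3$.
   Context: The doubling dimension $\alpha_X$ of a metric space $(X,d_X)$ is the smallest $t$ such that every ball in $X$ can be covered by $2^t$ balls of half the radius. For a fixed constant $a>0$, $\mathcal{P}_X$ is the set of functions $\mu:X\to\{0,\frac{1}{n^a},\frac{2}{n^a},\dots,1\}$ with $\sum_{p\in X}\mu_p=1$. For $\mu,\nu\in\mathcal{P}_X$, $EMD_X(\mu,\nu)=\min_\pi\sum_{p,q\in X}d_X(p,q)\pi(p,q)$, where $\pi:X\times X\to\mathbb{R}$ ranges over functions with $\pi(p,q)\ge0$, $\sum_{q}\pi(p,q)=\mu_p$ for all $p$, and $\sum_p\pi(p,q)=\nu_q$ for all $q$. The notation $\tilde O(\cdot)$ hides factors polylogarithmic in $n$. *)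

theory Defs
  imports "HOL-Probability.Probability" "HOL-Library.Landau_Symbols"
begin

text \<open>
  For a nonempty finite space the infimum is attained, and replacing the closed balls by open
  ones yields the same value.
\<close>

definition doubling_dim :: "'a set \<Rightarrow> ('a \<Rightarrow> 'a \<Rightarrow> real) \<Rightarrow> real" where
  "doubling_dim X d = Inf {t. \<forall>x\<in>X. \<forall>r>0. \<exists>C\<subseteq>X. finite C \<and> real (card C) \<le> 2 powr t \<and>
     Metric_space.mcball X d x r \<subseteq> (\<Union>c\<in>C. Metric_space.mcball X d c (r / 2))}"

text \<open>
  The value \<open>1\<close> is listed separately because it is not a multiple of \<open>1 / n\<^sup>a\<close> when \<open>n\<^sup>a\<close> is not
  an integer.
\<close>

definition grid_distributions :: "real \<Rightarrow> 'a set \<Rightarrow> ('a \<Rightarrow> real) set" where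
  "grid_distributions a X =
     {\<mu> \<in> X \<rightarrow>\<^sub>E insert 1 {real k / real (card X) powr a | k :: nat. real k \<le> real (card X) powr a}.
        (\<Sum>p\<in>X. \<mu> p) = 1}"

definition transport_plans ::
  "'a set \<Rightarrow> ('a \<Rightarrow> real) \<Rightarrow> ('a \<Rightarrow> real) \<Rightarrow> ('a \<Rightarrow> 'a \<Rightarrow> real) set" where
  "transport_plans X \<mu> \<nu> =
     {\<pi>. (\<forall>p\<in>X. \<forall>q\<in>X. 0 \<le> \<pi> p q) \<and>
         (\<forall>p\<in>X. (\<Sum>q\<in>X. \<pi> p q) = \<mu> p) \<and> (\<forall>q\<in>X. (\<Sum>p\<in>X. \<pi> p q) = \<nu> q)}"

text \<open>For distributions on a finite space the infimum is attained, by compactness.\<close>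

definition EMD ::
  "'a set \<Rightarrow> ('a \<Rightarrow> 'a \<Rightarrow> real) \<Rightarrow> ('a \<Rightarrow> real) \<Rightarrow> ('a \<Rightarrow> real) \<Rightarrow> real" where
  "EMD X d \<mu> \<nu> = (INF \<pi>\<in>transport_plans X \<mu> \<nu>. \<Sum>p\<in>X. \<Sum>q\<in>X. d p q * \<pi> p q)"

text \<open>
  Deterministic two-party protocols as binary trees: at each inner node the owner of the node
  sends one bit, a function of her or his own input, which selects the subtree (left for
  \<open>True\<close>). The output is attached to the leaf, so it is determined by the transcript and known to
  both players. A randomized (public-coin) protocol is a probability distribution on
  deterministic protocols; its communication complexity is the worst case over inputs and coins.
\<close>

datatype ('x, 'y, 'o) protocol =
    Output 'o
  | Alice "'x \<Rightarrow> bool" "('x, 'y, 'o) protocol" "('x, 'y, 'o) protocol"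
  | Bob "'y \<Rightarrow> bool" "('x, 'y, 'o) protocol" "('x, 'y, 'o) protocol"

primrec run :: "('x, 'y, 'o) protocol \<Rightarrow> 'x \<Rightarrow> 'y \<Rightarrow> 'o" where
  "run (Output z) x y = z"
| "run (Alice f P Q) x y = (if f x then run P x y else run Q x y)"
| "run (Bob g P Q) x y = (if g y then run P x y else run Q x y)"

primrec comm_cost :: "('x, 'y, 'o) protocol \<Rightarrow> nat" where
  "comm_cost (Output z) = 0"
| "comm_cost (Alice f P Q) = Suc (max (comm_cost P) (comm_cost Q))"
| "comm_cost (Bob g P Q) = Suc (max (comm_cost P) (comm_cost Q))"

definition comm_complexity_le :: "('x, 'y, 'o) protocol pmf \<Rightarrow> real \<Rightarrow> bool" where
  "comm_complexity_le R b \<longleftrightarrow> (\<forall>P\<in>set_pmf R. real (comm_cost P) \<le> b)"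

definition soft_O :: "(nat \<Rightarrow> real) \<Rightarrow> (nat \<Rightarrow> real) set" where
  "soft_O g = {f. \<exists>k::nat. f \<in> O(\<lambda>n. g n * ln (real n) ^ k)}"

end

theory Submission
  imports Defs
begin

text \<open>
  Let \<open>\<rho> = n powr (c * \<epsilon> / \<alpha>)\<close>. A random hierarchy of partitions with radii growing by the factor
  \<open>\<rho>\<close> is obtained by assigning every point to the first centre of a random permutation within the
  current radius and merging clusters whose centres share a net point. As the common offset of the
  radii is logarithmically uniform, two points \<open>x\<close> and \<open>y\<close> are charged
  \<open>O(ln n / ln \<rho>) * d x y = O(\<alpha> / \<epsilon>) * d x y\<close> in expectation. The earth mover distance is
  thus approximated by a sum of transshipment costs, one for each cluster, each of which
  involves at most \<open>O(\<rho>) powr \<alpha>\<close> children and can be evaluated by exchanging the masses of the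
  children.

  Each summand lies between an \<open>\<ell>\<^sub>1\<close> distance of the two mass vectors and \<open>O(\<rho>)\<close> times this
  distance, so the sum can be estimated from \<open>O(\<rho>)\<close> samples of coordinates drawn with
  probability proportional to their contribution to the \<open>\<ell>\<^sub>1\<close> distance. Such a sample is the first
  difference of the two inputs along a public random sequence of coordinates; it is found by
  binary search with randomised equality tests.
\<close>

text \<open>A tree metric would charge a pair that is separated at level \<open>i\<close> but not
  above with the diameter of the common cluster, of order \<open>\<rho> * R i\<close>, and the large
  \<rho> would be lost in the approximation. Shipping between the centres of children at their true
  distances charges \<open>d x y + O(R i)\<close> instead, with \<open>d x y\<close> at a single
  level only; this is why a transshipment cost is evaluated in every cluster. The decomposition errs
  on one side: its cost dominates the earth mover distance for every outcome of the coins, so only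
  the upper bound is random and Markov's inequality suffices.

  The normalising l1 distance is not known to the players. The waiting time for the first difference
  supplies it: the expected reward of a trial is the mean reward per draw times the expected waiting
  time, also for truncated sequences, so a quotient of two sums over the same trials estimates the
  weighted sum. The errors of the equality tests are kept apart as a total variation distance from
  an exact search.\<close>

lemma integrable_pmf_bounded:
  fixes f :: "'a \<Rightarrow> real"
  assumes "\<And>x. \<bar>f x\<bar> \<le> B"
  shows "integrable (measure_pmf M) f"
  by (rule measure_pmf.integrable_const_bound[where B = B]) (use assms in auto)

text \<open>Nonnegative integrals pass through \<open>bind_pmf\<close> without integrability
  conditions; boundedness transfers the identity to Bochner integrals.\<close>

lemma expectation_bind_pmf_bounded:
  fixes f :: "'b \<Rightarrow> real"
  assumes "\<And>x. 0 \<le> f x" "\<And>x. f x \<le> B"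
  shows "measure_pmf.expectation (bind_pmf M N) f
           = measure_pmf.expectation M (\<lambda>x. measure_pmf.expectation (N x) f)"
proof -
  have int: "integrable (measure_pmf Q) f" for Q
    by (rule integrable_pmf_bounded[where B = B]) (use assms in auto)
  have E: "0 \<le> measure_pmf.expectation Q f" "measure_pmf.expectation Q f \<le> B" for Q
    using assms by (auto intro!: measure_pmf.integral_le_const[OF int])
  have int': "integrable (measure_pmf M) (\<lambda>x. measure_pmf.expectation (N x) f)"
    by (rule integrable_pmf_bounded[where B = B]) (use E in auto)
  have nn: "(\<integral>\<^sup>+x. ennreal (f x) \<partial>Q) = ennreal (measure_pmf.expectation Q f)" for Q :: "'b pmf"
    using int assms by (intro nn_integral_eq_integral) auto
  have "ennreal (measure_pmf.expectation (bind_pmf M N) f)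
          = (\<integral>\<^sup>+x. ennreal (measure_pmf.expectation (N x) f) \<partial>M)"
    unfolding nn[symmetric] by simp
  also have "\<dots> = ennreal (measure_pmf.expectation M (\<lambda>x. measure_pmf.expectation (N x) f))"
    using int' E by (intro nn_integral_eq_integral) auto
  finally show ?thesis
    by (rule ennreal_inj[THEN iffD1, rotated -1]) (use E in auto)
qed

lemma expectation_bind_pmf_finite:
  fixes f :: "'b \<Rightarrow> real"
  assumes "finite (set_pmf M)" "\<And>x. x \<in> set_pmf M \<Longrightarrow> finite (set_pmf (N x))"
  shows "measure_pmf.expectation (bind_pmf M N) f
           = measure_pmf.expectation M (\<lambda>x. measure_pmf.expectation (N x) f)"
  using assms
  by (subst pmf_expectation_bind[of "set_pmf M"], simp_all)
     (subst integral_measure_pmf[of "set_pmf M"], simp_all)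

text \<open>
  \<open>close_pmf \<delta> M N\<close> is equivalent to a bound \<open>\<delta>\<close> on the total variation distance: applying the
  condition to \<open>1 - f\<close> gives the reverse inequality.
\<close>

definition close_pmf :: "real \<Rightarrow> 'a pmf \<Rightarrow> 'a pmf \<Rightarrow> bool" where
  "close_pmf \<delta> M N \<longleftrightarrow> (\<forall>f. (\<forall>z. 0 \<le> f z \<and> f z \<le> 1) \<longrightarrow>
     measure_pmf.expectation N f \<le> measure_pmf.expectation M f + \<delta>)"

lemma close_pmf_refl: "close_pmf 0 M M"
  by (simp add: close_pmf_def)

lemma close_pmf_mono: "close_pmf \<delta> M N \<Longrightarrow> \<delta> \<le> \<delta>' \<Longrightarrow> close_pmf \<delta>' M N"
  unfolding close_pmf_def by (meson add_left_mono order_trans)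

text \<open>The kernels are exchanged first, under \<open>N\<close>; then the bounded function
  \<open>\<lambda>z. E (F z) f\<close> serves as test function for \<open>M\<close> and
  \<open>N\<close>. Hence the kernels need to be close only on the support of the second
  law.\<close>

lemma close_pmf_bind:
  assumes "close_pmf \<delta> M N" "\<And>z. z \<in> set_pmf N \<Longrightarrow> close_pmf \<delta>' (F z) (G z)" "0 \<le> \<delta>'"
  shows "close_pmf (\<delta> + \<delta>') (bind_pmf M F) (bind_pmf N G)"
  unfolding close_pmf_def
proof (intro allI impI)
  fix f :: "'b \<Rightarrow> real" assume f: "\<forall>z. 0 \<le> f z \<and> f z \<le> 1"
  have intf: "integrable (measure_pmf Q) f" for Q
    by (rule integrable_pmf_bounded[where B = 1]) (use f in auto)
  have E: "0 \<le> measure_pmf.expectation Q f \<and> measure_pmf.expectation Q f \<le> 1" for Q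
    using f by (auto intro!: measure_pmf.integral_le_const[OF intf])
  have intE: "integrable (measure_pmf Q) (\<lambda>z. measure_pmf.expectation (H z) f)"
    for Q :: "'a pmf" and H
    by (rule integrable_pmf_bounded[where B = 1]) (use E in auto)
  have "measure_pmf.expectation (bind_pmf N G) f
      = measure_pmf.expectation N (\<lambda>z. measure_pmf.expectation (G z) f)"
    using f by (intro expectation_bind_pmf_bounded[where B = 1]) auto
  also have "\<dots> \<le> measure_pmf.expectation N (\<lambda>z. measure_pmf.expectation (F z) f + \<delta>')"
    using assms(2) f
    by (intro integral_mono_AE Bochner_Integration.integrable_add intE)
       (auto simp: AE_measure_pmf_iff close_pmf_def)
  also have "\<dots> = measure_pmf.expectation N (\<lambda>z. measure_pmf.expectation (F z) f) + \<delta>'"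
    by (subst Bochner_Integration.integral_add) (auto intro: intE)
  also have "\<dots> \<le> measure_pmf.expectation M (\<lambda>z. measure_pmf.expectation (F z) f) + \<delta> + \<delta>'"
    using assms(1) E by (simp add: close_pmf_def)
  also have "\<dots> = measure_pmf.expectation (bind_pmf M F) f + (\<delta> + \<delta>')"
    using f by (subst expectation_bind_pmf_bounded[where B = 1]) auto
  finally show "measure_pmf.expectation (bind_pmf N G) f
      \<le> measure_pmf.expectation (bind_pmf M F) f + (\<delta> + \<delta>')" .
qed

lemma close_pmf_bind_right:
  assumes "\<And>z. z \<in> set_pmf M \<Longrightarrow> close_pmf \<delta> (F z) (G z)" "0 \<le> \<delta>"
  shows "close_pmf \<delta> (bind_pmf M F) (bind_pmf M G)"
  using close_pmf_bind[OF close_pmf_refl[of M] assms] by simp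

lemma close_pmf_prob:
  assumes "close_pmf \<delta> M N"
  shows "measure_pmf.prob N E \<le> measure_pmf.prob M E + \<delta>"
proof -
  have "measure_pmf.expectation N (indicator E) \<le> measure_pmf.expectation M (indicator E :: _ \<Rightarrow> real) + \<delta>"
    using assms[unfolded close_pmf_def, rule_format, of "indicator E"] by (simp add: indicator_def)
  then show ?thesis by simp
qed

subsection \<open>Randomised protocols as a monad\<close>

text \<open>Only the output law for each pair of inputs is retained, so protocols can be composed
  and compared as probabilistic programs. The distribution \<open>R\<close> is fixed before the
  inputs, which makes its randomness public.\<close>

definition computable :: "nat \<Rightarrow> ('x \<Rightarrow> 'y \<Rightarrow> 'o pmf) \<Rightarrow> bool" where
  "computable c F \<longleftrightarrow> (\<exists>R. (\<forall>P\<in>set_pmf R. comm_cost P \<le> c) \<and>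
     (\<forall>x y. map_pmf (\<lambda>P. run P x y) R = F x y))"

lemma computable_return: "computable 0 (\<lambda>x y. return_pmf z)"
  unfolding computable_def by (rule exI[of _ "return_pmf (Output z)"]) simp

lemma computable_mono: "computable c F \<Longrightarrow> c \<le> c' \<Longrightarrow> computable c' F"
  unfolding computable_def by (meson order_trans)

lemma computable_Alice_bit: "computable 1 (\<lambda>x y. return_pmf (f x :: bool))"
  unfolding computable_def
  by (rule exI[of _ "return_pmf (Alice f (Output True) (Output False))"]) auto

lemma computable_Bob_bit: "computable 1 (\<lambda>x y. return_pmf (f y :: bool))"
  unfolding computable_def
  by (rule exI[of _ "return_pmf (Bob f (Output True) (Output False))"]) auto

lemma computable_coins:
  assumes "\<And>\<omega>. \<omega> \<in> set_pmf Q \<Longrightarrow> computable c (F \<omega>)"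
  shows "computable c (\<lambda>x y. bind_pmf Q (\<lambda>\<omega>. F \<omega> x y))"
proof -
  from assms obtain R where R: "\<And>\<omega> P. \<omega> \<in> set_pmf Q \<Longrightarrow> P \<in> set_pmf (R \<omega>) \<Longrightarrow> comm_cost P \<le> c"
      "\<And>\<omega> x y. \<omega> \<in> set_pmf Q \<Longrightarrow> map_pmf (\<lambda>P. run P x y) (R \<omega>) = F \<omega> x y"
    unfolding computable_def by metis
  show ?thesis unfolding computable_def
    by (rule exI[of _ "bind_pmf Q R"])
       (use R in \<open>auto simp: map_bind_pmf intro!: bind_pmf_cong\<close>)
qed

text \<open>
  The continuations at distinct leaves are drawn independently; any other coupling would do, since
  a run reaches a single leaf.
\<close>

primrec graft :: "('x, 'y, 'a) protocol \<Rightarrow> ('a \<Rightarrow> ('x, 'y, 'b) protocol pmf) \<Rightarrow> ('x, 'y, 'b) protocol pmf"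
where
  "graft (Output z) K = K z"
| "graft (Alice f P Q) K = bind_pmf (graft P K) (\<lambda>P'. map_pmf (Alice f P') (graft Q K))"
| "graft (Bob f P Q) K = bind_pmf (graft P K) (\<lambda>P'. map_pmf (Bob f P') (graft Q K))"

text \<open>A continuation is drawn for every leaf, but a run reads only one of them; at each inner
  node the draw for the subtree that is not entered integrates out.\<close>

lemma run_graft:
  "map_pmf (\<lambda>P. run P x y) (graft P K) = map_pmf (\<lambda>P. run P x y) (K (run P x y))"
  by (induction P)
     (auto simp: map_bind_pmf map_pmf_comp o_def bind_return_pmf' map_pmf_const
           simp flip: map_pmf_def intro: map_pmf_cong)

lemma comm_cost_graft:
  assumes "\<And>z P. P \<in> set_pmf (K z) \<Longrightarrow> comm_cost P \<le> c" "P' \<in> set_pmf (graft P K)"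
  shows "comm_cost P' \<le> comm_cost P + c"
  using assms(2) by (induction P arbitrary: P') (use assms(1) in \<open>fastforce+\<close>)

text \<open>The leaf carries \<open>z\<close>, so both players know it when they continue. The bound
  on the continuation is required for every \<open>z\<close>, even for values that never occur;
  hence the default branches in the programs below.\<close>

lemma computable_bind:
  assumes "computable c F" "\<And>z. computable c' (G z)"
  shows "computable (c + c') (\<lambda>x y. bind_pmf (F x y) (\<lambda>z. G z x y))"
proof -
  from assms(1) obtain R where R: "\<And>P. P \<in> set_pmf R \<Longrightarrow> comm_cost P \<le> c"
      "\<And>x y. map_pmf (\<lambda>P. run P x y) R = F x y"
    unfolding computable_def by metis
  from assms(2) obtain K where K: "\<And>z P. P \<in> set_pmf (K z) \<Longrightarrow> comm_cost P \<le> c'"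
      "\<And>z x y. map_pmf (\<lambda>P. run P x y) (K z) = G z x y"
    unfolding computable_def by metis
  show ?thesis unfolding computable_def
  proof (intro exI[of _ "bind_pmf R (\<lambda>P. graft P K)"] conjI ballI allI)
    fix P' assume "P' \<in> set_pmf (bind_pmf R (\<lambda>P. graft P K))"
    then obtain P where "P \<in> set_pmf R" "P' \<in> set_pmf (graft P K)" by auto
    then show "comm_cost P' \<le> c + c'"
      using R(1) comm_cost_graft[OF K(1)] by (meson add_le_mono1 order_trans)
  next
    fix x y
    show "map_pmf (\<lambda>P. run P x y) (bind_pmf R (\<lambda>P. graft P K)) = bind_pmf (F x y) (\<lambda>z. G z x y)"
      unfolding map_bind_pmf run_graft K R(2)[symmetric] bind_map_pmf ..
  qed
qed

lemma computable_map:
  assumes "computable c F"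
  shows "computable c (\<lambda>x y. map_pmf h (F x y))"
  using computable_bind[OF assms, of 0 "\<lambda>z x y. return_pmf (h z)"]
  by (simp add: computable_return map_pmf_def)

text \<open>The least significant bit is sent first. Reducing modulo \<open>2 ^ b\<close> avoids any
  promise on the size of \<open>f x\<close> and lets the induction pass to
  \<open>f x div 2\<close>.\<close>

lemma computable_Alice_nat: "computable b (\<lambda>x y. return_pmf (f x mod 2 ^ b :: nat))"
proof (induction b arbitrary: f)
  case 0
  show ?case by (simp add: computable_return)
next
  case (Suc b)
  have "f x mod 2 ^ Suc b = 2 * ((f x div 2) mod 2 ^ b) + of_bool (odd (f x))" for x
    using mod_mult2_eq[of "f x" 2 "2 ^ b"] by (simp add: mod2_eq_if)
  then show ?case
    using computable_bind[OF computable_Alice_bit[of "\<lambda>x. odd (f x)"],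
        where G = "\<lambda>z x y. map_pmf (\<lambda>v. 2 * v + of_bool z) (return_pmf ((f x div 2) mod 2 ^ b))",
        OF computable_map[OF Suc.IH[of "\<lambda>x. f x div 2"]]]
    by (simp add: bind_return_pmf)
qed

lemma computable_Bob_nat: "computable b (\<lambda>x y. return_pmf (f y mod 2 ^ b :: nat))"
proof (induction b arbitrary: f)
  case 0
  show ?case by (simp add: computable_return)
next
  case (Suc b)
  have "f x mod 2 ^ Suc b = 2 * ((f x div 2) mod 2 ^ b) + of_bool (odd (f x))" for x
    using mod_mult2_eq[of "f x" 2 "2 ^ b"] by (simp add: mod2_eq_if)
  then show ?case
    using computable_bind[OF computable_Bob_bit[of "\<lambda>x. odd (f x)"],
        where G = "\<lambda>z x y. map_pmf (\<lambda>v. 2 * v + of_bool z) (return_pmf ((f y div 2) mod 2 ^ b))",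
        OF computable_map[OF Suc.IH[of "\<lambda>x. f x div 2"]]]
    by (simp add: bind_return_pmf)
qed

lemma computable_list:
  assumes "\<And>s. s \<in> set ss \<Longrightarrow> computable c (\<lambda>x y. return_pmf (f s x y))"
  shows "computable (length ss * c) (\<lambda>x y. return_pmf (map (\<lambda>s. f s x y) ss))"
  using assms
proof (induction ss)
  case Nil
  show ?case by (simp add: computable_return)
next
  case (Cons s ss)
  have "computable (c + length ss * c) (\<lambda>x y. bind_pmf (return_pmf (f s x y))
          (\<lambda>z. map_pmf ((#) z) (return_pmf (map (\<lambda>s. f s x y) ss))))"
    by (intro computable_bind computable_map Cons.IH) (use Cons.prems in auto)
  then show ?case by (simp add: bind_return_pmf)
qed

subsection \<open>Locating the first difference\<close>

text \<open>Random parity fingerprints: \<open>J\<close> is a public coin, and each round costs one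
  bit per player. Equal inputs are never rejected.\<close>

primrec equality_test :: "nat \<Rightarrow> nat set \<Rightarrow> (nat \<Rightarrow> bool) \<Rightarrow> (nat \<Rightarrow> bool) \<Rightarrow> bool pmf" where
  "equality_test 0 I u v = return_pmf True"
| "equality_test (Suc b) I u v = bind_pmf (pmf_of_set (Pow I)) (\<lambda>J.
     if odd (card {t\<in>J. u t}) = odd (card {t\<in>J. v t}) then equality_test b I u v
     else return_pmf False)"

lemma equality_test_eq: "\<forall>t\<in>I. u t = v t \<Longrightarrow> finite I \<Longrightarrow> equality_test b I u v = return_pmf True"
proof (induction b)
  case (Suc b)
  have "{t\<in>J. u t} = {t\<in>J. v t}" if "J \<in> set_pmf (pmf_of_set (Pow I))" for J
    using that Suc.prems by (subst (asm) set_pmf_of_set) auto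
  then show ?case using Suc
    by (simp cong: bind_pmf_cong_simp)
qed simp

text \<open>Toggling the membership of \<open>t0\<close> in \<open>J\<close> is an involution of
  \<open>Pow I\<close> that flips exactly one of the two parities. It therefore exchanges the event
  with its complement and preserves the uniform distribution.\<close>

lemma prob_parity_eq:
  assumes "finite I" "t0 \<in> I" "u t0 \<noteq> v t0"
  shows "measure_pmf.prob (pmf_of_set (Pow I))
           {J. odd (card {t\<in>J. u t}) = odd (card {t\<in>J. v t})} = 1 / 2"
proof -
  let ?E = "{J. odd (card {t\<in>J. u t}) = odd (card {t\<in>J. v t})}"
  define f where "f J = (if t0 \<in> J then J - {t0} else insert t0 J)" for J
  have bij: "bij_betw f (Pow I) (Pow I)"
    by (rule bij_betwI[where g = f]) (use assms in \<open>auto simp: f_def split: if_splits\<close>)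
  have par: "odd (card {t\<in>f J. w t}) \<longleftrightarrow> (odd (card {t\<in>J. w t}) \<noteq> w t0)" if "J \<subseteq> I" for J w
  proof -
    have fin: "finite J" using that assms finite_subset by auto
    show ?thesis
    proof (cases "t0 \<in> J")
      case True
      then have *: "{t\<in>J. w t} = {t\<in>f J. w t} \<union> (if w t0 then {t0} else {})"
        "t0 \<notin> f J" "finite (f J)"
        using fin by (auto simp: f_def)
      have c: "card {t\<in>J. w t} = card {t\<in>f J. w t} + of_bool (w t0)"
        unfolding *(1) using *(2,3) by simp
      have "odd (card {t\<in>J. w t}) \<longleftrightarrow> (odd (card {t\<in>f J. w t}) \<noteq> w t0)"
        unfolding c by simp
      then show ?thesis by blast
    next
      case False
      then have *: "{t\<in>f J. w t} = {t\<in>J. w t} \<union> (if w t0 then {t0} else {})"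
        by (auto simp: f_def)
      have "card {t\<in>f J. w t} = card {t\<in>J. w t} + of_bool (w t0)"
        unfolding * using fin False by simp
      then show ?thesis by simp
    qed
  qed
  have "measure_pmf.prob (pmf_of_set (Pow I)) ?E
      = measure_pmf.prob (map_pmf f (pmf_of_set (Pow I))) ?E"
    using assms by (subst map_pmf_of_set_bij_betw[OF bij]) auto
  also have "\<dots> = measure_pmf.prob (pmf_of_set (Pow I)) (f -` ?E)" by simp
  also have "\<dots> = measure_pmf.prob (pmf_of_set (Pow I)) (- ?E)"
  proof (intro measure_pmf.finite_measure_eq_AE)
    have "J \<in> f -` ?E \<longleftrightarrow> J \<in> - ?E" if "J \<subseteq> I" for J
      using par[OF that, of u] par[OF that, of v] assms(3) by blast
    then show "AE J in pmf_of_set (Pow I). J \<in> f -` ?E \<longleftrightarrow> J \<in> - ?E"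
      using assms(1) by (simp only: AE_measure_pmf_iff) (subst set_pmf_of_set; blast)
  qed simp_all
  also have "\<dots> = 1 - measure_pmf.prob (pmf_of_set (Pow I)) ?E"
    using measure_pmf.prob_compl[of ?E "pmf_of_set (Pow I)"] by (simp add: Compl_eq_Diff_UNIV)
  finally show ?thesis by simp
qed

text \<open>For unequal inputs one more round replaces the expectation of \<open>f\<close> by its
  average with \<open>f False\<close>, so the gap to the correct value halves in each round.\<close>

lemma equality_test_close:
  assumes "finite I"
  shows "close_pmf ((1 / 2) ^ b) (equality_test b I u v) (return_pmf (\<forall>t\<in>I. u t = v t))"
proof (cases "\<forall>t\<in>I. u t = v t")
  case True
  then show ?thesis
    using equality_test_eq[OF True assms]
      close_pmf_mono[OF close_pmf_refl[of "return_pmf True"], of "(1 / 2) ^ b"] by simp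
next
  case False
  then obtain t0 where t0: "t0 \<in> I" "u t0 \<noteq> v t0" by auto
  show ?thesis unfolding close_pmf_def
  proof (intro allI impI)
    fix f :: "bool \<Rightarrow> real" assume f: "\<forall>z. 0 \<le> f z \<and> f z \<le> 1"
    let ?E = "{J. odd (card {t\<in>J. u t}) = odd (card {t\<in>J. v t})}"
    have "f False \<le> measure_pmf.expectation (equality_test b I u v) f + (1 / 2) ^ b"
    proof (induction b)
      case 0
      show ?case using spec[OF f, of False] spec[OF f, of True] by simp
    next
      case (Suc b)
      let ?A = "measure_pmf.expectation (equality_test b I u v) f"
      have int: "integrable (measure_pmf (pmf_of_set (Pow I))) (indicator ?E :: _ \<Rightarrow> real)"
        by (rule integrable_pmf_bounded[where B = 1]) (simp add: indicator_def)
      have E: "measure_pmf.expectation (pmf_of_set (Pow I)) (indicator ?E) = (1 / 2 :: real)"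
        using prob_parity_eq[where u = u and v = v, OF assms t0]
        by simp
      have "measure_pmf.expectation (equality_test (Suc b) I u v) f
          = measure_pmf.expectation (pmf_of_set (Pow I))
              (\<lambda>J. f False + (?A - f False) * indicator ?E J)"
        unfolding equality_test.simps using f
        by (subst expectation_bind_pmf_bounded[where B = 1])
           (auto intro!: Bochner_Integration.integral_cong)
      also have "\<dots> = f False + (?A - f False) * (1 / 2)"
        by (subst Bochner_Integration.integral_add[OF _ integrable_mult_right[OF int]])
           (simp_all only: integrable_mult_right[OF int] Bochner_Integration.integral_mult_right[OF int] E, simp_all)
      finally have *: "measure_pmf.expectation (equality_test (Suc b) I u v) f
          = f False + (?A - f False) * (1 / 2)" .
      show ?case unfolding * using Suc by (simp add: field_simps)
    qed
    moreover have "(\<forall>t\<in>I. u t = v t) = False" using False by blast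
    ultimately show "measure_pmf.expectation (return_pmf (\<forall>t\<in>I. u t = v t)) f
        \<le> measure_pmf.expectation (equality_test b I u v) f + (1 / 2) ^ b"
      by (simp only:) simp
  qed
qed

lemma computable_equality_test:
  assumes "finite I"
  shows "computable (2 * b) (\<lambda>x y. equality_test b I (u x) (v y))"
proof (induction b)
  case 0
  show ?case by (simp add: computable_return)
next
  case (Suc b)
  have "computable (1 + (1 + 2 * b)) (\<lambda>x y. bind_pmf (return_pmf (odd (card {t\<in>J. u x t})))
     (\<lambda>p. bind_pmf (return_pmf (odd (card {t\<in>J. v y t})))
       (\<lambda>q. if p = q then equality_test b I (u x) (v y) else return_pmf False)))" for J
  proof (intro computable_bind computable_Alice_bit computable_Bob_bit)
    fix p q :: bool
    show "computable (2 * b) (\<lambda>x y. if p = q then equality_test b I (u x) (v y) else return_pmf False)"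
      using Suc.IH computable_mono[OF computable_return[of False], of "2 * b", OF le0]
      by (cases "p = q") (simp_all only: if_True if_False simp_thms)
  qed
  then show ?case
    unfolding equality_test.simps
    by (intro computable_coins) (simp add: bind_return_pmf)
qed

primrec search :: "nat \<Rightarrow> nat \<Rightarrow> nat \<Rightarrow> (nat \<Rightarrow> bool) \<Rightarrow> (nat \<Rightarrow> bool) \<Rightarrow> nat pmf" where
  "search b 0 l u v = return_pmf l"
| "search b (Suc k) l u v = bind_pmf (equality_test b {l..<l + 2 ^ k} u v) (\<lambda>r.
     if r then search b k (l + 2 ^ k) u v else search b k l u v)"

text \<open>The search with exact answers. The last position of the window is returned without a
  test, so this value alone does not tell whether a difference exists.\<close>

primrec first_diff :: "nat \<Rightarrow> nat \<Rightarrow> (nat \<Rightarrow> bool) \<Rightarrow> (nat \<Rightarrow> bool) \<Rightarrow> nat" where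
  "first_diff 0 l u v = l"
| "first_diff (Suc k) l u v = (if \<forall>t\<in>{l..<l + 2 ^ k}. u t = v t
     then first_diff k (l + 2 ^ k) u v else first_diff k l u v)"

text \<open>A union bound over the \<open>k\<close> equality tests.\<close>

lemma search_close:
  "close_pmf (real k * (1 / 2) ^ b) (search b k l u v) (return_pmf (first_diff k l u v))"
proof (induction k arbitrary: l)
  case 0
  show ?case by (simp add: close_pmf_refl)
next
  case (Suc k)
  let ?r = "\<forall>t\<in>{l..<l + 2 ^ k}. u t = v t"
  have "close_pmf ((1 / 2) ^ b + real k * (1 / 2) ^ b) (search b (Suc k) l u v)
          (bind_pmf (return_pmf ?r) (\<lambda>r. if r then return_pmf (first_diff k (l + 2 ^ k) u v)
             else return_pmf (first_diff k l u v)))"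
    unfolding search.simps
    by (intro close_pmf_bind equality_test_close) (auto intro: Suc.IH)
  then show ?case
    by (simp only: bind_return_pmf first_diff.simps of_nat_Suc distrib_right mult_1_left
          if_distrib[of return_pmf])
qed

lemma computable_search: "computable (k * (2 * b)) (\<lambda>x y. search b k l (u x) (v y))"
proof (induction k arbitrary: l)
  case 0
  show ?case by (simp add: computable_return)
next
  case (Suc k)
  have "computable (2 * b + k * (2 * b)) (\<lambda>x y. bind_pmf (equality_test b {l..<l + 2 ^ k} (u x) (v y)) (\<lambda>r.
     if r then search b k (l + 2 ^ k) (u x) (v y) else search b k l (u x) (v y)))"
  proof (intro computable_bind computable_equality_test)
    fix r
    show "computable (k * (2 * b)) (\<lambda>x y. if r then search b k (l + 2 ^ k) (u x) (v y)
            else search b k l (u x) (v y))"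
      using Suc.IH by (cases r) auto
  qed simp
  then show ?case by simp
qed

lemma first_diff_props:
  "l \<le> first_diff k l u v \<and> first_diff k l u v < l + 2 ^ k \<and>
   (\<forall>t. l \<le> t \<longrightarrow> t < first_diff k l u v \<longrightarrow> u t = v t) \<and>
   (Suc (first_diff k l u v) = l + 2 ^ k \<or> u (first_diff k l u v) \<noteq> v (first_diff k l u v))"
proof (induction k arbitrary: l)
  case (Suc k)
  show ?case
  proof (cases "\<forall>t\<in>{l..<l + 2 ^ k}. u t = v t")
    case True
    then have *: "first_diff (Suc k) l u v = first_diff k (l + 2 ^ k) u v" by simp
    show ?thesis unfolding * using Suc[of "l + 2 ^ k"] True
      by (auto simp: not_less)
  next
    case False
    then have *: "first_diff (Suc k) l u v = first_diff k l u v" by (simp only: first_diff.simps if_False)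
    \<comment> \<open>The end of the left half is not the end of the whole window, so the untested
      outcome has to be excluded here: a difference is known to exist in the left half, and
      everything before the returned position agrees.\<close>
    have "Suc (first_diff k l u v) \<noteq> l + 2 ^ k \<or> u (first_diff k l u v) \<noteq> v (first_diff k l u v)"
    proof (rule ccontr)
      assume *: "\<not> ?thesis"
      from False obtain t where "t \<in> {l..<l + 2 ^ k}" and uv: "u t \<noteq> v t" by blast
      then have t: "l \<le> t" "t < l + 2 ^ k" by auto
      have "t < first_diff k l u v \<or> t = first_diff k l u v" using t * by auto
      then show False using Suc[of l] t uv * by metis
    qed
    then show ?thesis unfolding * using Suc[of l] by auto
  qed
qed simp

subsection \<open>Weighted sampling until the first hit\<close>

definition weighted_pmf :: "'a set \<Rightarrow> ('a \<Rightarrow> real) \<Rightarrow> 'a pmf" where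
  "weighted_pmf S w = embed_pmf (\<lambda>e. if e \<in> S then w e / sum w S else 0)"

lemma pmf_weighted_pmf:
  assumes "finite S" "S \<noteq> {}" "\<And>e. e \<in> S \<Longrightarrow> 0 < w e"
  shows "pmf (weighted_pmf S w) e = (if e \<in> S then w e / sum w S else 0)"
  unfolding weighted_pmf_def
proof (rule pmf_embed_pmf)
  have pos: "0 < sum w S" using assms by (intro sum_pos) auto
  show "0 \<le> (if x \<in> S then w x / sum w S else 0)" for x
    using assms(3)[of x] pos by (auto intro!: divide_nonneg_pos less_imp_le)
  have "(\<integral>\<^sup>+x. ennreal (if x \<in> S then w x / sum w S else 0) \<partial>count_space UNIV)
      = (\<Sum>x\<in>S. ennreal (w x / sum w S))"
    using assms(1) by (subst nn_integral_count_space'[where A = S]) auto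
  also have "\<dots> = ennreal (\<Sum>x\<in>S. w x / sum w S)"
    using assms(3) pos by (intro sum_ennreal) (auto intro!: divide_nonneg_pos less_imp_le)
  also have "(\<Sum>x\<in>S. w x / sum w S) = 1"
    using pos by (simp flip: sum_divide_distrib)
  finally show "(\<integral>\<^sup>+x. ennreal (if x \<in> S then w x / sum w S else 0) \<partial>count_space UNIV) = 1"
    by simp
qed

lemma set_weighted_pmf:
  assumes "finite S" "S \<noteq> {}" "\<And>e. e \<in> S \<Longrightarrow> 0 < w e"
  shows "set_pmf (weighted_pmf S w) = S"
proof -
  have "0 < sum w S" using assms by (intro sum_pos) auto
  then show ?thesis using assms(3)
    by (auto simp: set_pmf_eq pmf_weighted_pmf[OF assms]) fastforce
qed

lemma expectation_weighted_pmf: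
  fixes f :: "'a \<Rightarrow> real"
  assumes "finite S" "S \<noteq> {}" "\<And>e. e \<in> S \<Longrightarrow> 0 < w e"
  shows "measure_pmf.expectation (weighted_pmf S w) f = (\<Sum>e\<in>S. w e * f e) / sum w S"
  by (subst integral_measure_pmf[of S])
     (use assms in \<open>auto simp: set_weighted_pmf pmf_weighted_pmf sum_divide_distrib intro!: sum.cong\<close>)

text \<open>The value of the first element that lies in \<open>D\<close>; \<open>hit_time\<close>
  below is the number of draws used. A list without a hit counts with reward \<open>0\<close> and
  its full length, which keeps the identity \<open>E_reward\<close> exact for finite lists.\<close>

primrec reward :: "'e set \<Rightarrow> ('e \<Rightarrow> real) \<Rightarrow> 'e list \<Rightarrow> real" where
  "reward D h [] = 0"
| "reward D h (e # es) = (if e \<in> D then h e else reward D h es)"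

primrec hit_time :: "'e set \<Rightarrow> 'e list \<Rightarrow> real" where
  "hit_time D [] = 0"
| "hit_time D (e # es) = (if e \<in> D then 1 else 1 + hit_time D es)"

lemma reward_hit_time_nth:
  assumes "t < length es" "es ! t \<in> D" "\<And>s. s < t \<Longrightarrow> es ! s \<notin> D"
  shows "reward D h es = h (es ! t) \<and> hit_time D es = real t + 1"
  using assms
proof (induction es arbitrary: t)
  case (Cons e es)
  show ?case
  proof (cases t)
    case 0
    then show ?thesis using Cons.prems by simp
  next
    case (Suc s)
    then have "reward D h es = h (es ! s) \<and> hit_time D es = real s + 1"
      using Cons.prems by (intro Cons.IH) (auto, fastforce)
    then show ?thesis using Cons.prems(3)[of 0] Suc by simp
  qed
qed simp

lemma reward_hit_time_none:
  "(\<And>s. s < length es \<Longrightarrow> es ! s \<notin> D) \<Longrightarrow> reward D h es = 0 \<and> hit_time D es = length es"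
proof (induction es)
  case (Cons e es)
  have "reward D h es = 0 \<and> hit_time D es = length es"
    using Cons.prems[of "Suc s" for s] by (intro Cons.IH) auto
  then show ?case using Cons.prems[of 0] by simp
qed simp

lemma set_replicate_pmf_finite: "finite (set_pmf Q) \<Longrightarrow> finite (set_pmf (replicate_pmf N Q))"
  by (induction N) auto

lemma set_replicate_pmf_subset:
  "es \<in> set_pmf (replicate_pmf N Q) \<Longrightarrow> length es = N \<and> set es \<subseteq> set_pmf Q"
  by (induction N arbitrary: es) (auto, blast)

locale first_hit =
  fixes Q :: "'e pmf" and D :: "'e set" and h :: "'e \<Rightarrow> real" and G :: real
  assumes finite_Q: "finite (set_pmf Q)"
    and h_bounds: "\<And>e. e \<in> set_pmf Q \<Longrightarrow> e \<in> D \<Longrightarrow> 1 \<le> h e \<and> h e \<le> G"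
begin

definition "hit_prob = measure_pmf.prob Q D"
definition "mean_reward = measure_pmf.expectation Q (\<lambda>e. indicator D e * h e)"
abbreviation "E N \<equiv> measure_pmf.expectation (replicate_pmf N Q)"

lemma E_Suc:
  fixes f :: "'e list \<Rightarrow> real"
  shows "E (Suc N) f = measure_pmf.expectation Q (\<lambda>e. E N (\<lambda>es. f (e # es)))"
  by (simp add: expectation_bind_pmf_finite finite_Q set_replicate_pmf_finite)

lemma integrable_E: "integrable (measure_pmf (replicate_pmf N Q)) (f :: 'e list \<Rightarrow> real)"
  by (intro integrable_measure_pmf_finite set_replicate_pmf_finite finite_Q)

lemma expectation_split:
  "measure_pmf.expectation Q (\<lambda>e. if e \<in> D then f e else c :: real)
     = measure_pmf.expectation Q (\<lambda>e. indicator D e * f e) + (1 - hit_prob) * c"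
proof -
  have int: "integrable (measure_pmf Q) (f :: 'e \<Rightarrow> real)" for f
    by (intro integrable_measure_pmf_finite finite_Q)
  have "measure_pmf.expectation Q (\<lambda>e. if e \<in> D then f e else c)
      = measure_pmf.expectation Q (\<lambda>e. indicator D e * f e + (c - c * indicator D e))"
    by (intro Bochner_Integration.integral_cong) auto
  also have "\<dots> = measure_pmf.expectation Q (\<lambda>e. indicator D e * f e) + (c - c * hit_prob)"
    by (subst Bochner_Integration.integral_add[OF int int],
        subst Bochner_Integration.integral_diff[OF int int])
       (simp add: hit_prob_def)
  finally show ?thesis by (simp add: algebra_simps)
qed

lemma hit_prob_bounds: "0 \<le> hit_prob" "hit_prob \<le> 1"
  unfolding hit_prob_def by auto

lemma hit_prob_expectation: "measure_pmf.expectation Q (indicator D) = hit_prob"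
  unfolding hit_prob_def by simp

lemma E_reward_Suc: "E (Suc N) (reward D h) = mean_reward + (1 - hit_prob) * E N (reward D h)"
proof -
  have "E (Suc N) (reward D h)
      = measure_pmf.expectation Q (\<lambda>e. if e \<in> D then h e else E N (reward D h))"
    unfolding E_Suc by (intro Bochner_Integration.integral_cong) auto
  then show ?thesis unfolding expectation_split mean_reward_def .
qed

lemma E_time_Suc: "E (Suc N) (hit_time D) = 1 + (1 - hit_prob) * E N (hit_time D)"
proof -
  have "E (Suc N) (hit_time D)
      = measure_pmf.expectation Q (\<lambda>e. if e \<in> D then 1 else 1 + E N (hit_time D))"
    unfolding E_Suc
    by (intro Bochner_Integration.integral_cong)
       (auto simp: Bochner_Integration.integral_add[OF _ integrable_E])
  then show ?thesis unfolding expectation_split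
    using hit_prob_expectation by (simp add: algebra_simps)
qed

text \<open>Wald's identity: both expectations satisfy the same affine recursion, with constant
  terms \<open>mean_reward\<close> and \<open>1\<close>. No limit of long sequences is
  involved.\<close>

lemma E_reward: "E N (reward D h) = mean_reward * E N (hit_time D)"
  by (induction N) (simp_all add: E_reward_Suc E_time_Suc algebra_simps del: replicate_pmf.simps(2))

text \<open>Wald's identity once more, for the indicator of a hit: the right-hand side is the
  probability of a hit within \<open>N\<close> draws.\<close>

lemma E_time: "hit_prob * E N (hit_time D) = 1 - (1 - hit_prob) ^ N"
proof (induction N)
  case (Suc N)
  have "hit_prob * E (Suc N) (hit_time D) = hit_prob + (1 - hit_prob) * (hit_prob * E N (hit_time D))"
    unfolding E_time_Suc by (simp add: algebra_simps)
  then show ?case unfolding Suc by (simp add: algebra_simps del: replicate_pmf.simps(2))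
qed simp

text \<open>With \<open>p = hit_prob\<close>, Bernoulli's inequality gives
  \<open>(1 - p) ^ N * (1 + N * p) \<le> (1 - p\<^sup>2) ^ N \<le> 1\<close>, so a miss has
  probability at most one half once \<open>N * p \<ge> 1\<close>.\<close>

lemma E_time_lower:
  assumes "1 \<le> hit_prob * real N"
  shows "1 \<le> 2 * hit_prob * E N (hit_time D)"
proof -
  have "(1 - hit_prob) ^ N * (1 + real N * hit_prob) \<le> (1 - hit_prob) ^ N * (1 + hit_prob) ^ N"
    using hit_prob_bounds by (intro mult_left_mono Bernoulli_inequality) auto
  also have "\<dots> = (1 - hit_prob\<^sup>2) ^ N"
    by (simp add: power_mult_distrib[symmetric] algebra_simps power2_eq_square)
  also have "\<dots> \<le> 1"
    using hit_prob_bounds by (intro power_le_one) (auto simp: power_le_one)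
  finally have "(1 - hit_prob) ^ N * (1 + real N * hit_prob) \<le> 1" .
  moreover have "(1 - hit_prob) ^ N * 2 \<le> (1 - hit_prob) ^ N * (1 + real N * hit_prob)"
    using assms hit_prob_bounds by (intro mult_left_mono) (auto simp: mult.commute)
  ultimately show ?thesis using E_time[of N] by simp
qed

lemma E_time_upper: "hit_prob * E N (hit_time D) \<le> 1"
  using E_time[of N] hit_prob_bounds by simp

lemma hit_time_nonneg: "0 \<le> hit_time D es"
  by (induction es) auto

lemma E_time_nonneg: "0 \<le> E N (hit_time D)"
  by (intro Bochner_Integration.integral_nonneg hit_time_nonneg)

text \<open>The second moment of a truncated geometric variable. After scaling by
  \<open>p\<^sup>2\<close> the recursion sends \<open>x\<close> to
  \<open>p\<^sup>2 + (1 - p) * (2 * p * (p * a) + x)\<close>, which keeps \<open>x \<le> 2\<close>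
  because \<open>p * a \<le> 1\<close> by \<open>E_time_upper\<close>.\<close>

lemma E_time_square: "hit_prob\<^sup>2 * E N (\<lambda>es. (hit_time D es)\<^sup>2) \<le> 2"
proof (induction N)
  case (Suc N)
  let ?p = hit_prob and ?a = "E N (hit_time D)" and ?b = "E N (\<lambda>es. (hit_time D es)\<^sup>2)"
  have "E (Suc N) (\<lambda>es. (hit_time D es)\<^sup>2)
      = measure_pmf.expectation Q (\<lambda>e. if e \<in> D then 1 else 1 + 2 * ?a + ?b)"
    unfolding E_Suc
    by (intro Bochner_Integration.integral_cong)
       (auto simp: power2_sum Bochner_Integration.integral_add[OF _ integrable_E]
          Bochner_Integration.integral_add[OF integrable_E integrable_E])
  also have "\<dots> = 1 + (1 - ?p) * (2 * ?a + ?b)"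
    unfolding expectation_split using hit_prob_expectation by (simp add: algebra_simps)
  finally have *: "E (Suc N) (\<lambda>es. (hit_time D es)\<^sup>2) = 1 + (1 - ?p) * (2 * ?a + ?b)" .
  have "?p\<^sup>2 * E (Suc N) (\<lambda>es. (hit_time D es)\<^sup>2)
      = ?p\<^sup>2 + (1 - ?p) * (2 * ?p * (?p * ?a) + ?p\<^sup>2 * ?b)"
    unfolding * by (simp add: algebra_simps power2_eq_square)
  also have "\<dots> \<le> ?p\<^sup>2 + (1 - ?p) * (2 * ?p * 1 + 2)"
    using Suc E_time_upper[of N] hit_prob_bounds
    by (intro add_left_mono mult_left_mono add_mono) auto
  also have "\<dots> = 2 - ?p\<^sup>2" by (simp add: algebra_simps power2_eq_square)
  finally show ?case using hit_prob_bounds by (smt (verit) zero_le_power2)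
qed simp

lemma reward_bounds: "set es \<subseteq> set_pmf Q \<Longrightarrow> 0 \<le> reward D h es \<and> (reward D h es)\<^sup>2 \<le> G * reward D h es"
proof (induction es)
  case (Cons e es)
  show ?case
  proof (cases "e \<in> D")
    case True
    then have "1 \<le> h e" "h e \<le> G" using h_bounds[of e] Cons.prems by auto
    then show ?thesis using True by (simp add: power2_eq_square mult_right_mono)
  qed (use Cons in auto)
qed simp

lemma E_reward_square: "E N (\<lambda>es. (reward D h es)\<^sup>2) \<le> G * E N (reward D h)"
proof -
  have "E N (\<lambda>es. (reward D h es)\<^sup>2) \<le> E N (\<lambda>es. G * reward D h es)"
    by (intro integral_mono_AE integrable_E)
       (use reward_bounds set_replicate_pmf_subset in \<open>blast intro: AE_pmfI\<close>)
  then show ?thesis by simp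
qed

lemma mean_reward_lower: "hit_prob \<le> mean_reward"
proof -
  have "measure_pmf.expectation Q (indicator D) \<le> mean_reward"
    unfolding mean_reward_def
    using h_bounds
    by (intro integral_mono_AE integrable_measure_pmf_finite finite_Q)
       (auto simp: AE_measure_pmf_iff indicator_def)
  then show ?thesis using hit_prob_expectation by simp
qed

end

subsection \<open>Sums of independent copies\<close>

text \<open>General monoids are allowed because pairs of reward and waiting time are summed jointly;
  the two sums come from the same trials.\<close>

primrec iid_sum :: "nat \<Rightarrow> 'a::comm_monoid_add pmf \<Rightarrow> 'a pmf" where
  "iid_sum 0 M = return_pmf 0"
| "iid_sum (Suc K) M = bind_pmf M (\<lambda>x. map_pmf ((+) x) (iid_sum K M))"

lemma finite_set_iid_sum: "finite (set_pmf M) \<Longrightarrow> finite (set_pmf (iid_sum K M))"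
  by (induction K) auto

lemma close_pmf_iid_sum:
  assumes "close_pmf \<delta> M N" "0 \<le> \<delta>"
  shows "close_pmf (real K * \<delta>) (iid_sum K M) (iid_sum K N)"
proof (induction K)
  case 0
  show ?case by (simp add: close_pmf_refl)
next
  case (Suc K)
  have "close_pmf (\<delta> + real K * \<delta>) (iid_sum (Suc K) M) (iid_sum (Suc K) N)"
    unfolding iid_sum.simps
  proof (intro close_pmf_bind assms)
    fix z
    have "close_pmf (real K * \<delta> + 0) (map_pmf ((+) z) (iid_sum K M)) (map_pmf ((+) z) (iid_sum K N))"
      unfolding map_pmf_def by (intro close_pmf_bind Suc close_pmf_refl) simp
    then show "close_pmf (real K * \<delta>) (map_pmf ((+) z) (iid_sum K M)) (map_pmf ((+) z) (iid_sum K N))"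
      by simp
  qed (use assms in auto)
  then show ?case by (simp add: algebra_simps)
qed

lemma computable_iid_sum:
  assumes "computable c M"
  shows "computable (K * c) (\<lambda>x y. iid_sum K (M x y))"
proof (induction K)
  case 0
  show ?case by (simp add: computable_return)
next
  case (Suc K)
  have "computable (c + K * c) (\<lambda>x y. bind_pmf (M x y) (\<lambda>z. map_pmf ((+) z) (iid_sum K (M x y))))"
    by (intro computable_bind computable_map assms Suc)
  then show ?case by simp
qed

text \<open>Mean and variance are proved together: the cross term in the variance vanishes by the
  statement on the mean. The additive map \<open>\<phi>\<close> will be \<open>fst\<close> or
  \<open>snd\<close>.\<close>

lemma iid_sum_moments:
  fixes \<phi> :: "'a::comm_monoid_add \<Rightarrow> real"
  assumes fin: "finite (set_pmf M)" and add: "\<And>x y. \<phi> (x + y) = \<phi> x + \<phi> y"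
    and m: "m = measure_pmf.expectation M \<phi>"
  shows "measure_pmf.expectation (iid_sum K M) (\<lambda>s. \<phi> s - real K * m) = 0 \<and>
    measure_pmf.expectation (iid_sum K M) (\<lambda>s. (\<phi> s - real K * m)\<^sup>2)
      = real K * measure_pmf.expectation M (\<lambda>x. (\<phi> x - m)\<^sup>2)"
proof (induction K)
  case 0
  have "\<phi> 0 = 0" using add[of 0 0] by simp
  then show ?case by simp
next
  case (Suc K)
  note fs = finite_set_iid_sum[OF fin]
  have int: "integrable (measure_pmf (iid_sum K M)) f" for f :: "'a \<Rightarrow> real"
    by (intro integrable_measure_pmf_finite fs)
  have intM: "integrable (measure_pmf M) f" for f :: "'a \<Rightarrow> real"
    by (intro integrable_measure_pmf_finite fin)
  let ?EK = "measure_pmf.expectation (iid_sum K M)" and ?EM = "measure_pmf.expectation M"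
  have step: "measure_pmf.expectation (iid_sum (Suc K) M) f = ?EM (\<lambda>x. ?EK (\<lambda>s. f (x + s)))"
    for f :: "'a \<Rightarrow> real"
    using fin fs by (simp add: expectation_bind_pmf_finite)
  have mean0: "?EM (\<lambda>x. \<phi> x - m) = 0"
    using m by (simp add: Bochner_Integration.integral_diff[OF intM])
  have e: "\<phi> (x + s) - real (Suc K) * m = (\<phi> x - m) + (\<phi> s - real K * m)" for x s
    by (simp add: add algebra_simps)
  have "measure_pmf.expectation (iid_sum (Suc K) M) (\<lambda>s. \<phi> s - real (Suc K) * m)
      = ?EM (\<lambda>x. (\<phi> x - m) + ?EK (\<lambda>s. \<phi> s - real K * m))"
    unfolding step e
    by (subst Bochner_Integration.integral_add[OF int int]) simp
  also have "\<dots> = 0" using Suc mean0 by simp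
  finally have 1: "measure_pmf.expectation (iid_sum (Suc K) M) (\<lambda>s. \<phi> s - real (Suc K) * m) = 0" .
  have "measure_pmf.expectation (iid_sum (Suc K) M) (\<lambda>s. (\<phi> s - real (Suc K) * m)\<^sup>2)
      = ?EM (\<lambda>x. ?EK (\<lambda>s. (\<phi> x - m)\<^sup>2 + ((\<phi> s - real K * m)\<^sup>2 + 2 * (\<phi> x - m) * (\<phi> s - real K * m))))"
    unfolding step e power2_sum by (simp add: add.assoc)
  also have "\<dots> = ?EM (\<lambda>x. (\<phi> x - m)\<^sup>2 + (?EK (\<lambda>s. (\<phi> s - real K * m)\<^sup>2)
      + 2 * (\<phi> x - m) * ?EK (\<lambda>s. \<phi> s - real K * m)))"
    by (subst Bochner_Integration.integral_add[OF int int],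
        subst Bochner_Integration.integral_add[OF int int]) simp
  also have "\<dots> = ?EM (\<lambda>x. (\<phi> x - m)\<^sup>2 + real K * ?EM (\<lambda>x. (\<phi> x - m)\<^sup>2))"
    using Suc by simp
  also have "\<dots> = real (Suc K) * ?EM (\<lambda>x. (\<phi> x - m)\<^sup>2)"
    by (subst Bochner_Integration.integral_add[OF intM intM]) (simp add: algebra_simps)
  finally show ?case using 1 by blast
qed

text \<open>Chebyshev's inequality for a deviation of half the mean, with the variance bounded by
  the second moment.\<close>

lemma iid_sum_concentration:
  fixes \<phi> :: "'a::comm_monoid_add \<Rightarrow> real"
  assumes fin: "finite (set_pmf M)" and add: "\<And>x y. \<phi> (x + y) = \<phi> x + \<phi> y"
    and m: "m = measure_pmf.expectation M \<phi>" "0 < m" and "0 < K"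
  shows "measure_pmf.prob (iid_sum K M) {s. real K * m / 2 \<le> \<bar>\<phi> s - real K * m\<bar>}
    \<le> 4 * measure_pmf.expectation M (\<lambda>x. (\<phi> x)\<^sup>2) / (real K * m\<^sup>2)"
proof -
  have intM: "integrable (measure_pmf M) f" for f :: "'a \<Rightarrow> real"
    by (intro integrable_measure_pmf_finite fin)
  have int: "integrable (measure_pmf (iid_sum K M)) f" for f :: "'a \<Rightarrow> real"
    by (intro integrable_measure_pmf_finite finite_set_iid_sum fin)
  have "measure_pmf.expectation M (\<lambda>x. (\<phi> x - m)\<^sup>2)
      = measure_pmf.expectation M (\<lambda>x. (\<phi> x)\<^sup>2 + (m\<^sup>2 - 2 * m * \<phi> x))"
    by (intro Bochner_Integration.integral_cong) (auto simp: power2_diff)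
  also have "\<dots> = measure_pmf.expectation M (\<lambda>x. (\<phi> x)\<^sup>2) + (m\<^sup>2 - 2 * m * m)"
    using m by (subst Bochner_Integration.integral_add[OF intM intM],
        subst Bochner_Integration.integral_diff[OF intM intM]) simp
  finally have V: "measure_pmf.expectation M (\<lambda>x. (\<phi> x - m)\<^sup>2) \<le> measure_pmf.expectation M (\<lambda>x. (\<phi> x)\<^sup>2)"
    by (simp add: power2_eq_square)
  let ?c = "(real K * m / 2)\<^sup>2"
  have c: "0 < ?c" using assms by simp
  have "{s. real K * m / 2 \<le> \<bar>\<phi> s - real K * m\<bar>} = {s. ?c \<le> (\<phi> s - real K * m)\<^sup>2}"
    using assms by (auto simp: abs_le_square_iff[symmetric])
  then have "measure_pmf.prob (iid_sum K M) {s. real K * m / 2 \<le> \<bar>\<phi> s - real K * m\<bar>}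
      \<le> measure_pmf.expectation (iid_sum K M) (\<lambda>s. (\<phi> s - real K * m)\<^sup>2) / ?c"
    using integral_Markov_inequality_measure[OF int[of "\<lambda>s. (\<phi> s - real K * m)\<^sup>2"], of "{}" ?c] c
    by simp
  also have "\<dots> = real K * measure_pmf.expectation M (\<lambda>x. (\<phi> x - m)\<^sup>2) / ?c"
    using iid_sum_moments[OF fin add m(1), of K] by simp
  also have "\<dots> \<le> real K * measure_pmf.expectation M (\<lambda>x. (\<phi> x)\<^sup>2) / ?c"
    using V by (intro divide_right_mono mult_left_mono) auto
  also have "\<dots> = 4 * measure_pmf.expectation M (\<lambda>x. (\<phi> x)\<^sup>2) / (real K * m\<^sup>2)"
    using assms by (simp add: power2_eq_square field_simps)
  finally show ?thesis .
qed

subsection \<open>Estimating a weighted symmetric difference\<close>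

definition sym_diff_set :: "'e set \<Rightarrow> 'e set \<Rightarrow> 'e set" where
  "sym_diff_set A B = (A - B) \<union> (B - A)"

text \<open>Beyond the end of the list both predicates are false, so no difference is ever found
  there.\<close>

definition search_list :: "nat \<Rightarrow> nat \<Rightarrow> 'e list \<Rightarrow> 'e set \<Rightarrow> 'e set \<Rightarrow> nat pmf" where
  "search_list b k es A B =
     search b k 0 (\<lambda>t. t < length es \<and> es ! t \<in> A) (\<lambda>t. t < length es \<and> es ! t \<in> B)"

definition first_diff_list :: "nat \<Rightarrow> 'e list \<Rightarrow> 'e set \<Rightarrow> 'e set \<Rightarrow> nat" where
  "first_diff_list k es A B =
     first_diff k 0 (\<lambda>t. t < length es \<and> es ! t \<in> A) (\<lambda>t. t < length es \<and> es ! t \<in> B)"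

lemma first_diff_list_props:
  assumes "length es < 2 ^ k"
  shows "\<And>s. s < first_diff_list k es A B \<Longrightarrow> s < length es \<Longrightarrow> es ! s \<notin> sym_diff_set A B"
    and "first_diff_list k es A B < length es \<Longrightarrow> es ! first_diff_list k es A B \<in> sym_diff_set A B"
  using first_diff_props[of 0 k "\<lambda>t. t < length es \<and> es ! t \<in> A" "\<lambda>t. t < length es \<and> es ! t \<in> B"]
    assms unfolding first_diff_list_def sym_diff_set_def by auto

text \<open>With \<open>2 ^ k - 1\<close> draws the last index of the search window is free to
  signal that nothing was hit. The value \<open>h (es ! t)\<close> stands inside
  \<open>return_pmf\<close> because it will be something that the players obtain by communicating,
  and only for the one index found.\<close>

definition trial :: "nat \<Rightarrow> nat \<Rightarrow> 'e pmf \<Rightarrow> ('e \<Rightarrow> real) \<Rightarrow> 'e set \<Rightarrow> 'e set \<Rightarrow> (real \<times> real) pmf" where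
  "trial b k Q h A B = bind_pmf (replicate_pmf (2 ^ k - 1) Q) (\<lambda>es.
     bind_pmf (search_list b k es A B) (\<lambda>t.
       if t < 2 ^ k - 1 then map_pmf (\<lambda>r. (r, real t + 1)) (return_pmf (h (es ! t)))
       else return_pmf (0, real (2 ^ k - 1))))"

definition ideal_trial :: "nat \<Rightarrow> 'e pmf \<Rightarrow> ('e \<Rightarrow> real) \<Rightarrow> 'e set \<Rightarrow> (real \<times> real) pmf" where
  "ideal_trial k Q h D = map_pmf (\<lambda>es. (reward D h es, hit_time D es)) (replicate_pmf (2 ^ k - 1) Q)"

lemma trial_close:
  "close_pmf (real k * (1 / 2) ^ b) (trial b k Q h A B) (ideal_trial k Q h (sym_diff_set A B))"
proof -
  have "close_pmf (real k * (1 / 2) ^ b) (trial b k Q h A B)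
     (bind_pmf (replicate_pmf (2 ^ k - 1) Q) (\<lambda>es.
        return_pmf (reward (sym_diff_set A B) h es, hit_time (sym_diff_set A B) es)))"
    unfolding trial_def
  proof (rule close_pmf_bind_right)
    fix es assume "es \<in> set_pmf (replicate_pmf (2 ^ k - 1) Q)"
    then have len: "length es = 2 ^ k - 1" using set_replicate_pmf_subset by blast
    then have "length es < 2 ^ k" by simp
    note fd = first_diff_list_props[OF this, where A = A and B = B]
    let ?t = "first_diff_list k es A B" and ?D = "sym_diff_set A B"
    have eq: "(if ?t < 2 ^ k - 1 then map_pmf (\<lambda>r. (r, real ?t + 1)) (return_pmf (h (es ! ?t)))
       else return_pmf (0, real (2 ^ k - 1))) = return_pmf (reward ?D h es, hit_time ?D es)"
    proof (cases "?t < length es")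
      case True
      then show ?thesis using reward_hit_time_nth[of ?t es ?D h] fd len by auto
    next
      case False
      then have "reward ?D h es = 0 \<and> hit_time ?D es = length es"
        using fd(1) by (intro reward_hit_time_none) auto
      then show ?thesis using False len by simp
    qed
    have "close_pmf (real k * (1 / 2) ^ b + 0) (bind_pmf (search_list b k es A B) (\<lambda>t.
       if t < 2 ^ k - 1 then map_pmf (\<lambda>r. (r, real t + 1)) (return_pmf (h (es ! t)))
       else return_pmf (0, real (2 ^ k - 1))))
      (bind_pmf (return_pmf ?t) (\<lambda>t.
       if t < 2 ^ k - 1 then map_pmf (\<lambda>r. (r, real t + 1)) (return_pmf (h (es ! t)))
       else return_pmf (0, real (2 ^ k - 1))))"
      unfolding search_list_def first_diff_list_def
      by (intro close_pmf_bind search_close close_pmf_refl) simp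
    then show "close_pmf (real k * (1 / 2) ^ b) (bind_pmf (search_list b k es A B) (\<lambda>t.
       if t < 2 ^ k - 1 then map_pmf (\<lambda>r. (r, real t + 1)) (return_pmf (h (es ! t)))
       else return_pmf (0, real (2 ^ k - 1))))
       (return_pmf (reward ?D h es, hit_time ?D es))"
      unfolding bind_return_pmf eq by simp
  qed simp
  then show ?thesis unfolding ideal_trial_def map_pmf_def .
qed

lemma computable_trial:
  assumes "\<And>e. e \<in> set_pmf Q \<Longrightarrow> computable c (\<lambda>x y. return_pmf (g e x y))"
  shows "computable (k * (2 * b) + c) (\<lambda>x y. trial b k Q (\<lambda>e. g e x y) (A x) (B y))"
  unfolding trial_def
proof (rule computable_coins)
  fix es assume "es \<in> set_pmf (replicate_pmf (2 ^ k - 1) Q)"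
  then have es: "length es = 2 ^ k - 1" "set es \<subseteq> set_pmf Q" using set_replicate_pmf_subset by blast+
  show "computable (k * (2 * b) + c) (\<lambda>x y. bind_pmf (search_list b k es (A x) (B y)) (\<lambda>t.
       if t < 2 ^ k - 1 then map_pmf (\<lambda>r. (r, real t + 1)) (return_pmf (g (es ! t) x y))
       else return_pmf (0, real (2 ^ k - 1))))"
    unfolding search_list_def
  proof (intro computable_bind computable_search)
    fix t
    show "computable c (\<lambda>x y. if t < 2 ^ k - 1
        then map_pmf (\<lambda>r. (r, real t + 1)) (return_pmf (g (es ! t) x y))
        else return_pmf (0, real (2 ^ k - 1)))"
    proof (cases "t < 2 ^ k - 1")
      case True
      then have "es ! t \<in> set_pmf Q" using es by auto
      then show ?thesis using True computable_map[OF assms] by (simp del: map_return_pmf)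
    next
      case False
      then show ?thesis using computable_mono[OF computable_return le0] by simp
    qed
  qed
qed

text \<open>By Wald's identity the ratio of the two means is
  \<open>mean_reward = Z / sum w S\<close>. With both sums within a factor in
  \<open>[1/2, 3/2]\<close> of their means, the quotient is correct up to a factor 3 in each
  direction, and the multiplier 4 makes it an overestimate. The heaviest item \<open>e0\<close>
  belongs to the difference, so a draw hits with probability at least
  \<open>1 / card S\<close>.\<close>

lemma ideal_trial_sum:
  assumes "finite S" "\<And>e. e \<in> S \<Longrightarrow> 0 < w e"
    and h: "\<And>e. e \<in> S \<inter> D \<Longrightarrow> 1 \<le> h e \<and> h e \<le> G" and "1 \<le> G"
    and e0: "e0 \<in> S \<inter> D" "\<And>e. e \<in> S \<Longrightarrow> w e \<le> w e0"
    and k: "card S < 2 ^ k" and K: "1000 * G \<le> real K"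
  defines "Z \<equiv> (\<Sum>e\<in>S \<inter> D. w e * h e)"
  shows "19 / 20 \<le> measure_pmf.prob (iid_sum K (ideal_trial k (weighted_pmf S w) h D))
     {s. Z \<le> 4 * sum w S * fst s / snd s \<and> 4 * sum w S * fst s / snd s \<le> 16 * Z}"
proof -
  define Q where "Q = weighted_pmf S w"
  define N :: nat where "N = 2 ^ k - 1"
  have ne: "S \<noteq> {}" using e0 by auto
  note ws = assms(1) ne assms(2)
  have setQ: "set_pmf Q = S" unfolding Q_def by (rule set_weighted_pmf[OF ws])
  interpret first_hit Q D h G
    by unfold_locales (use setQ assms in auto)
  have W: "0 < sum w S" using ws by (intro sum_pos) auto
  have p: "hit_prob = (\<Sum>e\<in>S \<inter> D. w e) / sum w S"
    using hit_prob_expectation assms(1) expectation_weighted_pmf[OF ws, where f = "indicator D"]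
    by (simp add: Q_def sum.inter_restrict indicator_def if_distrib cong: if_cong)
  have z: "mean_reward = Z / sum w S"
  proof -
    have "Z = (\<Sum>e\<in>S. w e * (indicator D e * h e))"
      unfolding Z_def sum.inter_restrict[OF assms(1)] by (intro sum.cong) auto
    then show ?thesis
      using mean_reward_def expectation_weighted_pmf[OF ws, where f = "\<lambda>e. indicator D e * h e"]
      by (simp only: Q_def)
  qed
  have w0: "0 < w e0" using e0 assms(2) by auto
  let ?wD = "\<Sum>e\<in>S \<inter> D. w e"
  have wD: "w e0 \<le> ?wD"
    using e0 assms(1,2) by (intro member_le_sum) (auto intro: less_imp_le)
  have "card S \<le> N" using k unfolding N_def by simp
  then have cN: "real (card S) \<le> real N" by simp
  have "sum w S \<le> real (card S) * w e0"
    using sum_bounded_above[of S w "w e0"] e0(2) by auto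
  also have "\<dots> \<le> real N * ?wD" using cN wD w0 by (intro mult_mono) auto
  finally have "sum w S \<le> real N * ?wD" .
  then have pN: "1 \<le> hit_prob * real N" "0 < hit_prob"
    unfolding p using W w0 wD by (simp_all add: field_simps)
  define M where "M = ideal_trial k Q h D"
  have finM: "finite (set_pmf M)"
    unfolding M_def ideal_trial_def by (simp add: set_replicate_pmf_finite finite_Q)
  define mr where "mr = measure_pmf.expectation M fst"
  define mt where "mt = measure_pmf.expectation M snd"
  have mr: "mr = mean_reward * mt" "mt = E N (hit_time D)" "mr = E N (reward D h)"
    unfolding mr_def mt_def M_def ideal_trial_def N_def[symmetric] by (simp_all add: E_reward)
  have mt1: "1 \<le> 2 * hit_prob * mt" using E_time_lower[OF pN(1)] mr by simp
  have "mt \<noteq> 0" using mt1 by auto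
  then have mtpos: "0 < mt" using E_time_nonneg[of N] mr(2) by simp
  have "hit_prob * mt \<le> mr" unfolding mr(1) using mean_reward_lower mtpos by (intro mult_right_mono) auto
  then have mr1: "1 \<le> 2 * mr" using mt1 by simp
  have Kpos: "0 < K" using K \<open>1 \<le> G\<close> by (cases K) auto
  \<comment> \<open>After scaling with \<open>hit_prob\<close> the second moment is at most 2 and
    the mean at least 1/2: \<open>4 * 2 / (1000 / 4)\<close>.\<close>
  have bt: "measure_pmf.prob (iid_sum K M) {s. real K * mt / 2 \<le> \<bar>snd s - real K * mt\<bar>} \<le> 32 / 1000"
  proof -
    have "measure_pmf.prob (iid_sum K M) {s. real K * mt / 2 \<le> \<bar>snd s - real K * mt\<bar>}
        \<le> 4 * measure_pmf.expectation M (\<lambda>x. (snd x)\<^sup>2) / (real K * mt\<^sup>2)"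
      by (rule iid_sum_concentration[OF finM _ mt_def mtpos Kpos]) simp
    also have "\<dots> = 4 * (hit_prob\<^sup>2 * E N (\<lambda>es. (hit_time D es)\<^sup>2)) / (real K * (hit_prob * mt)\<^sup>2)"
      using pN(2) unfolding M_def ideal_trial_def N_def[symmetric] by (simp add: power_mult_distrib)
    also have "\<dots> \<le> 4 * 2 / (1000 * (1 / 2)\<^sup>2)"
    proof -
      have "(1 / 2)\<^sup>2 \<le> (hit_prob * mt)\<^sup>2" using mt1 by (intro power_mono) auto
      then have "1000 * (1 / 2)\<^sup>2 \<le> real K * (hit_prob * mt)\<^sup>2"
        using K \<open>1 \<le> G\<close> by (intro mult_mono) auto
      then show ?thesis using E_time_square[of N] by (intro frac_le) auto
    qed
    finally show ?thesis by (simp add: power2_eq_square)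
  qed
  \<comment> \<open>Here the number of trials must grow with \<open>G\<close>: the second moment is
    at most \<open>G * mr\<close> and \<open>mr \<ge> 1/2\<close>.\<close>
  have br: "measure_pmf.prob (iid_sum K M) {s. real K * mr / 2 \<le> \<bar>fst s - real K * mr\<bar>} \<le> 8 / 1000"
  proof -
    have "measure_pmf.prob (iid_sum K M) {s. real K * mr / 2 \<le> \<bar>fst s - real K * mr\<bar>}
        \<le> 4 * measure_pmf.expectation M (\<lambda>x. (fst x)\<^sup>2) / (real K * mr\<^sup>2)"
      by (rule iid_sum_concentration[OF finM _ mr_def _ Kpos]) (use mr1 in auto)
    also have "\<dots> \<le> 4 * (G * mr) / (real K * mr\<^sup>2)"
      using E_reward_square[of N] mr(3) mr1 unfolding M_def ideal_trial_def N_def[symmetric]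
      by (intro divide_right_mono mult_left_mono) auto
    also have "\<dots> = 4 * G / (real K * mr)"
      using mr1 by (simp add: power2_eq_square)
    also have "\<dots> \<le> 4 * G / ((1000 * G) * (1 / 2))"
    proof -
      have "1000 * G * (1 / 2) \<le> real K * mr" using K \<open>1 \<le> G\<close> mr1 by (intro mult_mono) auto
      then show ?thesis using \<open>1 \<le> G\<close> by (intro frac_le) auto
    qed
    finally show ?thesis using \<open>1 \<le> G\<close> by simp
  qed
  let ?bad = "{s. real K * mt / 2 \<le> \<bar>snd s - real K * mt\<bar>} \<union> {s. real K * mr / 2 \<le> \<bar>fst s - real K * mr\<bar>}"
  let ?good = "{s. Z \<le> 4 * sum w S * fst s / snd s \<and> 4 * sum w S * fst s / snd s \<le> 16 * Z}"
  have "- ?bad \<subseteq> ?good"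
  proof (intro subsetI)
    fix s assume s: "s \<in> - ?bad"
    define r where "r = fst s"
    define t where "t = snd s"
    from s have "\<bar>t - real K * mt\<bar> < real K * mt / 2" "\<bar>r - real K * mr\<bar> < real K * mr / 2"
      unfolding Compl_iff Un_iff mem_Collect_eq de_Morgan_disj not_le r_def t_def by blast+
    then have t: "real K * mt / 2 < t" "t < 3 * (real K * mt / 2)"
      and r: "real K * mr / 2 < r" "r < 3 * (real K * mr / 2)" by linarith+
    have "0 < real K * mt / 2" using mtpos Kpos by simp
    then have tpos: "0 < t" using t(1) by linarith
    \<comment> \<open>A common unit for both sums: \<open>q\<close> is \<open>Z\<close> times half
      the mean total time and equally \<open>sum w S\<close> times half the mean total
      reward.\<close>
    define q where "q = Z * (real K * mt / 2)"
    have q: "sum w S * (real K * mr / 2) = q"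
      unfolding q_def mr(1) z using W by simp
    have Z0: "0 \<le> Z" unfolding Z_def using h assms(2)
      by (intro sum_nonneg mult_nonneg_nonneg) (auto intro: less_imp_le order_trans[of 0 1])
    then have q0: "0 \<le> q" unfolding q_def using \<open>0 < real K * mt / 2\<close> by (intro mult_nonneg_nonneg) auto
    note mult_left_mono[OF less_imp_le[OF t(2)] Z0] mult_left_mono[OF less_imp_le[OF t(1)] Z0]
    then have zt: "Z * t \<le> 3 * q" "q \<le> Z * t" by (simp_all only: q_def mult.left_commute)
    note mult_left_mono[OF less_imp_le[OF r(2)] less_imp_le[OF W]]
      mult_left_mono[OF less_imp_le[OF r(1)] less_imp_le[OF W]]
    then have "sum w S * r \<le> 3 * q" "q \<le> sum w S * r" by (simp_all only: q mult.left_commute[of _ 3])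
    then have "Z * t \<le> 4 * (sum w S * r)" "4 * (sum w S * r) \<le> 16 * (Z * t)"
      using zt q0 by linarith+
    then show "s \<in> ?good"
      using tpos unfolding r_def t_def by (simp add: field_simps)
  qed
  then have "measure_pmf.prob (iid_sum K M) (- ?bad) \<le> measure_pmf.prob (iid_sum K M) ?good"
    by (intro measure_pmf.finite_measure_mono) auto
  moreover have "measure_pmf.prob (iid_sum K M) (- ?bad) = 1 - measure_pmf.prob (iid_sum K M) ?bad"
    using measure_pmf.prob_compl[of ?bad "iid_sum K M"] by (simp add: Compl_eq_Diff_UNIV)
  moreover have "measure_pmf.prob (iid_sum K M) ?bad \<le> 32 / 1000 + 8 / 1000"
    using bt br measure_Un_le[of "{s. real K * mt / 2 \<le> \<bar>snd s - real K * mt\<bar>}" "iid_sum K M"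
       "{s. real K * mr / 2 \<le> \<bar>fst s - real K * mr\<bar>}"] by simp
  ultimately show ?thesis unfolding M_def Q_def by linarith
qed

text \<open>
  Searching a list of the items in decreasing order of weight yields the heaviest differing item;
  after discarding all heavier items a weighted sample hits the difference with probability at least
  \<open>1 / card U\<close>, however spread out the weights are.
\<close>

lemma estimate_sym_diff:
  fixes w :: "'e \<Rightarrow> real" and A :: "'x \<Rightarrow> 'e set" and B :: "'y \<Rightarrow> 'e set"
  assumes fin: "finite U" and pos: "\<And>e. e \<in> U \<Longrightarrow> 0 < w e"
    and k: "card U < 2 ^ k" and G: "1 \<le> G" and K: "1000 * G \<le> real K"
    and \<delta>: "(real K + 1) * (real k * (1 / 2) ^ b) \<le> 1 / 20"
    and comp: "\<And>e. e \<in> U \<Longrightarrow> computable c (\<lambda>x y. return_pmf (g e x y))"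
  shows "\<exists>F. computable (k * (2 * b) + K * (k * (2 * b) + c)) F \<and>
    (\<forall>x y. (\<forall>e\<in>U \<inter> sym_diff_set (A x) (B y). 1 \<le> g e x y \<and> g e x y \<le> G) \<longrightarrow>
       9 / 10 \<le> measure_pmf.prob (F x y)
         {z. (\<Sum>e\<in>U \<inter> sym_diff_set (A x) (B y). w e * g e x y) \<le> z \<and>
             z \<le> 16 * (\<Sum>e\<in>U \<inter> sym_diff_set (A x) (B y). w e * g e x y)})"
proof -
  define us where "us = rev (sort_key w (SOME xs. set xs = U \<and> distinct xs))"
  have "set (SOME xs. set xs = U \<and> distinct xs) = U \<and> distinct (SOME xs. set xs = U \<and> distinct xs)"
    by (rule someI_ex) (rule finite_distinct_list[OF fin])
  then have us: "set us = U" "distinct us" "sorted (map w (rev us))"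
    by (simp_all add: us_def)
  have len: "length us = card U" using distinct_card[OF us(2)] us(1) by simp
  have dec: "w (us ! j) \<le> w (us ! i)" if "i \<le> j" "j < length us" for i j
  proof -
    have "map w (rev us) ! (length us - 1 - j) \<le> map w (rev us) ! (length us - 1 - i)"
      using that us(3) by (intro sorted_nth_mono) auto
    then show ?thesis using that by (simp add: rev_nth)
  qed
  \<comment> \<open>Defined by weight and not by index, so that items of equal weight are kept.
    After the search \<open>i\<close> is known to both players, hence the sampling distribution on
    \<open>T i\<close> is public.\<close>
  define T where "T i = {e\<in>U. w e \<le> w (us ! i)}" for i
  define \<Phi> where "\<Phi> i = (\<lambda>s :: real \<times> real. 4 * sum w (T i) * fst s / snd s)" for i
  \<comment> \<open>An index beyond the list means that no item differs; then the sum to be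
    estimated is \<open>0\<close>.\<close>
  define F where "F x y = bind_pmf (search_list b k us (A x) (B y)) (\<lambda>i. if i < length us
     then map_pmf (\<Phi> i) (iid_sum K (trial b k (weighted_pmf (T i) w) (\<lambda>e. g e x y) (A x) (B y)))
     else return_pmf 0)" for x y
  have T: "finite (T i)" "\<And>e. e \<in> T i \<Longrightarrow> 0 < w e" "T i \<subseteq> U" for i
    using fin pos by (auto simp: T_def)
  have Ti: "us ! i \<in> T i" if "i < length us" for i using that us(1) by (auto simp: T_def)
  have "computable (k * (2 * b) + K * (k * (2 * b) + c)) F"
    unfolding F_def search_list_def
  proof (intro computable_bind computable_search)
    fix i
    show "computable (K * (k * (2 * b) + c)) (\<lambda>x y. if i < length us
     then map_pmf (\<Phi> i) (iid_sum K (trial b k (weighted_pmf (T i) w) (\<lambda>e. g e x y) (A x) (B y)))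
     else return_pmf 0)"
    proof (cases "i < length us")
      case True
      have "set_pmf (weighted_pmf (T i) w) \<subseteq> U"
        using set_weighted_pmf[of "T i" w] T Ti[OF True] by blast
      then have "computable (K * (k * (2 * b) + c)) (\<lambda>x y. map_pmf (\<Phi> i)
          (iid_sum K (trial b k (weighted_pmf (T i) w) (\<lambda>e. g e x y) (A x) (B y))))"
        by (intro computable_map computable_iid_sum computable_trial comp) auto
      then show ?thesis using True by simp
    next
      case False
      then show ?thesis using computable_mono[OF computable_return le0] by simp
    qed
  qed
  moreover have "9 / 10 \<le> measure_pmf.prob (F x y)
         {z. (\<Sum>e\<in>U \<inter> sym_diff_set (A x) (B y). w e * g e x y) \<le> z \<and>
             z \<le> 16 * (\<Sum>e\<in>U \<inter> sym_diff_set (A x) (B y). w e * g e x y)}"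
    if gb: "\<forall>e\<in>U \<inter> sym_diff_set (A x) (B y). 1 \<le> g e x y \<and> g e x y \<le> G" for x y
  proof -
    let ?D = "sym_diff_set (A x) (B y)"
    let ?Z = "\<Sum>e\<in>U \<inter> ?D. w e * g e x y"
    let ?h = "\<lambda>e. g e x y"
    let ?E = "{z. ?Z \<le> z \<and> z \<le> 16 * ?Z}"
    let ?i = "first_diff_list k us (A x) (B y)"
    define I where "I i = (if i < length us
       then map_pmf (\<Phi> i) (iid_sum K (ideal_trial k (weighted_pmf (T i) w) ?h ?D))
       else return_pmf 0)" for i
    have "length us < 2 ^ k" using len k by simp
    note fd = first_diff_list_props[OF this, where A = "A x" and B = "B y"]
    \<comment> \<open>One search for the heaviest difference and one in each of the \<open>K\<close>
      trials; the total error \<open>1 / 20\<close> is what separates the \<open>19 / 20\<close> of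
      the ideal trials from the \<open>9 / 10\<close> claimed.\<close>
    have "close_pmf (real k * (1 / 2) ^ b + real K * (real k * (1 / 2) ^ b)) (F x y)
            (bind_pmf (return_pmf ?i) I)"
      unfolding F_def
    proof (intro close_pmf_bind)
      show "close_pmf (real k * (1 / 2) ^ b) (search_list b k us (A x) (B y)) (return_pmf ?i)"
        unfolding search_list_def first_diff_list_def by (rule search_close)
      fix i
      show "close_pmf (real K * (real k * (1 / 2) ^ b)) (if i < length us
          then map_pmf (\<Phi> i) (iid_sum K (trial b k (weighted_pmf (T i) w) ?h (A x) (B y)))
          else return_pmf 0) (I i)"
      proof (cases "i < length us")
        case True
        have "close_pmf (real K * (real k * (1 / 2) ^ b) + 0)
           (map_pmf (\<Phi> i) (iid_sum K (trial b k (weighted_pmf (T i) w) ?h (A x) (B y))))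
           (map_pmf (\<Phi> i) (iid_sum K (ideal_trial k (weighted_pmf (T i) w) ?h ?D)))"
          unfolding map_pmf_def
          by (intro close_pmf_bind close_pmf_iid_sum trial_close close_pmf_refl) auto
        then show ?thesis using True by (simp add: I_def)
      next
        case False
        then show ?thesis
          using close_pmf_mono[OF close_pmf_refl, of "real K * (real k * (1 / 2) ^ b)"] by (simp add: I_def)
      qed
    qed simp
    then have "measure_pmf.prob (I ?i) ?E
        \<le> measure_pmf.prob (F x y) ?E + (real k * (1 / 2) ^ b + real K * (real k * (1 / 2) ^ b))"
      unfolding bind_return_pmf by (rule close_pmf_prob)
    moreover have "(real k * (1 / 2) ^ b + real K * (real k * (1 / 2) ^ b)) \<le> 1 / 20"
      using \<delta> by (simp add: algebra_simps)
    moreover have "19 / 20 \<le> measure_pmf.prob (I ?i) ?E"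
    proof (cases "?i < length us")
      case True
      have DT: "U \<inter> ?D = T ?i \<inter> ?D"
      proof (intro equalityI subsetI)
        fix e assume e: "e \<in> U \<inter> ?D"
        then obtain j where j: "j < length us" "us ! j = e" using us(1) by (auto simp: in_set_conv_nth)
        have "?i \<le> j" using fd(1)[of j] j e by (meson IntD2 not_le)
        then show "e \<in> T ?i \<inter> ?D" using dec[of ?i j] j e by (auto simp: T_def)
      qed (use T(3) in blast)
      have "card (T ?i) < 2 ^ k" using card_mono[OF fin T(3)[of ?i]] k by simp
      then have "19 / 20 \<le> measure_pmf.prob (iid_sum K (ideal_trial k (weighted_pmf (T ?i) w) ?h ?D))
        {s. (\<Sum>e\<in>T ?i \<inter> ?D. w e * ?h e) \<le> 4 * sum w (T ?i) * fst s / snd s \<and>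
            4 * sum w (T ?i) * fst s / snd s \<le> 16 * (\<Sum>e\<in>T ?i \<inter> ?D. w e * ?h e)}"
        using gb[unfolded DT] Ti[OF True] fd(2)[OF True] T G K
        by (intro ideal_trial_sum[where ?e0.0 = "us ! ?i" and G = G]) (auto simp: T_def)
      then show ?thesis using True by (simp add: I_def DT \<Phi>_def vimage_def)
    next
      case False
      have "U \<inter> ?D = {}"
      proof (rule ccontr)
        assume "U \<inter> ?D \<noteq> {}"
        then obtain j where "j < length us" "us ! j \<in> ?D" using us(1) by (metis disjoint_iff in_set_conv_nth)
        then show False using fd(1)[of j] False by auto
      qed
      then show ?thesis using False by (simp add: I_def)
    qed
    ultimately show ?thesis by linarith
  qed
  ultimately show ?thesis by blast
qed

subsection \<open>Transshipment\<close>

definition plan_cost :: "'a set \<Rightarrow> ('a \<Rightarrow> 'a \<Rightarrow> real) \<Rightarrow> ('a \<Rightarrow> 'a \<Rightarrow> real) \<Rightarrow> real" where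
  "plan_cost X d f = (\<Sum>p\<in>X. \<Sum>q\<in>X. d p q * f p q)"

text \<open>Transshipment: mass may be relayed through intermediate points and only the net surplus
  is prescribed. Hence costs are subadditive in the surplus, which transport plans with fixed
  marginals do not offer directly.\<close>

definition flows :: "'a set \<Rightarrow> ('a \<Rightarrow> real) \<Rightarrow> ('a \<Rightarrow> 'a \<Rightarrow> real) set" where
  "flows X \<tau> = {f. (\<forall>p\<in>X. \<forall>q\<in>X. 0 \<le> f p q) \<and>
     (\<forall>p\<in>X. (\<Sum>q\<in>X. f p q) - (\<Sum>q\<in>X. f q p) = \<tau> p)}"

definition shipping_cost :: "'a set \<Rightarrow> ('a \<Rightarrow> 'a \<Rightarrow> real) \<Rightarrow> ('a \<Rightarrow> real) \<Rightarrow> real" where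
  "shipping_cost X d \<tau> = (INF f\<in>flows X \<tau>. plan_cost X d f)"

lemma sum_of_bool_mult:
  fixes g :: "'a \<Rightarrow> real"
  assumes "finite X" "z \<in> X"
  shows "(\<Sum>p\<in>X. of_bool (z = p) * g p) = g z"
proof -
  have "(\<Sum>p\<in>X. of_bool (z = p) * g p) = (\<Sum>p\<in>X. if p = z then g p else 0)"
    by (intro sum.cong) auto
  then show ?thesis using assms by simp
qed

locale finite_metric = Metric_space X d for X :: "'a set" and d +
  assumes finite_X: "finite X"
begin

lemma plan_cost_nonneg: "(\<And>p q. p \<in> X \<Longrightarrow> q \<in> X \<Longrightarrow> 0 \<le> f p q) \<Longrightarrow> 0 \<le> plan_cost X d f"
  unfolding plan_cost_def by (intro sum_nonneg mult_nonneg_nonneg) auto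

text \<open>
  Mass \<open>k\<close> that enters and leaves \<open>v\<close> is sent directly from its sources to its destinations, in
  proportion to the incoming and outgoing amounts.
\<close>

lemma reroute:
  assumes \<pi>: "\<pi> \<in> transport_plans X (\<lambda>p. \<mu> p + (if p = v then k else 0)) (\<lambda>p. \<nu> p + (if p = v then k else 0))"
    and v: "v \<in> X" "0 \<le> \<mu> v" "0 \<le> \<nu> v" "0 < k" "\<pi> v v = 0"
  shows "\<exists>\<pi>'\<in>transport_plans X \<mu> \<nu>. plan_cost X d \<pi>' \<le> plan_cost X d \<pi>"
proof -
  define a where "a w = \<pi> v w" for w
  define b where "b u = \<pi> u v" for u
  define A where "A = \<mu> v + k"
  define B where "B = \<nu> v + k"
  have AB: "0 < A" "0 < B" "k \<le> A" "k \<le> B" using v by (auto simp: A_def B_def)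
  have sa: "sum a X = A" and sb: "sum b X = B"
    using \<pi> v(1) by (auto simp: transport_plans_def a_def b_def A_def B_def)
  have nn: "0 \<le> \<pi> p q" if "p \<in> X" "q \<in> X" for p q using \<pi> that by (auto simp: transport_plans_def)
  have na: "0 \<le> a w" "0 \<le> b w" if "w \<in> X" for w using nn v(1) that by (auto simp: a_def b_def)
  have av: "a v = 0" "b v = 0" using v by (auto simp: a_def b_def)
  \<comment> \<open>\<open>A\<close> and \<open>B\<close> are the total outgoing and incoming masses
    of \<open>v\<close>. Row \<open>v\<close> gives up the fraction \<open>k / A\<close> and column
    \<open>v\<close> the fraction \<open>k / B\<close>; the product term has just these marginals.
    At \<open>u = w = v\<close> nothing is removed because \<open>a v = b v = 0\<close>.\<close>
  define \<pi>' where "\<pi>' u w = \<pi> u w + k / (A * B) * (b u * a w)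
      - (if u = v then k / A * a w else 0) - (if w = v then k / B * b u else 0)" for u w
  have "0 \<le> \<pi>' u w" if uw: "u \<in> X" "w \<in> X" for u w
  proof -
    have fr: "k / A * c \<le> c" "k / B * c \<le> c" if "0 \<le> c" for c
      using mult_right_mono[of "k / A" 1 c] mult_right_mono[of "k / B" 1 c] AB that by simp_all
    have "0 \<le> k / (A * B) * (b u * a w)" using AB v na uw by (intro mult_nonneg_nonneg) auto
    then show ?thesis
      using fr(1)[OF na(1)[OF uw(2)]] fr(2)[OF na(2)[OF uw(1)]] nn[OF uw] av v(5)
      unfolding \<pi>'_def by (cases "u = v"; cases "w = v") (auto simp: a_def b_def)
  qed
  moreover have "(\<Sum>w\<in>X. \<pi>' u w) = \<mu> u" if "u \<in> X" for u
  proof -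
    have "(\<Sum>w\<in>X. \<pi>' u w) = (\<Sum>w\<in>X. \<pi> u w) + k / (A * B) * (b u * A)
        - (if u = v then k / A * A else 0) - k / B * b u"
      unfolding \<pi>'_def sa[symmetric] using finite_X v(1)
      by (simp add: sum.distrib sum_subtractf sum_distrib_left)
    then show ?thesis using \<pi> that AB by (simp add: transport_plans_def)
  qed
  moreover have "(\<Sum>u\<in>X. \<pi>' u w) = \<nu> w" if "w \<in> X" for w
  proof -
    have "(\<Sum>u\<in>X. \<pi>' u w) = (\<Sum>u\<in>X. \<pi> u w) + k / (A * B) * (B * a w)
        - k / A * a w - (if w = v then k / B * B else 0)"
      unfolding \<pi>'_def sb[symmetric] using finite_X v(1)
      by (simp add: sum.distrib sum_subtractf sum_distrib_left sum_distrib_right)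
    then show ?thesis using \<pi> that AB by (simp add: transport_plans_def)
  qed
  ultimately have "\<pi>' \<in> transport_plans X \<mu> \<nu>" by (auto simp: transport_plans_def)
  moreover have "plan_cost X d \<pi>' \<le> plan_cost X d \<pi>"
  proof -
    define P where "P = (\<Sum>u\<in>X. d u v * b u)"
    define R where "R = (\<Sum>w\<in>X. d v w * a w)"
    have s1: "(\<Sum>u\<in>X. \<Sum>w\<in>X. d u w * (if u = v then k / A * a w else 0)) = k / A * R"
      using finite_X v(1) unfolding R_def sum_distrib_left
      by (subst sum.swap) (auto simp: if_distrib cong: if_cong intro!: sum.cong)
    have s2: "(\<Sum>u\<in>X. \<Sum>w\<in>X. d u w * (if w = v then k / B * b u else 0)) = k / B * P"
      using finite_X v(1) unfolding P_def sum_distrib_left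
      by (auto simp: if_distrib cong: if_cong intro!: sum.cong)
    \<comment> \<open>The triangle inequality through \<open>v\<close>; the resulting bound is
      exactly what the removed parts of the plan cost.\<close>
    have "(\<Sum>u\<in>X. \<Sum>w\<in>X. d u w * (b u * a w)) \<le> (\<Sum>u\<in>X. \<Sum>w\<in>X. (d u v + d v w) * (b u * a w))"
      using v(1) na by (intro sum_mono mult_right_mono triangle) auto
    also have "\<dots> = (\<Sum>u\<in>X. \<Sum>w\<in>X. (d u v * b u) * a w) + (\<Sum>u\<in>X. \<Sum>w\<in>X. b u * (d v w * a w))"
      by (simp add: algebra_simps sum.distrib)
    also have "\<dots> = P * A + B * R"
      unfolding P_def R_def sa[symmetric] sb[symmetric] sum_product ..
    finally have "k / (A * B) * (\<Sum>u\<in>X. \<Sum>w\<in>X. d u w * (b u * a w)) \<le> k / (A * B) * (P * A + B * R)"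
      using AB v by (intro mult_left_mono) auto
    also have "\<dots> = k / B * P + k / A * R" using AB by (simp add: field_simps)
    finally have "k / (A * B) * (\<Sum>u\<in>X. \<Sum>w\<in>X. d u w * (b u * a w)) \<le> k / B * P + k / A * R" .
    moreover have "plan_cost X d \<pi>' = plan_cost X d \<pi>
        + k / (A * B) * (\<Sum>u\<in>X. \<Sum>w\<in>X. d u w * (b u * a w)) - k / A * R - k / B * P"
      unfolding plan_cost_def \<pi>'_def s1[symmetric] s2[symmetric] sum_distrib_left
      by (simp add: algebra_simps sum.distrib sum_subtractf)
    ultimately show ?thesis by linarith
  qed
  ultimately show ?thesis by blast
qed

text \<open>Mass that stays at \<open>v\<close> costs nothing and is removed first. Afterwards
  either all of \<open>k\<close> is gone or the diagonal entry at \<open>v\<close> is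
  \<open>0\<close>, as \<open>reroute\<close> demands.\<close>

lemma cancel_point:
  assumes \<pi>: "\<pi> \<in> transport_plans X (\<lambda>p. \<mu> p + (if p = v then k else 0)) (\<lambda>p. \<nu> p + (if p = v then k else 0))"
    and v: "v \<in> X" "0 \<le> \<mu> v" "0 \<le> \<nu> v" "0 \<le> k"
  shows "\<exists>\<pi>'\<in>transport_plans X \<mu> \<nu>. plan_cost X d \<pi>' \<le> plan_cost X d \<pi>"
proof -
  define t where "t = min k (\<pi> v v)"
  define \<pi>0 where "\<pi>0 p q = \<pi> p q - (if p = v then if q = v then t else 0 else 0)" for p q
  have "0 \<le> \<pi> v v" using \<pi> v by (auto simp: transport_plans_def)
  then have t: "0 \<le> t" "t \<le> k" "t \<le> \<pi> v v" using v by (auto simp: t_def)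
  have rows: "(\<Sum>q\<in>X. \<pi>0 p q) = (\<Sum>q\<in>X. \<pi> p q) - (if p = v then t else 0)"
    "(\<Sum>q\<in>X. \<pi>0 q p) = (\<Sum>q\<in>X. \<pi> q p) - (if p = v then t else 0)" if "p \<in> X" for p
    unfolding \<pi>0_def sum_subtractf using finite_X that by (cases "p = v"; simp)+
  have \<pi>0: "\<pi>0 \<in> transport_plans X (\<lambda>p. \<mu> p + (if p = v then k - t else 0)) (\<lambda>p. \<nu> p + (if p = v then k - t else 0))"
    using \<pi> rows t by (auto simp: transport_plans_def \<pi>0_def)
  have "plan_cost X d \<pi>0 = plan_cost X d \<pi>"
    unfolding plan_cost_def \<pi>0_def using v(1) by (intro sum.cong) auto
  moreover have "\<exists>\<pi>'\<in>transport_plans X \<mu> \<nu>. plan_cost X d \<pi>' \<le> plan_cost X d \<pi>0"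
  proof (cases "t = k")
    case True
    have "(\<lambda>p. \<xi> p + (if p = v then k - t else 0)) = \<xi>" for \<xi> :: "'a \<Rightarrow> real"
      using True by auto
    then show ?thesis using \<pi>0 by (intro bexI[of _ \<pi>0]) (simp_all only: order_refl)
  next
    case False
    then have "0 < k - t" "\<pi>0 v v = 0" using t by (auto simp: t_def \<pi>0_def min_def split: if_splits)
    then show ?thesis using reroute[OF \<pi>0] v by blast
  qed
  ultimately show ?thesis by simp
qed

lemma cancel_common_mass:
  assumes "\<pi> \<in> transport_plans X (\<lambda>p. \<mu> p + \<kappa> p) (\<lambda>p. \<nu> p + \<kappa> p)"
    and "\<And>p. p \<in> X \<Longrightarrow> 0 \<le> \<mu> p \<and> 0 \<le> \<nu> p \<and> 0 \<le> \<kappa> p"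
  shows "\<exists>\<pi>'\<in>transport_plans X \<mu> \<nu>. plan_cost X d \<pi>' \<le> plan_cost X d \<pi>"
proof -
  have "\<exists>\<pi>'\<in>transport_plans X \<mu> \<nu>. plan_cost X d \<pi>' \<le> plan_cost X d \<pi>"
    if "finite F" "F \<subseteq> X" "\<pi> \<in> transport_plans X (\<lambda>p. \<mu> p + (if p \<in> F then \<kappa> p else 0)) (\<lambda>p. \<nu> p + (if p \<in> F then \<kappa> p else 0))"
    for F \<pi>
    using that
  proof (induction F arbitrary: \<pi> rule: finite_induct)
    case empty
    then show ?case by auto
  next
    case (insert v F)
    let ?m = "\<lambda>p. \<mu> p + (if p \<in> F then \<kappa> p else 0)" and ?n = "\<lambda>p. \<nu> p + (if p \<in> F then \<kappa> p else 0)"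
    have "\<xi> p + (if p \<in> insert v F then \<kappa> p else 0)
        = (\<xi> p + (if p \<in> F then \<kappa> p else 0)) + (if p = v then \<kappa> v else 0)" for p and \<xi> :: "'a \<Rightarrow> real"
      using insert.hyps by auto
    then have "\<pi> \<in> transport_plans X (\<lambda>p. ?m p + (if p = v then \<kappa> v else 0)) (\<lambda>p. ?n p + (if p = v then \<kappa> v else 0))"
      using insert.prems(2) by (simp only:)
    then obtain \<pi>' where "\<pi>' \<in> transport_plans X ?m ?n" "plan_cost X d \<pi>' \<le> plan_cost X d \<pi>"
      using cancel_point[of \<pi> ?m v "\<kappa> v" ?n] insert.prems(1) insert.hyps assms(2)[of v]
      by (simp only: if_False insert_subset add_0_right) blast
    note \<pi>' = this
    obtain \<pi>'' where "\<pi>'' \<in> transport_plans X \<mu> \<nu>" "plan_cost X d \<pi>'' \<le> plan_cost X d \<pi>'"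
      using insert.IH[OF _ \<pi>'(1)] insert.prems(1) by blast
    then show ?case using \<pi>'(2) by (intro bexI[of _ \<pi>'']) auto
  qed
  moreover have "\<pi> \<in> transport_plans X (\<lambda>p. \<mu> p + (if p \<in> X then \<kappa> p else 0)) (\<lambda>p. \<nu> p + (if p \<in> X then \<kappa> p else 0))"
    using assms(1) by (auto simp: transport_plans_def)
  ultimately show ?thesis using finite_X by blast
qed

lemma EMD_le:
  assumes "\<pi> \<in> transport_plans X \<mu> \<nu>"
  shows "EMD X d \<mu> \<nu> \<le> plan_cost X d \<pi>"
  unfolding EMD_def plan_cost_def
  by (rule cINF_lower[OF _ assms], rule bdd_belowI2[where m = 0])
     (auto simp: transport_plans_def intro!: sum_nonneg)

text \<open>A flow with \<nu> added on the diagonal is a transport plan between \<mu> and \<nu>,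
  both increased by the inflow \<kappa>. The diagonal is free, and the common mass \<kappa> can be
  cancelled.\<close>

lemma EMD_le_shipping_cost:
  assumes "\<And>p. p \<in> X \<Longrightarrow> 0 \<le> \<mu> p \<and> 0 \<le> \<nu> p" "flows X (\<lambda>p. \<mu> p - \<nu> p) \<noteq> {}"
  shows "EMD X d \<mu> \<nu> \<le> shipping_cost X d (\<lambda>p. \<mu> p - \<nu> p)"
  unfolding shipping_cost_def
proof (rule cINF_greatest[OF assms(2)])
  fix f assume f: "f \<in> flows X (\<lambda>p. \<mu> p - \<nu> p)"
  define \<kappa> where "\<kappa> p = (\<Sum>q\<in>X. f q p)" for p
  define \<pi> where "\<pi> p q = f p q + (if p = q then \<nu> p else 0)" for p q
  have "\<pi> \<in> transport_plans X (\<lambda>p. \<mu> p + \<kappa> p) (\<lambda>p. \<nu> p + \<kappa> p)"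
    using f finite_X assms(1)
    by (auto simp: transport_plans_def flows_def \<pi>_def \<kappa>_def sum.distrib algebra_simps)
  moreover have "0 \<le> \<kappa> p" if "p \<in> X" for p
    unfolding \<kappa>_def using f that by (intro sum_nonneg) (auto simp: flows_def)
  ultimately obtain \<pi>' where \<pi>': "\<pi>' \<in> transport_plans X \<mu> \<nu>" "plan_cost X d \<pi>' \<le> plan_cost X d \<pi>"
    using cancel_common_mass[of \<pi> \<mu> \<kappa> \<nu>] assms(1) by blast
  have "plan_cost X d \<pi> = plan_cost X d f"
    unfolding plan_cost_def \<pi>_def by (intro sum.cong) auto
  then show "EMD X d \<mu> \<nu> \<le> plan_cost X d f" using EMD_le[OF \<pi>'(1)] \<pi>'(2) by simp
qed

lemma shipping_cost_le: "f \<in> flows X \<tau> \<Longrightarrow> shipping_cost X d \<tau> \<le> plan_cost X d f"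
  unfolding shipping_cost_def
  by (rule cINF_lower, rule bdd_belowI2[where m = 0]) (auto simp: flows_def intro!: plan_cost_nonneg)

lemma shipping_cost_nonneg:
  assumes "flows X \<tau> \<noteq> {}"
  shows "0 \<le> shipping_cost X d \<tau>"
  unfolding shipping_cost_def
  by (rule cINF_greatest[OF assms]) (auto simp: flows_def intro!: plan_cost_nonneg)

text \<open>Every dipole is served by one direct shipment of \<open>\<bar>a i\<bar>\<close>, whose
  direction is given by the sign of \<open>a i\<close>.\<close>

lemma shipping_cost_dipoles:
  assumes "finite I" "\<And>i. i \<in> I \<Longrightarrow> u i \<in> X \<and> v i \<in> X"
    and \<tau>: "\<And>p. p \<in> X \<Longrightarrow> \<tau> p = (\<Sum>i\<in>I. a i * (of_bool (u i = p) - of_bool (v i = p)))"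
  shows "flows X \<tau> \<noteq> {} \<and> shipping_cost X d \<tau> \<le> (\<Sum>i\<in>I. \<bar>a i\<bar> * d (u i) (v i))"
proof -
  define s where "s i = (if 0 \<le> a i then u i else v i)" for i
  define t where "t i = (if 0 \<le> a i then v i else u i)" for i
  have st: "s i \<in> X" "t i \<in> X" if "i \<in> I" for i using assms(2)[OF that] by (auto simp: s_def t_def)
  define f where "f p q = (\<Sum>i\<in>I. \<bar>a i\<bar> * (of_bool (s i = p) * of_bool (t i = q)))" for p q
  have row: "(\<Sum>q\<in>X. f p q) = (\<Sum>i\<in>I. \<bar>a i\<bar> * of_bool (s i = p))" for p
    unfolding f_def
    by (subst sum.swap, rule sum.cong) (use st finite_X in \<open>auto simp: of_bool_def simp flip: sum_distrib_left\<close>)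
  have col: "(\<Sum>q\<in>X. f q p) = (\<Sum>i\<in>I. \<bar>a i\<bar> * of_bool (t i = p))" for p
    unfolding f_def
    by (subst sum.swap, rule sum.cong) (use st finite_X in \<open>auto simp: of_bool_def simp flip: sum_distrib_left\<close>)
  have "f \<in> flows X \<tau>"
    unfolding flows_def mem_Collect_eq row col
  proof (intro conjI ballI)
    fix p assume "p \<in> X"
    then show "(\<Sum>i\<in>I. \<bar>a i\<bar> * of_bool (s i = p)) - (\<Sum>i\<in>I. \<bar>a i\<bar> * of_bool (t i = p)) = \<tau> p"
      unfolding \<tau>[OF \<open>p \<in> X\<close>] sum_subtractf[symmetric]
      by (intro sum.cong) (auto simp: s_def t_def algebra_simps)
  qed (auto simp: f_def intro!: sum_nonneg)
  moreover have "plan_cost X d f = (\<Sum>i\<in>I. \<bar>a i\<bar> * d (u i) (v i))"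
  proof -
    have "plan_cost X d f = (\<Sum>p\<in>X. \<Sum>q\<in>X. \<Sum>i\<in>I. \<bar>a i\<bar> * (of_bool (s i = p) * (of_bool (t i = q) * d p q)))"
      unfolding plan_cost_def f_def sum_distrib_left by (simp add: algebra_simps)
    also have "\<dots> = (\<Sum>i\<in>I. \<Sum>p\<in>X. \<Sum>q\<in>X. \<bar>a i\<bar> * (of_bool (s i = p) * (of_bool (t i = q) * d p q)))"
      by (subst sum.swap[of _ I X], subst sum.swap[of _ I X]) simp
    also have "\<dots> = (\<Sum>i\<in>I. \<bar>a i\<bar> * d (s i) (t i))"
    proof (intro sum.cong refl)
      fix i assume i: "i \<in> I"
      show "(\<Sum>p\<in>X. \<Sum>q\<in>X. \<bar>a i\<bar> * (of_bool (s i = p) * (of_bool (t i = q) * d p q)))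
          = \<bar>a i\<bar> * d (s i) (t i)"
        unfolding sum_distrib_left[symmetric]
        by (simp only: sum_of_bool_mult[OF finite_X st(1)[OF i]] sum_of_bool_mult[OF finite_X st(2)[OF i]])
    qed
    also have "\<dots> = (\<Sum>i\<in>I. \<bar>a i\<bar> * d (u i) (v i))"
      by (intro sum.cong) (auto simp: s_def t_def commute)
    finally show ?thesis .
  qed
  ultimately show ?thesis using shipping_cost_le by force
qed

text \<open>Flows add up. Near-optimal flows with a slack \<open>e\<close> are taken, so that
  attainment of the infimum need not be shown.\<close>

lemma shipping_cost_sum:
  assumes "finite J" "\<And>j. j \<in> J \<Longrightarrow> flows X (\<tau> j) \<noteq> {}"
    and \<sigma>: "\<And>p. p \<in> X \<Longrightarrow> \<sigma> p = (\<Sum>j\<in>J. \<tau> j p)"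
  shows "flows X \<sigma> \<noteq> {} \<and> shipping_cost X d \<sigma> \<le> (\<Sum>j\<in>J. shipping_cost X d (\<tau> j))"
proof -
  have *: "\<exists>f\<in>flows X \<sigma>. plan_cost X d f \<le> (\<Sum>j\<in>J. shipping_cost X d (\<tau> j)) + real (card J) * e" if "0 < e" for e
  proof -
    have "\<exists>f\<in>flows X (\<tau> j). plan_cost X d f < shipping_cost X d (\<tau> j) + e" if "j \<in> J" for j
    proof -
      have "Inf (plan_cost X d ` flows X (\<tau> j)) < shipping_cost X d (\<tau> j) + e"
        using \<open>0 < e\<close> by (simp add: shipping_cost_def)
      then show ?thesis using cInf_lessD[of "plan_cost X d ` flows X (\<tau> j)"] assms(2)[OF that] by auto
    qed
    then obtain F where F: "\<And>j. j \<in> J \<Longrightarrow> F j \<in> flows X (\<tau> j)"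
        "\<And>j. j \<in> J \<Longrightarrow> plan_cost X d (F j) < shipping_cost X d (\<tau> j) + e" by metis
    let ?f = "\<lambda>p q. \<Sum>j\<in>J. F j p q"
    have "?f \<in> flows X \<sigma>"
      unfolding flows_def mem_Collect_eq
    proof (intro conjI ballI)
      fix p assume p: "p \<in> X"
      have "(\<Sum>q\<in>X. ?f p q) - (\<Sum>q\<in>X. ?f q p) = (\<Sum>j\<in>J. (\<Sum>q\<in>X. F j p q) - (\<Sum>q\<in>X. F j q p))"
        by (subst sum.swap, subst (2) sum.swap) (simp add: sum_subtractf)
      also have "\<dots> = \<sigma> p" using F(1) p \<sigma> by (auto simp: flows_def intro!: sum.cong)
      finally show "(\<Sum>q\<in>X. ?f p q) - (\<Sum>q\<in>X. ?f q p) = \<sigma> p" .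
    qed (use F(1) in \<open>auto simp: flows_def intro!: sum_nonneg\<close>)
    moreover have "plan_cost X d ?f = (\<Sum>j\<in>J. plan_cost X d (F j))"
    proof -
      have "plan_cost X d ?f = (\<Sum>p\<in>X. \<Sum>j\<in>J. \<Sum>q\<in>X. d p q * F j p q)"
        unfolding plan_cost_def sum_distrib_left by (intro sum.cong refl sum.swap)
      also have "\<dots> = (\<Sum>j\<in>J. plan_cost X d (F j))"
        unfolding plan_cost_def by (rule sum.swap)
      finally show ?thesis .
    qed
    moreover have "(\<Sum>j\<in>J. plan_cost X d (F j)) \<le> (\<Sum>j\<in>J. shipping_cost X d (\<tau> j) + e)"
      using F(2) by (intro sum_mono) (auto intro: less_imp_le)
    moreover have "\<dots> = (\<Sum>j\<in>J. shipping_cost X d (\<tau> j)) + real (card J) * e"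
      by (simp add: sum.distrib)
    ultimately show ?thesis by (intro bexI[of _ ?f]) (simp_all only:)
  qed
  have "shipping_cost X d \<sigma> \<le> (\<Sum>j\<in>J. shipping_cost X d (\<tau> j))"
  proof (rule field_le_epsilon)
    fix e :: real assume that: "0 < e"
    have "0 < e / (real (card J) + 1)" using that by simp
    from *[OF this] obtain f where f: "f \<in> flows X \<sigma>"
      "plan_cost X d f \<le> (\<Sum>j\<in>J. shipping_cost X d (\<tau> j)) + real (card J) * (e / (real (card J) + 1))" by auto
    have "real (card J) * (e / (real (card J) + 1)) \<le> e" using that by (simp add: field_simps)
    then show "shipping_cost X d \<sigma> \<le> (\<Sum>j\<in>J. shipping_cost X d (\<tau> j)) + e"
      using f(2) shipping_cost_le[OF f(1)] by linarith
  qed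
  moreover have "flows X \<sigma> \<noteq> {}" using *[of 1] by auto
  ultimately show ?thesis by blast
qed

end

subsection \<open>Hierarchical decompositions\<close>

text \<open>The bound \<open>4 * R i\<close> is what labels within distance \<open>2 * R i\<close>
  of their points give. The labels of different levels need not be related.\<close>

locale hierarchy = finite_metric X d for X :: "'a set" and d +
  fixes lab :: "nat \<Rightarrow> 'a \<Rightarrow> 'b" and L :: nat and R :: "nat \<Rightarrow> real" and \<rho> :: real
  assumes rho: "2 \<le> \<rho>" and R_pos: "\<And>i. 0 < R i" and R_Suc: "\<And>i. R (Suc i) = \<rho> * R i"
    and diam: "\<And>i x y. i \<le> L \<Longrightarrow> x \<in> X \<Longrightarrow> y \<in> X \<Longrightarrow> lab i x = lab i y \<Longrightarrow> d x y \<le> 4 * R i"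
    and bottom: "\<And>x y. x \<in> X \<Longrightarrow> y \<in> X \<Longrightarrow> lab 0 x = lab 0 y \<Longrightarrow> x = y"
    and top: "\<And>x y. x \<in> X \<Longrightarrow> y \<in> X \<Longrightarrow> lab L x = lab L y"
begin

text \<open>Agreement on all levels from \<open>i\<close> to \<open>L\<close> forces the partitions
  to be nested; a pair is separated at level \<open>i\<close> as soon as some label at or above
  \<open>i\<close> differs.\<close>

definition same :: "nat \<Rightarrow> 'a \<Rightarrow> 'a \<Rightarrow> bool" where
  "same i x y \<longleftrightarrow> (\<forall>j\<in>{i..L}. lab j x = lab j y)"

definition cls :: "nat \<Rightarrow> 'a \<Rightarrow> 'a set" where
  "cls i x = {y\<in>X. same i x y}"

definition parts :: "nat \<Rightarrow> 'a set set" where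
  "parts i = cls i ` X"

text \<open>A function of the set alone: a cluster that is unchanged at the next level keeps its
  centre, so the skipped levels really contribute nothing to the telescoping sum.\<close>

definition cen :: "'a set \<Rightarrow> 'a" where
  "cen S = (SOME y. y \<in> S)"

definition kids :: "nat \<Rightarrow> 'a set \<Rightarrow> 'a set set" where
  "kids i C = {S\<in>parts i. S \<subseteq> C}"

definition active :: "nat set" where
  "active = {i. i < L \<and> parts i \<noteq> parts (Suc i)}"

text \<open>
  \<open>s S\<close> is the surplus of the cluster \<open>S\<close>. The dipoles move the surpluses of the children of \<open>C\<close> to
  the centre of \<open>C\<close>; summed over the hierarchy they telescope to the difference of the two
  distributions, whence \<open>total_cost\<close> dominates the earth mover distance. The second summand of
  \<open>local_cost\<close> makes it comparable to an \<open>\<ell>\<^sub>1\<close> norm up to a factor \<open>O(\<rho>)\<close>. Levels at which the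
  partition does not change contribute nothing and are skipped, which keeps the number of terms
  polynomial in \<open>card X\<close> for every aspect ratio.
\<close>

definition dipoles :: "nat \<Rightarrow> 'a set \<Rightarrow> ('a set \<Rightarrow> real) \<Rightarrow> 'a \<Rightarrow> real" where
  "dipoles i C s p = (\<Sum>S\<in>kids i C. s S * (of_bool (cen S = p) - of_bool (cen C = p)))"

definition local_cost :: "nat \<Rightarrow> 'a set \<Rightarrow> ('a set \<Rightarrow> real) \<Rightarrow> real" where
  "local_cost i C s = shipping_cost X d (dipoles i C s) + R i * (\<Sum>S\<in>kids i C. \<bar>s S\<bar>)"

definition total_cost :: "('a \<Rightarrow> real) \<Rightarrow> real" where
  "total_cost \<sigma> = (\<Sum>i\<in>active. \<Sum>C\<in>parts (Suc i). local_cost i C (sum \<sigma>))"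

section \<open>Nested partitions and domination of the earth mover distance\<close>

lemma same_refl: "same i x x"
  by (simp add: same_def)

lemma same_sym: "same i x y \<Longrightarrow> same i y x"
  by (simp add: same_def)

lemma same_trans: "same i x y \<Longrightarrow> same i y z \<Longrightarrow> same i x z"
  by (simp add: same_def)

lemma same_Suc:
  assumes "i \<le> L"
  shows "same i x y \<longleftrightarrow> lab i x = lab i y \<and> same (Suc i) x y"
  unfolding same_def atLeastAtMost_insertL[OF assms, symmetric] by simp

lemma same_imp_Suc: "same i x y \<Longrightarrow> same (Suc i) x y"
  by (simp add: same_def)

lemma same_top: "x \<in> X \<Longrightarrow> y \<in> X \<Longrightarrow> same L x y"
  using top[of x y] by (simp add: same_def)

lemma same_bottom: "x \<in> X \<Longrightarrow> y \<in> X \<Longrightarrow> same 0 x y \<Longrightarrow> x = y"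
  using bottom[of x y] by (simp add: same_def)

lemma same_diam: "i \<le> L \<Longrightarrow> x \<in> X \<Longrightarrow> y \<in> X \<Longrightarrow> same i x y \<Longrightarrow> d x y \<le> 4 * R i"
  using diam[of i x y] by (simp add: same_def)

lemma cls_eq_iff: "x \<in> X \<Longrightarrow> y \<in> X \<Longrightarrow> cls i x = cls i y \<longleftrightarrow> same i x y"
  unfolding cls_def using same_refl same_sym same_trans by blast

lemma in_part:
  assumes "S \<in> parts i" "x \<in> S"
  shows "x \<in> X \<and> S = cls i x"
proof -
  obtain z where z: "z \<in> X" "S = cls i z" using assms(1) by (auto simp: parts_def)
  then have "x \<in> X" "same i z x" using assms(2) by (auto simp: cls_def)
  then show ?thesis using cls_eq_iff[of z x i] z by simp
qed

lemma in_cls: "x \<in> X \<Longrightarrow> x \<in> cls i x"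
  by (simp add: cls_def same_refl)

lemma cls_in_parts: "x \<in> X \<Longrightarrow> cls i x \<in> parts i"
  by (simp add: parts_def)

lemma finite_parts: "finite (parts i)" and card_parts: "card (parts i) \<le> card X"
  unfolding parts_def using finite_X card_image_le by auto

lemma finite_part: "S \<in> parts i \<Longrightarrow> finite S"
  unfolding parts_def cls_def using finite_X by auto

lemma finite_kids: "finite (kids i C)"
  unfolding kids_def using finite_parts by auto

lemma finite_active: "finite active"
  unfolding active_def by auto

lemma cen_in: "S \<in> parts i \<Longrightarrow> cen S \<in> S"
  unfolding cen_def parts_def by (rule someI_ex) (use in_cls in blast)

lemma cen_in_X: "S \<in> parts i \<Longrightarrow> cen S \<in> X"
  using cen_in in_part by blast

lemma kids_eq:
  assumes "C \<in> parts (Suc i)"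
  shows "kids i C = cls i ` C"
proof (intro equalityI subsetI)
  fix S assume "S \<in> kids i C"
  then have "S \<in> parts i" "S \<subseteq> C" by (auto simp: kids_def)
  then show "S \<in> cls i ` C" using cen_in[of S i] in_part[of S i "cen S"] by blast
next
  fix S assume "S \<in> cls i ` C"
  then obtain x where x: "x \<in> C" "S = cls i x" by auto
  then have "x \<in> X" "C = cls (Suc i) x" using in_part[OF assms] by auto
  moreover have "cls i x \<subseteq> cls (Suc i) x" by (auto simp: cls_def same_imp_Suc)
  ultimately show "S \<in> kids i C" using x by (simp add: kids_def cls_in_parts)
qed

lemma sum_parts: "(\<Sum>C\<in>parts i. sum f C) = sum f X"
proof -
  have "{x\<in>X. cls i x = C} = C" if "C \<in> parts i" for C
    using in_part[OF that] in_cls by blast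
  then show ?thesis
    unfolding sum.image_gen[OF finite_X, of f "cls i"] parts_def[symmetric] by (intro sum.cong) auto
qed

lemma sum_kids:
  assumes "C \<in> parts (Suc i)"
  shows "(\<Sum>S\<in>kids i C. sum \<sigma> S * \<phi> S) = (\<Sum>x\<in>C. \<sigma> x * \<phi> (cls i x) :: real)"
proof -
  have "{x\<in>C. cls i x = S} = S" if "S \<in> kids i C" for S
    using that in_part[of S i] in_cls in_part[OF assms] unfolding kids_def by blast
  moreover have "cls i x = S" if "S \<in> kids i C" "x \<in> S" for S x
    using that in_part[of S i x] by (auto simp: kids_def)
  ultimately have "(\<Sum>S\<in>kids i C. sum \<sigma> S * \<phi> S) = (\<Sum>S\<in>cls i ` C. \<Sum>x\<in>{x\<in>C. cls i x = S}. \<sigma> x * \<phi> (cls i x))"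
    unfolding kids_eq[OF assms, symmetric] sum_distrib_right
    by (intro sum.cong[OF refl] sum.cong[OF sym]) simp_all
  also have "\<dots> = (\<Sum>x\<in>C. \<sigma> x * \<phi> (cls i x))"
    by (rule sum.image_gen[symmetric]) (rule finite_part[OF assms])
  finally show ?thesis .
qed

lemma dipoles_sum:
  assumes "C \<in> parts (Suc i)"
  shows "dipoles i C (sum \<sigma>) p = (\<Sum>x\<in>C. \<sigma> x * (of_bool (cen (cls i x) = p) - of_bool (cen C = p)))"
  unfolding dipoles_def by (rule sum_kids[OF assms])

lemma dipoles_cost:
  assumes "i < L" "C \<in> parts (Suc i)"
  shows "flows X (dipoles i C s) \<noteq> {}"
    and "shipping_cost X d (dipoles i C s) \<le> 4 * \<rho> * R i * (\<Sum>S\<in>kids i C. \<bar>s S\<bar>)"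
proof -
  have "flows X (dipoles i C s) \<noteq> {} \<and>
      shipping_cost X d (dipoles i C s) \<le> (\<Sum>S\<in>kids i C. \<bar>s S\<bar> * d (cen S) (cen C))"
    by (rule shipping_cost_dipoles[OF finite_kids])
       (use cen_in_X assms(2) in \<open>auto simp: kids_def dipoles_def\<close>)
  moreover have "(\<Sum>S\<in>kids i C. \<bar>s S\<bar> * d (cen S) (cen C)) \<le> (\<Sum>S\<in>kids i C. \<bar>s S\<bar> * (4 * R (Suc i)))"
  proof (intro sum_mono mult_left_mono)
    fix S assume "S \<in> kids i C"
    then have "cen S \<in> C" using cen_in by (auto simp: kids_def)
    moreover have "cen C \<in> C" using cen_in assms by auto
    ultimately have "cen S \<in> X" "cen C \<in> X" "cls (Suc i) (cen S) = cls (Suc i) (cen C)"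
      using in_part[OF assms(2), of "cen S"] in_part[OF assms(2), of "cen C"] by simp_all
    then have "cen S \<in> X" "cen C \<in> X" "same (Suc i) (cen S) (cen C)"
      using cls_eq_iff by simp_all
    then show "d (cen S) (cen C) \<le> 4 * R (Suc i)" using same_diam[of "Suc i"] assms(1) by auto
  qed auto
  ultimately show "flows X (dipoles i C s) \<noteq> {}"
    "shipping_cost X d (dipoles i C s) \<le> 4 * \<rho> * R i * (\<Sum>S\<in>kids i C. \<bar>s S\<bar>)"
    unfolding R_Suc by (simp_all add: sum_distrib_left mult_ac)
qed

text \<open>The upper bound ships each child's surplus straight to the centre of \<open>C\<close>,
  over a distance of at most \<open>4 * R (Suc i) = 4 * \<rho> * R i\<close>.\<close>

lemma local_cost_bounds:
  assumes "i < L" "C \<in> parts (Suc i)"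
  shows "R i * (\<Sum>S\<in>kids i C. \<bar>s S\<bar>) \<le> local_cost i C s"
    and "local_cost i C s \<le> (1 + 4 * \<rho>) * (R i * (\<Sum>S\<in>kids i C. \<bar>s S\<bar>))"
  using dipoles_cost[OF assms, of s] shipping_cost_nonneg[of "dipoles i C s"]
  unfolding local_cost_def by (auto simp: algebra_simps)

lemma inactive_cls:
  assumes "i < L" "i \<notin> active" "x \<in> X"
  shows "cls i x = cls (Suc i) x"
proof -
  have "cls i x \<in> parts (Suc i)" using assms cls_in_parts by (auto simp: active_def)
  then show ?thesis using in_part in_cls[OF assms(3)] by blast
qed

lemma EMD_le_total_cost:
  assumes "\<And>p. p \<in> X \<Longrightarrow> 0 \<le> \<mu> p \<and> 0 \<le> \<nu> p" and "sum \<mu> X = sum \<nu> X"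
  shows "EMD X d \<mu> \<nu> \<le> total_cost (\<lambda>p. \<mu> p - \<nu> p)"
proof -
  define \<sigma> where "\<sigma> p = \<mu> p - \<nu> p" for p
  have \<sigma>0: "sum \<sigma> X = 0" using assms(2) by (simp add: \<sigma>_def sum_subtractf)
  define J where "J = Sigma active (\<lambda>i. parts (Suc i))"
  have J: "finite J" unfolding J_def using finite_active finite_parts by auto
  define e where "e i x p = (of_bool (cen (cls i x) = p) :: real)" for i x p
  have sum: "\<sigma> p = (\<Sum>j\<in>J. dipoles (fst j) (snd j) (sum \<sigma>) p)" if p: "p \<in> X" for p
  proof -
    have "(\<Sum>j\<in>J. dipoles (fst j) (snd j) (sum \<sigma>) p) = (\<Sum>i\<in>active. \<Sum>C\<in>parts (Suc i). dipoles i C (sum \<sigma>) p)"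
      unfolding J_def using finite_active finite_parts by (subst sum.Sigma) (auto simp: case_prod_beta)
    also have "\<dots> = (\<Sum>i\<in>active. \<Sum>C\<in>parts (Suc i). \<Sum>x\<in>C. \<sigma> x * (e i x p - e (Suc i) x p))"
    proof (intro sum.cong refl)
      fix i C assume "i \<in> active" and C: "C \<in> parts (Suc i)"
      show "dipoles i C (sum \<sigma>) p = (\<Sum>x\<in>C. \<sigma> x * (e i x p - e (Suc i) x p))"
        unfolding dipoles_sum[OF C] e_def using in_part[OF C] by (intro sum.cong refl) metis
    qed
    also have "\<dots> = (\<Sum>i\<in>active. \<Sum>x\<in>X. \<sigma> x * (e i x p - e (Suc i) x p))"
      unfolding sum_parts ..
    \<comment> \<open>The inactive levels are put back: their clusters, hence their centres, agree
      with those of the next level.\<close>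
    also have "\<dots> = (\<Sum>i<L. \<Sum>x\<in>X. \<sigma> x * (e i x p - e (Suc i) x p))"
    proof (rule sum.mono_neutral_left)
      show "\<forall>i\<in>{..<L} - active. (\<Sum>x\<in>X. \<sigma> x * (e i x p - e (Suc i) x p)) = 0"
        by (auto intro!: sum.neutral simp: e_def inactive_cls)
    qed (auto simp: active_def)
    also have "\<dots> = (\<Sum>x\<in>X. \<sigma> x * (\<Sum>i<L. e i x p - e (Suc i) x p))"
      by (subst sum.swap) (simp add: sum_distrib_left)
    also have "\<dots> = (\<Sum>x\<in>X. \<sigma> x * (e 0 x p - e L x p))"
      by (subst sum_lessThan_telescope') simp
    also have "\<dots> = (\<Sum>x\<in>X. \<sigma> x * e 0 x p) - (\<Sum>x\<in>X. \<sigma> x * e L x p)"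
      by (simp add: algebra_simps sum_subtractf)
    also have "(\<Sum>x\<in>X. \<sigma> x * e L x p) = (\<Sum>x\<in>X. \<sigma> x * e L p p)"
      using cls_eq_iff same_top p unfolding e_def by (intro sum.cong refl) metis
    \<comment> \<open>At the top all points share one centre, so only the total surplus remains. The
      bottom term, where clusters are singletons, reproduces \<sigma>.\<close>
    also have "\<dots> = 0" using \<sigma>0 by (simp flip: sum_distrib_right)
    also have "(\<Sum>x\<in>X. \<sigma> x * e 0 x p) = (\<Sum>x\<in>X. of_bool (p = x) * \<sigma> x)"
    proof (intro sum.cong refl)
      fix x assume x: "x \<in> X"
      have "cls 0 x = {x}" using same_bottom[of x] same_refl x by (auto simp: cls_def)
      then show "\<sigma> x * e 0 x p = of_bool (p = x) * \<sigma> x" by (auto simp: e_def cen_def)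
    qed
    also have "\<dots> = \<sigma> p" by (rule sum_of_bool_mult[OF finite_X p])
    finally show ?thesis by simp
  qed
  have JL: "fst j < L" "snd j \<in> parts (Suc (fst j))" if "j \<in> J" for j
    using that by (auto simp: J_def active_def)
  have fl: "flows X (dipoles (fst j) (snd j) (sum \<sigma>)) \<noteq> {}" if "j \<in> J" for j
    using dipoles_cost(1) JL[OF that] .
  have *: "flows X \<sigma> \<noteq> {} \<and> shipping_cost X d \<sigma> \<le> (\<Sum>j\<in>J. shipping_cost X d (dipoles (fst j) (snd j) (sum \<sigma>)))"
    by (rule shipping_cost_sum[OF J fl sum])
  have "EMD X d \<mu> \<nu> \<le> shipping_cost X d \<sigma>"
    using EMD_le_shipping_cost[OF assms(1)] * by (simp add: \<sigma>_def[abs_def])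
  also have "\<dots> \<le> (\<Sum>j\<in>J. shipping_cost X d (dipoles (fst j) (snd j) (sum \<sigma>)))" using * by blast
  also have "\<dots> \<le> (\<Sum>j\<in>J. local_cost (fst j) (snd j) (sum \<sigma>))"
    unfolding local_cost_def using less_imp_le[OF R_pos]
    by (intro sum_mono) (simp add: sum_nonneg)
  also have "\<dots> = total_cost \<sigma>"
    unfolding J_def total_cost_def using finite_active finite_parts
    by (subst sum.Sigma) (auto simp: case_prod_beta)
  finally show ?thesis by (simp add: \<sigma>_def[abs_def])
qed

section \<open>Upper bound: charging the cost to pairs of a transport plan\<close>

definition cut :: "nat \<Rightarrow> 'a \<Rightarrow> 'a \<Rightarrow> real" where
  "cut i x y = of_bool (\<not> same i x y)"

text \<open>The dipoles of \<open>C\<close> turn a unit of surplus at \<open>x\<close> into a unit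
  at the anchor of \<open>x\<close> minus a unit at \<open>cen C\<close>. For \<open>x\<close>
  outside \<open>C\<close> the two coincide and cancel.\<close>

definition anchor :: "nat \<Rightarrow> 'a set \<Rightarrow> 'a \<Rightarrow> 'a" where
  "anchor i C x = (if x \<in> C then cen (cls i x) else cen C)"

definition pair_cost :: "nat \<Rightarrow> 'a set \<Rightarrow> 'a \<Rightarrow> 'a \<Rightarrow> real" where
  "pair_cost i C x y = d (anchor i C x) (anchor i C y)
     + R i * (\<Sum>S\<in>kids i C. \<bar>of_bool (x \<in> S) - of_bool (y \<in> S)\<bar>)"

text \<open>Linear functionals of the surplus are rewritten as sums over pairs of the plan; \<phi>
  will be a difference of indicators of centres, or constantly 1.\<close>

lemma plan_marginal:
  assumes "\<pi> \<in> transport_plans X \<mu> \<nu>" "C \<subseteq> X"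
  shows "(\<Sum>x\<in>C. (\<mu> x - \<nu> x) * \<phi> x)
    = (\<Sum>(x, y)\<in>X \<times> X. \<pi> x y * (of_bool (x \<in> C) * \<phi> x - of_bool (y \<in> C) * \<phi> y :: real))"
proof -
  have 1: "(\<Sum>x\<in>C. \<mu> x * \<phi> x) = (\<Sum>x\<in>X. \<Sum>y\<in>X. \<pi> x y * (of_bool (x \<in> C) * \<phi> x))"
  proof -
    have "(\<Sum>x\<in>C. \<mu> x * \<phi> x) = (\<Sum>x\<in>X. \<mu> x * (of_bool (x \<in> C) * \<phi> x))"
      using assms(2) finite_X by (intro sum.mono_neutral_cong_left) auto
    then show ?thesis using assms(1) by (simp add: transport_plans_def flip: sum_distrib_right)
  qed
  have 2: "(\<Sum>y\<in>C. \<nu> y * \<phi> y) = (\<Sum>x\<in>X. \<Sum>y\<in>X. \<pi> x y * (of_bool (y \<in> C) * \<phi> y))"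
  proof -
    have "(\<Sum>y\<in>C. \<nu> y * \<phi> y) = (\<Sum>y\<in>X. \<nu> y * (of_bool (y \<in> C) * \<phi> y))"
      using assms(2) finite_X by (intro sum.mono_neutral_cong_left) auto
    also have "\<dots> = (\<Sum>y\<in>X. \<Sum>x\<in>X. \<pi> x y * (of_bool (y \<in> C) * \<phi> y))"
      using assms(1) by (simp add: transport_plans_def flip: sum_distrib_right)
    finally show ?thesis by (subst sum.swap)
  qed
  show ?thesis
    unfolding left_diff_distrib right_diff_distrib sum_subtractf 1 2 sum.cartesian_product
    by (simp add: case_prod_beta sum_subtractf)
qed

text \<open>The plan writes the surplus as a sum of dipoles from \<open>x\<close> to
  \<open>y\<close>; each of them becomes a dipole between the two anchors, of cost at most their
  distance.\<close>

lemma local_cost_le_pairs: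
  assumes \<pi>: "\<pi> \<in> transport_plans X \<mu> \<nu>" and "i < L" and C: "C \<in> parts (Suc i)"
  shows "local_cost i C (sum (\<lambda>p. \<mu> p - \<nu> p)) \<le> (\<Sum>(x, y)\<in>X \<times> X. \<pi> x y * pair_cost i C x y)"
proof -
  let ?\<sigma> = "\<lambda>p. \<mu> p - \<nu> p"
  have nn: "0 \<le> \<pi> x y" if "x \<in> X" "y \<in> X" for x y using \<pi> that by (auto simp: transport_plans_def)
  have CX: "C \<subseteq> X" using in_part[OF C] by auto
  have anchor_X: "anchor i C x \<in> X" if "x \<in> X" for x
    using that cen_in_X[OF C] cen_in_X[OF cls_in_parts[OF that]] by (auto simp: anchor_def)
  have "shipping_cost X d (dipoles i C (sum ?\<sigma>)) \<le> (\<Sum>z\<in>X \<times> X. \<bar>\<pi> (fst z) (snd z)\<bar> * d (anchor i C (fst z)) (anchor i C (snd z)))"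
  proof (rule conjunct2[OF shipping_cost_dipoles])
    fix p assume "p \<in> X"
    show "dipoles i C (sum ?\<sigma>) p = (\<Sum>z\<in>X \<times> X. \<pi> (fst z) (snd z) *
        (of_bool (anchor i C (fst z) = p) - of_bool (anchor i C (snd z) = p)))"
      unfolding dipoles_sum[OF C] plan_marginal[OF \<pi> CX] case_prod_beta
      by (intro sum.cong refl) (auto simp: anchor_def)
  qed (use finite_X anchor_X in auto)
  also have "\<dots> = (\<Sum>(x, y)\<in>X \<times> X. \<pi> x y * d (anchor i C x) (anchor i C y))"
    unfolding case_prod_beta using nn by (intro sum.cong refl) auto
  finally have 1: "shipping_cost X d (dipoles i C (sum ?\<sigma>)) \<le> \<dots>" .
  have "\<bar>sum ?\<sigma> S\<bar> \<le> (\<Sum>(x, y)\<in>X \<times> X. \<pi> x y * \<bar>of_bool (x \<in> S) - of_bool (y \<in> S)\<bar>)"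
    if "S \<in> kids i C" for S
  proof -
    have "S \<subseteq> X" using that CX by (auto simp: kids_def)
    from plan_marginal[OF \<pi> this, of "\<lambda>_. 1"]
    have "\<bar>sum ?\<sigma> S\<bar> = \<bar>\<Sum>(x, y)\<in>X \<times> X. \<pi> x y * (of_bool (x \<in> S) - of_bool (y \<in> S))\<bar>" by simp
    also have "\<dots> \<le> (\<Sum>z\<in>X \<times> X. \<bar>\<pi> (fst z) (snd z) * (of_bool (fst z \<in> S) - of_bool (snd z \<in> S))\<bar>)"
      unfolding case_prod_beta by (rule sum_abs)
    also have "\<dots> = (\<Sum>(x, y)\<in>X \<times> X. \<pi> x y * \<bar>of_bool (x \<in> S) - of_bool (y \<in> S)\<bar>)"
      unfolding case_prod_beta using nn by (intro sum.cong refl) (auto simp: abs_mult)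
    finally show ?thesis .
  qed
  then have "(\<Sum>S\<in>kids i C. \<bar>sum ?\<sigma> S\<bar>)
      \<le> (\<Sum>S\<in>kids i C. \<Sum>(x, y)\<in>X \<times> X. \<pi> x y * \<bar>of_bool (x \<in> S) - of_bool (y \<in> S)\<bar>)"
    by (rule sum_mono)
  also have "\<dots> = (\<Sum>(x, y)\<in>X \<times> X. \<pi> x y * (\<Sum>S\<in>kids i C. \<bar>of_bool (x \<in> S) - of_bool (y \<in> S)\<bar>))"
    by (subst sum.swap) (simp add: case_prod_beta sum_distrib_left)
  finally have "R i * (\<Sum>S\<in>kids i C. \<bar>sum ?\<sigma> S\<bar>) \<le> R i * \<dots>"
    using R_pos[of i] by (intro mult_left_mono) auto
  also have "\<dots> = (\<Sum>(x, y)\<in>X \<times> X. \<pi> x y * (R i * (\<Sum>S\<in>kids i C. \<bar>of_bool (x \<in> S) - of_bool (y \<in> S)\<bar>)))"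
    unfolding sum_distrib_left[of "R i" _ "X \<times> X"] case_prod_beta by (intro sum.cong refl) (simp only: mult.left_commute)
  finally show ?thesis
    using 1 unfolding local_cost_def pair_cost_def
    by (simp add: distrib_left sum.distrib case_prod_beta)
qed

lemma sum_indicator_part:
  assumes "x \<in> X"
  shows "(\<Sum>C\<in>parts i. of_bool (x \<in> C)) = (1 :: real)"
proof -
  have "(\<Sum>C\<in>parts i. of_bool (x \<in> C)) = (\<Sum>C\<in>parts i. of_bool (cls i x = C) * (1 :: real))"
    using in_part in_cls[OF assms] by (intro sum.cong) auto
  also have "\<dots> = 1" by (rule sum_of_bool_mult[OF finite_parts cls_in_parts[OF assms]])
  finally show ?thesis .
qed

lemma sum_indicator_kids:
  assumes "x \<in> X" "C \<in> parts (Suc i)"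
  shows "(\<Sum>S\<in>kids i C. of_bool (x \<in> S)) \<le> (of_bool (x \<in> C) :: real)"
proof (cases "x \<in> C")
  case True
  have "(\<Sum>S\<in>kids i C. of_bool (x \<in> S)) \<le> (\<Sum>S\<in>parts i. of_bool (x \<in> S) :: real)"
    by (intro sum_mono2 finite_parts) (auto simp: kids_def)
  then show ?thesis using True sum_indicator_part[OF assms(1)] by simp
next
  case False
  then have "\<forall>S\<in>kids i C. x \<notin> S" by (auto simp: kids_def)
  then show ?thesis using False by simp
qed

text \<open>If \<open>C\<close> contains both points and its children separate them, their anchors
  are at distance at most \<open>d x y + 8 * R i\<close>, far less than the diameter of
  \<open>C\<close>. Only an end inside a cluster that already separates the pair pays
  \<open>4 * R (Suc i)\<close>, which is charged to the cut at level \<open>Suc i\<close>. The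
  coefficient of \<open>d x y\<close> is nonzero at a single level.\<close>

lemma pair_cost_le:
  assumes xy: "x \<in> X" "y \<in> X" and i: "i < L" and C: "C \<in> parts (Suc i)"
  shows "pair_cost i C x y
    \<le> of_bool (x \<in> C) * ((cut i x y - cut (Suc i) x y) * d x y + 9 * (R i * cut i x y) + 4 * (R (Suc i) * cut (Suc i) x y))
      + of_bool (y \<in> C) * (R i * cut i x y + 4 * (R (Suc i) * cut (Suc i) x y))"
proof -
  have Rnn: "0 \<le> R i" "0 \<le> R (Suc i)" using R_pos by (auto intro: less_imp_le)
  have cls_cen: "cen (cls i z) \<in> X" "same i z (cen (cls i z))" if "z \<in> X" for z
    using cen_in[OF cls_in_parts[OF that, of i]] by (auto simp: cls_def)
  have cC: "cen C \<in> C" "cen C \<in> X" using cen_in[OF C] cen_in_X[OF C] by auto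
  have inC: "same (Suc i) z z'" if "z \<in> C" "z' \<in> C" for z z'
    using in_part[OF C that(1)] in_part[OF C that(2)] cls_eq_iff[of z z' "Suc i"] by auto
  have cenC: "d (cen (cls i z)) (cen C) \<le> 4 * R (Suc i)" if "z \<in> C" for z
  proof -
    have z: "z \<in> X" using in_part[OF C that] by auto
    have "same (Suc i) (cen (cls i z)) (cen C)"
      using inC[OF that cC(1)] same_imp_Suc[OF cls_cen(2)[OF z]] same_sym same_trans by blast
    then show ?thesis using same_diam[of "Suc i"] i cls_cen(1)[OF z] cC by auto
  qed
  have A: "d (anchor i C x) (anchor i C y)
    \<le> of_bool (x \<in> C) * ((cut i x y - cut (Suc i) x y) * d x y + 8 * (R i * cut i x y) + 4 * (R (Suc i) * cut (Suc i) x y))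
      + of_bool (y \<in> C) * (4 * (R (Suc i) * cut (Suc i) x y))"
  proof (cases "x \<in> C"; cases "y \<in> C")
    assume c: "x \<in> C" "y \<in> C"
    then have s: "same (Suc i) x y" by (rule inC)
    show ?thesis
    proof (cases "same i x y")
      case True
      then have "cls i x = cls i y" using cls_eq_iff xy by blast
      then show ?thesis using c True s cls_cen[OF xy(2)] by (simp add: anchor_def cut_def)
    next
      case False
      have "d (cen (cls i x)) (cen (cls i y)) \<le> d (cen (cls i x)) x + d x (cen (cls i y))"
        using cls_cen xy by (intro triangle) auto
      also have "d x (cen (cls i y)) \<le> d x y + d y (cen (cls i y))"
        using cls_cen xy by (intro triangle) auto
      also have "d y (cen (cls i y)) \<le> 4 * R i" using same_diam[of i y] cls_cen xy i by auto
      also have "d (cen (cls i x)) x \<le> 4 * R i" 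
        using same_diam[of i x "cen (cls i x)"] cls_cen[OF xy(1)] xy i commute[of x] by simp
      finally show ?thesis using c False s by (simp add: anchor_def cut_def)
    qed
  next
    assume c: "x \<in> C" "y \<notin> C"
    then have "\<not> same (Suc i) x y" using in_part[OF C c(1)] xy by (auto simp: cls_def)
    moreover from this have "\<not> same i x y" using same_imp_Suc by blast
    ultimately show ?thesis using c cenC[OF c(1)] Rnn by (simp add: anchor_def cut_def)
  next
    assume c: "x \<notin> C" "y \<in> C"
    then have "\<not> same (Suc i) x y" using in_part[OF C c(2)] xy same_sym by (auto simp: cls_def)
    then show ?thesis using c cenC[OF c(2)] by (simp add: anchor_def cut_def commute)
  next
    assume c: "x \<notin> C" "y \<notin> C"
    then show ?thesis using cC by (simp add: anchor_def)
  qed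
  have "(\<Sum>S\<in>kids i C. \<bar>of_bool (x \<in> S) - of_bool (y \<in> S)\<bar>) \<le> cut i x y * (of_bool (x \<in> C) + of_bool (y \<in> C) :: real)"
  proof (cases "same i x y")
    case True
    have "\<bar>of_bool (x \<in> S) - of_bool (y \<in> S)\<bar> = (0 :: real)" if "S \<in> kids i C" for S
    proof -
      have "x \<in> S \<longleftrightarrow> y \<in> S"
        using that in_part[of S i] in_cls[OF xy(1), of i] in_cls[OF xy(2), of i] cls_eq_iff[OF xy, of i] True
        by (auto simp: kids_def)
      then show ?thesis by simp
    qed
    then have "(\<Sum>S\<in>kids i C. \<bar>of_bool (x \<in> S) - of_bool (y \<in> S)\<bar>) = (0 :: real)" by (rule sum.neutral[OF ballI])
    then show ?thesis using True by (simp add: cut_def)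
  next
    case False
    have "(\<Sum>S\<in>kids i C. \<bar>of_bool (x \<in> S) - of_bool (y \<in> S)\<bar>)
        \<le> (\<Sum>S\<in>kids i C. of_bool (x \<in> S) + of_bool (y \<in> S) :: real)" by (intro sum_mono) auto
    also have "\<dots> \<le> of_bool (x \<in> C) + of_bool (y \<in> C)"
      using sum_indicator_kids[OF xy(1) C] sum_indicator_kids[OF xy(2) C] by (simp add: sum.distrib)
    finally show ?thesis using False by (simp add: cut_def)
  qed
  then have "R i * (\<Sum>S\<in>kids i C. \<bar>of_bool (x \<in> S) - of_bool (y \<in> S)\<bar>)
      \<le> R i * (cut i x y * (of_bool (x \<in> C) + of_bool (y \<in> C) :: real))"
    using Rnn by (intro mult_left_mono) auto
  then show ?thesis using A unfolding pair_cost_def by (simp add: algebra_simps)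
qed

lemma R_sum_le: "(\<Sum>i\<le>j. R i) \<le> 2 * R j"
proof (induction j)
  case 0
  show ?case using R_pos[of 0] by simp
next
  case (Suc j)
  have "2 * R j \<le> R (Suc j)" unfolding R_Suc using rho R_pos[of j] by (intro mult_right_mono) auto
  then show ?case using Suc by simp
qed

text \<open>The distance terms telescope to at most \<open>d x y\<close>. A cut at level
  \<open>i\<close> is charged to the label differences at levels \<open>j \<ge> i\<close>; as the
  radii at least double, level \<open>j\<close> collects at most \<open>2 * R j\<close>, and 36 is
  \<open>2 * (10 + 8)\<close>.\<close>

lemma sum_pair_cost_le:
  assumes xy: "x \<in> X" "y \<in> X"
  shows "(\<Sum>i\<in>active. \<Sum>C\<in>parts (Suc i). pair_cost i C x y)
    \<le> d x y + 36 * (\<Sum>j\<le>L. R j * of_bool (lab j x \<noteq> lab j y))"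
proof -
  let ?D = "\<lambda>i. R i * cut i x y" and ?t = "\<lambda>i. (cut i x y - cut (Suc i) x y) * d x y"
  have Rnn: "0 \<le> R i" for i using R_pos by (auto intro: less_imp_le)
  have Dnn: "0 \<le> ?D i" for i using Rnn by (auto simp: cut_def)
  have tnn: "0 \<le> ?t i" for i using same_imp_Suc[of i x y] by (auto simp: cut_def)
  have "(\<Sum>i\<in>active. \<Sum>C\<in>parts (Suc i). pair_cost i C x y) \<le> (\<Sum>i\<in>active. ?t i + 10 * ?D i + 8 * ?D (Suc i))"
  proof (intro sum_mono)
    fix i assume "i \<in> active"
    then have i: "i < L" by (simp add: active_def)
    have "(\<Sum>C\<in>parts (Suc i). pair_cost i C x y) \<le> (\<Sum>C\<in>parts (Suc i).
        of_bool (x \<in> C) * (?t i + 9 * ?D i + 4 * ?D (Suc i)) + of_bool (y \<in> C) * (?D i + 4 * ?D (Suc i)))"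
      using pair_cost_le[OF xy i] by (intro sum_mono) auto
    also have "\<dots> = (?t i + 9 * ?D i + 4 * ?D (Suc i)) + (?D i + 4 * ?D (Suc i))"
      unfolding sum.distrib sum_distrib_right[symmetric] sum_indicator_part[OF xy(1)] sum_indicator_part[OF xy(2)]
      by simp
    finally show "(\<Sum>C\<in>parts (Suc i). pair_cost i C x y) \<le> ?t i + 10 * ?D i + 8 * ?D (Suc i)" by linarith
  qed
  also have "\<dots> \<le> (\<Sum>i<L. ?t i + 10 * ?D i + 8 * ?D (Suc i))"
    using Dnn tnn by (intro sum_mono2) (auto simp: active_def intro!: add_nonneg_nonneg)
  also have "\<dots> = (\<Sum>i<L. ?t i) + 10 * (\<Sum>i<L. ?D i) + 8 * (\<Sum>i<L. ?D (Suc i))"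
    by (simp add: sum.distrib sum_distrib_left)
  also have "(\<Sum>i<L. ?t i) \<le> d x y"
  proof -
    have "(\<Sum>i<L. ?t i) = (cut 0 x y - cut L x y) * d x y"
      unfolding sum_distrib_right[symmetric] by (subst sum_lessThan_telescope') simp
    also have "\<dots> \<le> 1 * d x y" by (intro mult_right_mono) (auto simp: cut_def)
    finally show ?thesis by simp
  qed
  also have "(\<Sum>i<L. ?D i) \<le> (\<Sum>i\<le>L. ?D i)"
    using Dnn by (intro sum_mono2) auto
  also have "(\<Sum>i<L. ?D (Suc i)) \<le> (\<Sum>i\<le>L. ?D i)"
    using Dnn[of 0] unfolding sum.atMost_shift by simp
  also have "(\<Sum>i\<le>L. ?D i) \<le> (\<Sum>i\<le>L. \<Sum>j\<in>{i..L}. R i * of_bool (lab j x \<noteq> lab j y))"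
  proof (intro sum_mono)
    fix i
    have "cut i x y \<le> (\<Sum>j\<in>{i..L}. of_bool (lab j x \<noteq> lab j y))"
    proof (cases "same i x y")
      case True
      then show ?thesis by (simp add: cut_def sum_nonneg)
    next
      case False
      then obtain j where j: "j \<in> {i..L}" "lab j x \<noteq> lab j y" by (auto simp: same_def)
      then have "(1 :: real) \<le> (\<Sum>j\<in>{i..L}. of_bool (lab j x \<noteq> lab j y))"
        using member_le_sum[of j "{i..L}" "\<lambda>j. of_bool (lab j x \<noteq> lab j y) :: real"] by auto
      then show ?thesis using False by (simp add: cut_def)
    qed
    then show "?D i \<le> (\<Sum>j\<in>{i..L}. R i * of_bool (lab j x \<noteq> lab j y))"
      unfolding sum_distrib_left[symmetric] using Rnn by (intro mult_left_mono)
  qed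
  also have "\<dots> = (\<Sum>j\<le>L. \<Sum>i\<le>j. R i * of_bool (lab j x \<noteq> lab j y))"
  proof -
    have "(\<Sum>i\<le>L. \<Sum>j\<in>{j\<in>{..L}. i \<le> j}. R i * of_bool (lab j x \<noteq> lab j y))
        = (\<Sum>j\<le>L. \<Sum>i\<in>{i\<in>{..L}. i \<le> j}. R i * of_bool (lab j x \<noteq> lab j y))"
      by (rule sum.swap_restrict) auto
    moreover have "{j\<in>{..L}. i \<le> j} = {i..L}" for i by auto
    moreover have "(\<Sum>j\<le>L. \<Sum>i\<in>{i\<in>{..L}. i \<le> j}. R i * of_bool (lab j x \<noteq> lab j y))
        = (\<Sum>j\<le>L. \<Sum>i\<le>j. R i * of_bool (lab j x \<noteq> lab j y))"
      by (intro sum.cong refl) auto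
    ultimately show ?thesis by (simp only:)
  qed
  also have "\<dots> \<le> (\<Sum>j\<le>L. 2 * (R j * of_bool (lab j x \<noteq> lab j y)))"
  proof (intro sum_mono)
    fix j
    have "(\<Sum>i\<le>j. R i * of_bool (lab j x \<noteq> lab j y)) \<le> 2 * R j * of_bool (lab j x \<noteq> lab j y)"
      unfolding sum_distrib_right[symmetric] by (intro mult_right_mono R_sum_le) auto
    then show "(\<Sum>i\<le>j. R i * of_bool (lab j x \<noteq> lab j y)) \<le> 2 * (R j * of_bool (lab j x \<noteq> lab j y))" by simp
  qed
  finally show ?thesis by (simp flip: sum_distrib_left)
qed

lemma total_cost_le_pairs:
  assumes \<pi>: "\<pi> \<in> transport_plans X \<mu> \<nu>"
  shows "total_cost (\<lambda>p. \<mu> p - \<nu> p)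
    \<le> (\<Sum>(x, y)\<in>X \<times> X. \<pi> x y * (d x y + 36 * (\<Sum>j\<le>L. R j * of_bool (lab j x \<noteq> lab j y))))"
proof -
  have "total_cost (\<lambda>p. \<mu> p - \<nu> p) \<le> (\<Sum>i\<in>active. \<Sum>C\<in>parts (Suc i). \<Sum>(x, y)\<in>X \<times> X. \<pi> x y * pair_cost i C x y)"
    unfolding total_cost_def by (intro sum_mono local_cost_le_pairs[OF \<pi>]) (auto simp: active_def)
  also have "\<dots> = (\<Sum>i\<in>active. \<Sum>(x, y)\<in>X \<times> X. \<pi> x y * (\<Sum>C\<in>parts (Suc i). pair_cost i C x y))"
    by (intro sum.cong refl, subst sum.swap) (simp add: case_prod_beta sum_distrib_left)
  also have "\<dots> = (\<Sum>(x, y)\<in>X \<times> X. \<pi> x y * (\<Sum>i\<in>active. \<Sum>C\<in>parts (Suc i). pair_cost i C x y))"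
    by (subst sum.swap) (simp add: case_prod_beta sum_distrib_left)
  also have "\<dots> \<le> (\<Sum>(x, y)\<in>X \<times> X. \<pi> x y * (d x y + 36 * (\<Sum>j\<le>L. R j * of_bool (lab j x \<noteq> lab j y))))"
    unfolding case_prod_beta using \<pi>
    by (intro sum_mono mult_left_mono sum_pair_cost_le) (auto simp: transport_plans_def)
  finally show ?thesis .
qed

text \<open>Sending a cluster to its parent maps \<open>parts i\<close> onto
  \<open>parts (Suc i)\<close>, and injectively only if the two partitions coincide. So the number
  of clusters drops at each active level while staying in \<open>{1..card X}\<close>.\<close>

lemma card_active: "card active \<le> card X"
proof -
  let ?F = "\<lambda>i S. cls (Suc i) (cen S)"
  have cen_cls: "cls (Suc i) (cen (cls i x)) = cls (Suc i) x" if "x \<in> X" for i x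
  proof -
    have "cen (cls i x) \<in> X" "same i x (cen (cls i x))"
      using cen_in[OF cls_in_parts[OF that, of i]] by (auto simp: cls_def)
    then show ?thesis using cls_eq_iff that same_imp_Suc by metis
  qed
  have img: "parts (Suc i) = ?F i ` parts i" for i
    unfolding parts_def image_image using cen_cls by (intro image_cong) auto
  have le: "card (parts (Suc i)) \<le> card (parts i)" for i
    unfolding img by (rule card_image_le[OF finite_parts])
  then have anti: "card (parts j) \<le> card (parts i)" if "i \<le> j" for i j
    using lift_Suc_antimono_le[of "\<lambda>i. card (parts i)"] that by blast
  have less: "card (parts (Suc i)) < card (parts i)" if "i \<in> active" for i
  proof (rule ccontr)
    assume "\<not> ?thesis"
    then have "card (?F i ` parts i) = card (parts i)" using le[of i] img by simp
    then have inj: "inj_on (?F i) (parts i)" by (rule eq_card_imp_inj_on[OF finite_parts])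
    have "cls i x = cls (Suc i) x" if x: "x \<in> X" for x
    proof (intro equalityI subsetI)
      fix y assume y: "y \<in> cls (Suc i) x"
      then have yX: "y \<in> X" "cls (Suc i) y = cls (Suc i) x" 
        using in_part[OF cls_in_parts[OF x] y] by auto
      then have "?F i (cls i y) = ?F i (cls i x)" using cen_cls x by simp
      then have "cls i y = cls i x" using inj_onD[OF inj] cls_in_parts x yX(1) by blast
      then show "y \<in> cls i x" using in_cls[OF yX(1)] by auto
    qed (auto simp: cls_def same_imp_Suc)
    then have "parts i = parts (Suc i)" unfolding parts_def by (intro image_cong) auto
    then show False using that by (simp add: active_def)
  qed
  have inj: "inj_on (\<lambda>i. card (parts i)) active"
  proof (rule linorder_inj_onI)
    fix i j assume "i < j" "i \<in> active" "j \<in> active"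
    then have "card (parts j) < card (parts i)" using less[of i] anti[of "Suc i" j] by simp
    then show "card (parts i) \<noteq> card (parts j)" by simp
  qed auto
  have "(\<lambda>i. card (parts i)) ` active \<subseteq> {1..card X}"
  proof
    fix c assume "c \<in> (\<lambda>i. card (parts i)) ` active"
    then obtain i where i: "i \<in> active" "c = card (parts i)" by auto
    then show "c \<in> {1..card X}" using less[OF i(1)] card_parts[of i] by auto
  qed
  then have "card active \<le> card {1..card X}" using card_inj_on_le[OF inj] by blast
  then show ?thesis by simp
qed

text \<open>Points of \<open>C\<close> agree on all levels above \<open>i\<close>, so distinct
  children already differ in their label at level \<open>i\<close>.\<close>

lemma card_kids:
  assumes "i < L" "C \<in> parts (Suc i)"
  shows "card (kids i C) \<le> card (lab i ` C)"
proof -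
  have "inj_on (\<lambda>S. lab i (cen S)) (kids i C)"
  proof (rule inj_onI)
    fix S T assume S: "S \<in> kids i C" and T: "T \<in> kids i C" and eq: "lab i (cen S) = lab i (cen T)"
    have s: "S \<in> parts i" "cen S \<in> C" "cen S \<in> S" and t: "T \<in> parts i" "cen T \<in> C" "cen T \<in> T"
      using S T cen_in by (auto simp: kids_def)
    have X: "cen S \<in> X" "cen T \<in> X" using cen_in_X s t by auto
    have "same (Suc i) (cen S) (cen T)"
      using in_part[OF assms(2)] s(2) t(2) cls_eq_iff[OF X] by metis
    then have "same i (cen S) (cen T)" using same_Suc[of i] eq assms(1) by auto
    then show "S = T" using in_part[OF s(1) s(3)] in_part[OF t(1) t(3)] cls_eq_iff[OF X] by metis
  qed
  moreover have "(\<lambda>S. lab i (cen S)) ` kids i C \<subseteq> lab i ` C"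
    using cen_in by (auto simp: kids_def)
  ultimately show ?thesis
    using card_inj_on_le finite_part[OF assms(2)] by blast
qed

end

subsection \<open>The protocol for a fixed decomposition\<close>

definition unit_distributions :: "nat \<Rightarrow> 'a set \<Rightarrow> ('a \<Rightarrow> real) set" where
  "unit_distributions m X = {\<mu>. (\<forall>x\<in>X. 0 \<le> \<mu> x \<and> (\<exists>k::nat. real m * \<mu> x = real k)) \<and> sum \<mu> X = 1}"

definition units :: "nat \<Rightarrow> ('a \<Rightarrow> real) \<Rightarrow> 'a set \<Rightarrow> nat" where
  "units m \<mu> S = nat \<lfloor>real m * sum \<mu> S\<rfloor>"

lemma units_eq:
  assumes "\<mu> \<in> unit_distributions m X" "S \<subseteq> X" "finite X"
  shows "real (units m \<mu> S) = real m * sum \<mu> S" and "units m \<mu> S \<le> m"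
proof -
  have "\<forall>x\<in>X. \<exists>k::nat. real m * \<mu> x = real k" using assms(1) by (auto simp: unit_distributions_def)
  then obtain k :: "'a \<Rightarrow> nat" where k: "\<And>x. x \<in> X \<Longrightarrow> real m * \<mu> x = real (k x)" by metis
  have "real m * sum \<mu> S = real (sum k S)"
    unfolding sum_distrib_left of_nat_sum using k assms(2) by (intro sum.cong) auto
  then show *: "real (units m \<mu> S) = real m * sum \<mu> S"
    by (simp add: units_def del: of_nat_sum)
  have "sum \<mu> S \<le> sum \<mu> X" using assms by (intro sum_mono2) (auto simp: unit_distributions_def)
  also have "\<dots> = 1" using assms(1) by (simp add: unit_distributions_def)
  finally have "real m * sum \<mu> S \<le> real m * 1" by (intro mult_left_mono) auto
  then show "units m \<mu> S \<le> m" using * by linarith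
qed

text \<open>Unary encoding: an l1 distance of integers becomes the size of a symmetric difference of
  sets.\<close>

lemma card_threshold_diff:
  assumes "a \<le> m" "b \<le> m"
  shows "real (card {t. t < m \<and> (t < a) \<noteq> (t < b)}) = \<bar>real a - real b\<bar>"
proof -
  have "{t. t < m \<and> (t < a) \<noteq> (t < b)} = {min a b..<max a b}" using assms by auto
  then show ?thesis by auto
qed

section \<open>Clusters as weighted items\<close>

context hierarchy
begin

definition parent :: "nat \<Rightarrow> 'a set \<Rightarrow> 'a set" where
  "parent i S = cls (Suc i) (cen S)"

lemma parent_kids:
  assumes "S \<in> parts i"
  shows "parent i S \<in> parts (Suc i)" "C \<in> parts (Suc i) \<Longrightarrow> S \<in> kids i C \<longleftrightarrow> parent i S = C"
proof -
  have c: "cen S \<in> S" "cen S \<in> X" using cen_in[OF assms] cen_in_X[OF assms] by auto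
  then show "parent i S \<in> parts (Suc i)" by (simp add: parent_def cls_in_parts)
  have "S = cls i (cen S)" using in_part[OF assms c(1)] by auto
  then have "S \<subseteq> parent i S" unfolding parent_def using same_imp_Suc by (auto simp: cls_def)
  then show "S \<in> kids i C \<longleftrightarrow> parent i S = C" if "C \<in> parts (Suc i)"
    using in_part[OF that, of "cen S"] c assms by (auto simp: kids_def parent_def)
qed

lemma sum_parts_kids: "(\<Sum>S\<in>parts i. f S) = (\<Sum>C\<in>parts (Suc i). \<Sum>S\<in>kids i C. f S)"
proof -
  have im: "parent i ` parts i \<subseteq> parts (Suc i)" using parent_kids(1) by auto
  have "(\<Sum>S\<in>parts i. f S) = (\<Sum>C\<in>parts (Suc i). sum f {S\<in>parts i. parent i S = C})"
    by (rule sum.group[OF finite_parts finite_parts im, symmetric])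
  also have "\<dots> = (\<Sum>C\<in>parts (Suc i). \<Sum>S\<in>kids i C. f S)"
    using parent_kids(2) by (intro sum.cong refl) (auto simp: kids_def)
  finally show ?thesis .
qed

text \<open>The triple \<open>(i, S, t)\<close> stands for the \<open>t\<close>-th unit of mass in
  the cluster \<open>S\<close> of level \<open>i\<close>; a player holds it if her or his mass in
  \<open>S\<close> exceeds \<open>t\<close> units.\<close>

definition items :: "nat \<Rightarrow> (nat \<times> 'a set \<times> nat) set" where
  "items m = Sigma active (\<lambda>i. parts i \<times> {..<m})"

definition holdings :: "nat \<Rightarrow> ('a \<Rightarrow> real) \<Rightarrow> (nat \<times> 'a set \<times> nat) set" where
  "holdings m \<mu> = {(i, S, t). t < units m \<mu> S}"

lemma finite_items: "finite (items m)"
  unfolding items_def using finite_active finite_parts by auto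

lemma card_items: "card (items m) \<le> card X * (card X * m)"
proof -
  have "card (items m) = (\<Sum>i\<in>active. card (parts i) * m)"
    unfolding items_def using finite_active finite_parts by (subst card_SigmaI) (auto simp: card_cartesian_product)
  also have "\<dots> \<le> (\<Sum>i\<in>active. card X * m)" by (intro sum_mono mult_right_mono card_parts) auto
  also have "\<dots> \<le> card X * (card X * m)" using card_active by simp
  finally show ?thesis .
qed

lemma sum_items:
  assumes "\<mu> \<in> unit_distributions m X" "\<nu> \<in> unit_distributions m X" "0 < m"
  shows "(\<Sum>e\<in>items m \<inter> sym_diff_set (holdings m \<mu>) (holdings m \<nu>). f (fst e) (fst (snd e)) / real m)
    = (\<Sum>i\<in>active. \<Sum>S\<in>parts i. f i S * \<bar>sum (\<lambda>p. \<mu> p - \<nu> p) S\<bar>)"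
proof -
  let ?D = "sym_diff_set (holdings m \<mu>) (holdings m \<nu>)"
  have D: "(i, S, t) \<in> ?D \<longleftrightarrow> (t < units m \<mu> S) \<noteq> (t < units m \<nu> S)" for i S t
    by (auto simp: sym_diff_set_def holdings_def)
  have "items m \<inter> ?D = Sigma active (\<lambda>i. Sigma (parts i) (\<lambda>S. {t. t < m \<and> (t < units m \<mu> S) \<noteq> (t < units m \<nu> S)}))"
    unfolding items_def using D by auto
  note * = this
  have "(\<Sum>e\<in>items m \<inter> ?D. f (fst e) (fst (snd e)) / real m)
      = (\<Sum>i\<in>active. \<Sum>S\<in>parts i. \<Sum>t\<in>{t. t < m \<and> (t < units m \<mu> S) \<noteq> (t < units m \<nu> S)}. f i S / real m)"
  proof -
    let ?T = "\<lambda>S. {t. t < m \<and> (t < units m \<mu> S) \<noteq> (t < units m \<nu> S)}"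
    have "(\<Sum>i\<in>active. \<Sum>S\<in>parts i. \<Sum>t\<in>?T S. f i S / real m)
        = (\<Sum>i\<in>active. \<Sum>(S, t)\<in>Sigma (parts i) ?T. f i S / real m)"
      using finite_parts by (intro sum.cong refl sum.Sigma) auto
    also have "\<dots> = (\<Sum>(i, S, t)\<in>Sigma active (\<lambda>i. Sigma (parts i) ?T). f i S / real m)"
      using finite_active finite_parts by (intro sum.Sigma) auto
    finally show ?thesis unfolding * by (simp only:) (auto intro!: sum.cong)
  qed
  also have "\<dots> = (\<Sum>i\<in>active. \<Sum>S\<in>parts i. f i S * \<bar>sum (\<lambda>p. \<mu> p - \<nu> p) S\<bar>)"
  proof (intro sum.cong refl)
    fix i S assume "S \<in> parts i"
    then have S: "S \<subseteq> X" using in_part by blast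
    note u = units_eq[OF assms(1) S finite_X] units_eq[OF assms(2) S finite_X]
    have "real (card {t. t < m \<and> (t < units m \<mu> S) \<noteq> (t < units m \<nu> S)}) = \<bar>real m * sum \<mu> S - real m * sum \<nu> S\<bar>"
      unfolding card_threshold_diff[OF u(2) u(4)] u(1) u(3) ..
    also have "\<dots> = real m * \<bar>sum (\<lambda>p. \<mu> p - \<nu> p) S\<bar>"
      by (simp add: sum_subtractf abs_mult flip: right_diff_distrib)
    finally show "(\<Sum>t\<in>{t. t < m \<and> (t < units m \<mu> S) \<noteq> (t < units m \<nu> S)}. f i S / real m)
        = f i S * \<bar>sum (\<lambda>p. \<mu> p - \<nu> p) S\<bar>"
      using assms(3) by simp
  qed
  finally show ?thesis .
qed

text \<open>The local cost of \<open>C\<close> is spread over its children in proportion to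
  \<open>\<bar>s S\<bar>\<close>; this is the price per unit of
  \<open>R i * \<bar>s S\<bar>\<close>, the value to be computed for a sampled item. If all
  surpluses vanish, so does the local cost, in accordance with division by zero.\<close>

definition ratio :: "nat \<Rightarrow> 'a set \<Rightarrow> ('a set \<Rightarrow> real) \<Rightarrow> real" where
  "ratio i C s = local_cost i C s / (R i * (\<Sum>S\<in>kids i C. \<bar>s S\<bar>))"

lemma ratio_cong:
  assumes "\<And>S. S \<in> kids i C \<Longrightarrow> s S = s' S"
  shows "ratio i C s = ratio i C s'"
proof -
  have "dipoles i C s = dipoles i C s'" unfolding dipoles_def using assms by (intro ext sum.cong) auto
  moreover have "(\<Sum>S\<in>kids i C. \<bar>s S\<bar>) = (\<Sum>S\<in>kids i C. \<bar>s' S\<bar>)" using assms by (intro sum.cong) auto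
  ultimately show ?thesis by (simp add: ratio_def local_cost_def)
qed

lemma ratio_bounds:
  assumes "i < L" "C \<in> parts (Suc i)" "S \<in> kids i C" "s S \<noteq> 0"
  shows "1 \<le> ratio i C s \<and> ratio i C s \<le> 1 + 4 * \<rho>"
proof -
  have "\<bar>s S\<bar> \<le> (\<Sum>S\<in>kids i C. \<bar>s S\<bar>)" using assms(3) finite_kids by (intro member_le_sum) auto
  then have "0 < R i * (\<Sum>S\<in>kids i C. \<bar>s S\<bar>)" using assms(4) R_pos[of i] by (intro mult_pos_pos) auto
  then show ?thesis using local_cost_bounds[OF assms(1,2), of s]
    unfolding ratio_def by (simp add: pos_le_divide_eq pos_divide_le_eq)
qed

lemma sum_kids_ratio:
  assumes "i < L" "C \<in> parts (Suc i)"
  shows "(\<Sum>S\<in>kids i C. R i * ratio i C s * \<bar>s S\<bar>) = local_cost i C s"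
proof -
  have "(\<Sum>S\<in>kids i C. R i * ratio i C s * \<bar>s S\<bar>) = ratio i C s * (R i * (\<Sum>S\<in>kids i C. \<bar>s S\<bar>))"
    by (simp add: sum_distrib_left mult_ac)
  also have "\<dots> = local_cost i C s"
    using local_cost_bounds[OF assms, of s] unfolding ratio_def by auto
  finally show ?thesis .
qed

lemma total_cost_ratio:
  "(\<Sum>i\<in>active. \<Sum>S\<in>parts i. R i * ratio i (parent i S) (sum \<sigma>) * \<bar>sum \<sigma> S\<bar>) = total_cost \<sigma>"
  unfolding total_cost_def
proof (rule sum.cong[OF refl])
  fix i assume i: "i \<in> active"
  have "(\<Sum>S\<in>parts i. R i * ratio i (parent i S) (sum \<sigma>) * \<bar>sum \<sigma> S\<bar>)
      = (\<Sum>C\<in>parts (Suc i). \<Sum>S\<in>kids i C. R i * ratio i (parent i S) (sum \<sigma>) * \<bar>sum \<sigma> S\<bar>)"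
    by (rule sum_parts_kids)
  also have "\<dots> = (\<Sum>C\<in>parts (Suc i). local_cost i C (sum \<sigma>))"
  proof (rule sum.cong[OF refl])
    fix C assume C: "C \<in> parts (Suc i)"
    have "parent i S = C" if "S \<in> kids i C" for S
      using parent_kids(2)[OF _ C, of S] that by (auto simp: kids_def)
    then have "(\<Sum>S\<in>kids i C. R i * ratio i (parent i S) (sum \<sigma>) * \<bar>sum \<sigma> S\<bar>)
        = (\<Sum>S\<in>kids i C. R i * ratio i C (sum \<sigma>) * \<bar>sum \<sigma> S\<bar>)" by (intro sum.cong) auto
    then show "(\<Sum>S\<in>kids i C. R i * ratio i (parent i S) (sum \<sigma>) * \<bar>sum \<sigma> S\<bar>) = local_cost i C (sum \<sigma>)"
      using sum_kids_ratio[OF _ C] i by (simp add: active_def)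
  qed
  finally show "(\<Sum>S\<in>parts i. R i * ratio i (parent i S) (sum \<sigma>) * \<bar>sum \<sigma> S\<bar>)
      = (\<Sum>C\<in>parts (Suc i). local_cost i C (sum \<sigma>))" .
qed

lemma total_cost_l1:
  "total_cost \<sigma> \<le> (\<Sum>i\<in>active. \<Sum>S\<in>parts i. (1 + 4 * \<rho>) * R i * \<bar>sum \<sigma> S\<bar>)"
  "(\<Sum>i\<in>active. \<Sum>S\<in>parts i. (1 + 4 * \<rho>) * R i * \<bar>sum \<sigma> S\<bar>) \<le> (1 + 4 * \<rho>) * total_cost \<sigma>"
proof -
  have eq: "(\<Sum>i\<in>active. \<Sum>S\<in>parts i. (1 + 4 * \<rho>) * R i * \<bar>sum \<sigma> S\<bar>)
      = (\<Sum>i\<in>active. \<Sum>C\<in>parts (Suc i). (1 + 4 * \<rho>) * (R i * (\<Sum>S\<in>kids i C. \<bar>sum \<sigma> S\<bar>)))"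
    by (rule sum.cong[OF refl], rule trans[OF sum_parts_kids]) (simp only: sum_distrib_left mult.assoc)
  show "total_cost \<sigma> \<le> (\<Sum>i\<in>active. \<Sum>S\<in>parts i. (1 + 4 * \<rho>) * R i * \<bar>sum \<sigma> S\<bar>)"
    unfolding eq total_cost_def by (intro sum_mono local_cost_bounds(2)) (auto simp: active_def)
  show "(\<Sum>i\<in>active. \<Sum>S\<in>parts i. (1 + 4 * \<rho>) * R i * \<bar>sum \<sigma> S\<bar>) \<le> (1 + 4 * \<rho>) * total_cost \<sigma>"
    unfolding eq total_cost_def sum_distrib_left[of "1 + 4 * \<rho>" _ active] sum_distrib_left[of "1 + 4 * \<rho>" _ "parts _"]
    using rho by (intro sum_mono mult_left_mono local_cost_bounds(1)) (auto simp: active_def)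
qed

text \<open>The plain l1 sum is estimated, scaled to dominate the cost. All rewards are 1, so no
  child masses are exchanged; the price is the factor \<open>1 + 4 * \<rho>\<close>, harmless for
  bounded \<rho>.\<close>

lemma coarse_protocol:
  assumes m: "0 < m" and k: "card X * (card X * m) < 2 ^ k" and K: "1000 \<le> K"
    and \<delta>: "(real K + 1) * (real k * (1 / 2) ^ b) \<le> 1 / 20"
  shows "\<exists>F. computable (k * (2 * b) + K * (k * (2 * b))) F \<and>
    (\<forall>\<mu>\<in>unit_distributions m X. \<forall>\<nu>\<in>unit_distributions m X.
       9 / 10 \<le> measure_pmf.prob (F \<mu> \<nu>) {z. total_cost (\<lambda>p. \<mu> p - \<nu> p) \<le> z \<and>
             z \<le> 16 * ((1 + 4 * \<rho>) * total_cost (\<lambda>p. \<mu> p - \<nu> p))})"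
proof -
  define w :: "nat \<times> 'a set \<times> nat \<Rightarrow> real" where "w e = (1 + 4 * \<rho>) * R (fst e) / real m" for e
  have pos: "0 < w e" for e unfolding w_def using rho R_pos m by simp
  have c0: "computable 0 (\<lambda>x y. return_pmf (1 :: real))" by (rule computable_return)
  have "card (items m) < 2 ^ k" using card_items k by (rule le_less_trans)
  note est = estimate_sym_diff[where w = w and g = "\<lambda>_ _ _. 1" and G = 1 and A = "holdings m" and B = "holdings m",
      OF finite_items pos this order_refl _ \<delta> c0]
  have "1000 * 1 \<le> real K" using K by simp
  from est[OF this] obtain F where F: "computable (k * (2 * b) + K * (k * (2 * b) + 0)) F"
    "\<forall>\<mu> \<nu>. (\<forall>e\<in>items m \<inter> sym_diff_set (holdings m \<mu>) (holdings m \<nu>). (1 :: real) \<le> 1 \<and> (1 :: real) \<le> 1)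
       \<longrightarrow> 9 / 10 \<le> measure_pmf.prob (F \<mu> \<nu>)
         {z. (\<Sum>e\<in>items m \<inter> sym_diff_set (holdings m \<mu>) (holdings m \<nu>). w e * 1) \<le> z \<and>
             z \<le> 16 * (\<Sum>e\<in>items m \<inter> sym_diff_set (holdings m \<mu>) (holdings m \<nu>). w e * 1)}"
    by (elim exE conjE) (rule that)
  have "9 / 10 \<le> measure_pmf.prob (F \<mu> \<nu>) {z. total_cost (\<lambda>p. \<mu> p - \<nu> p) \<le> z \<and>
             z \<le> 16 * ((1 + 4 * \<rho>) * total_cost (\<lambda>p. \<mu> p - \<nu> p))}"
    if "\<mu> \<in> unit_distributions m X" "\<nu> \<in> unit_distributions m X" for \<mu> \<nu>
  proof -
    let ?D = "items m \<inter> sym_diff_set (holdings m \<mu>) (holdings m \<nu>)"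
    have s: "(\<Sum>e\<in>?D. w e * 1)
       = (\<Sum>i\<in>active. \<Sum>S\<in>parts i. (1 + 4 * \<rho>) * R i * \<bar>sum (\<lambda>p. \<mu> p - \<nu> p) S\<bar>)"
      unfolding w_def mult_1_right by (rule sum_items[OF that m, of "\<lambda>i S. (1 + 4 * \<rho>) * R i"])
    have "measure_pmf.prob (F \<mu> \<nu>) {z. (\<Sum>e\<in>?D. w e * 1) \<le> z \<and> z \<le> 16 * (\<Sum>e\<in>?D. w e * 1)}
      \<le> measure_pmf.prob (F \<mu> \<nu>) {z. total_cost (\<lambda>p. \<mu> p - \<nu> p) \<le> z \<and>
             z \<le> 16 * ((1 + 4 * \<rho>) * total_cost (\<lambda>p. \<mu> p - \<nu> p))}"
      unfolding s using total_cost_l1[of "\<lambda>p. \<mu> p - \<nu> p"]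
      by (intro measure_pmf.finite_measure_mono) auto
    then show ?thesis using F(2)[rule_format, of \<mu> \<nu>] by simp
  qed
  then show ?thesis using F(1) by (intro exI[of _ F]) simp
qed

text \<open>The reward of an item is the \<open>ratio\<close> of its parent. It lies in
  \<open>[1, 1 + 4 * \<rho>]\<close>, which fixes the number of trials, and costs
  \<open>2 * (N * \<beta>)\<close> bits for the masses of at most \<open>N\<close> children.\<close>

lemma fine_protocol:
  assumes m: "0 < m" "m < 2 ^ \<beta>" and k: "card X * (card X * m) < 2 ^ k" and K: "1000 * (1 + 4 * \<rho>) \<le> real K"
    and \<delta>: "(real K + 1) * (real k * (1 / 2) ^ b) \<le> 1 / 20"
    and kids: "\<And>i C. i < L \<Longrightarrow> C \<in> parts (Suc i) \<Longrightarrow> card (kids i C) \<le> N"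
  shows "\<exists>F. computable (k * (2 * b) + K * (k * (2 * b) + 2 * (N * \<beta>))) F \<and>
    (\<forall>\<mu>\<in>unit_distributions m X. \<forall>\<nu>\<in>unit_distributions m X.
       9 / 10 \<le> measure_pmf.prob (F \<mu> \<nu>) {z. total_cost (\<lambda>p. \<mu> p - \<nu> p) \<le> z \<and>
             z \<le> 16 * total_cost (\<lambda>p. \<mu> p - \<nu> p)})"
proof -
  define w :: "nat \<times> 'a set \<times> nat \<Rightarrow> real" where "w e = R (fst e) / real m" for e
  \<comment> \<open>Counts modulo \<open>2 ^ \<beta>\<close> can be sent with \<beta> bits for
    arbitrary inputs; on \<open>unit_distributions\<close> they are exact, as counts are at most
    \<open>m < 2 ^ \<beta>\<close>.\<close>
  define s where "s \<mu> \<nu> S = (real (units m \<mu> S mod 2 ^ \<beta>) - real (units m \<nu> S mod 2 ^ \<beta>)) / real m"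
    for \<mu> \<nu> :: "'a \<Rightarrow> real" and S
  define g where "g e \<mu> \<nu> = ratio (fst e) (parent (fst e) (fst (snd e))) (s \<mu> \<nu>)" for e :: "nat \<times> 'a set \<times> nat" and \<mu> \<nu>
  have pos: "0 < w e" for e unfolding w_def using R_pos m by simp
  have comp: "computable (2 * (N * \<beta>)) (\<lambda>\<mu> \<nu>. return_pmf (g e \<mu> \<nu>))" if e: "e \<in> items m" for e
  proof -
    define i where "i = fst e"
    define C where "C = parent i (fst (snd e))"
    have i: "i < L" and C: "C \<in> parts (Suc i)"
      using e parent_kids(1) by (auto simp: items_def i_def C_def active_def)
    obtain ks where ks: "set ks = kids i C" "distinct ks" using finite_distinct_list[OF finite_kids] by blast
    define H where "H la lb = ratio i C (\<lambda>S. (real (the (map_of (zip ks la) S)) - real (the (map_of (zip ks lb) S))) / real m)"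
      for la lb :: "nat list"
    have "computable (length ks * \<beta> + length ks * \<beta>) (\<lambda>\<mu> \<nu>.
        bind_pmf (return_pmf (map (\<lambda>S. units m \<mu> S mod 2 ^ \<beta>) ks)) (\<lambda>la.
          map_pmf (H la) (return_pmf (map (\<lambda>S. units m \<nu> S mod 2 ^ \<beta>) ks))))"
      by (intro computable_bind computable_map computable_list computable_Alice_nat computable_Bob_nat)
    moreover have "H (map (\<lambda>S. units m \<mu> S mod 2 ^ \<beta>) ks) (map (\<lambda>S. units m \<nu> S mod 2 ^ \<beta>) ks) = g e \<mu> \<nu>" for \<mu> \<nu>
      unfolding H_def g_def i_def[symmetric] C_def[symmetric]
      by (rule ratio_cong) (simp add: map_of_zip_map s_def ks)
    moreover have "length ks \<le> N" using kids[OF i C] distinct_card[OF ks(2)] ks(1) by simp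
    from mult_right_mono[OF this, of \<beta>] have "length ks * \<beta> + length ks * \<beta> \<le> 2 * (N * \<beta>)" by linarith
    ultimately show ?thesis
      using computable_mono[of "length ks * \<beta> + length ks * \<beta>" "\<lambda>\<mu> \<nu>. return_pmf (g e \<mu> \<nu>)" "2 * (N * \<beta>)"]
      by (simp only: bind_return_pmf map_return_pmf)
  qed
  have G: "1 \<le> 1 + 4 * \<rho>" using rho by simp
  have "card (items m) < 2 ^ k" using card_items k by (rule le_less_trans)
  then have "\<exists>F. computable (k * (2 * b) + K * (k * (2 * b) + 2 * (N * \<beta>))) F \<and>
    (\<forall>\<mu> \<nu>. (\<forall>e\<in>items m \<inter> sym_diff_set (holdings m \<mu>) (holdings m \<nu>). 1 \<le> g e \<mu> \<nu> \<and> g e \<mu> \<nu> \<le> 1 + 4 * \<rho>) \<longrightarrow>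
       9 / 10 \<le> measure_pmf.prob (F \<mu> \<nu>)
         {z. (\<Sum>e\<in>items m \<inter> sym_diff_set (holdings m \<mu>) (holdings m \<nu>). w e * g e \<mu> \<nu>) \<le> z \<and>
             z \<le> 16 * (\<Sum>e\<in>items m \<inter> sym_diff_set (holdings m \<mu>) (holdings m \<nu>). w e * g e \<mu> \<nu>)})"
    by (intro estimate_sym_diff finite_items pos G K \<delta> comp)
  then obtain F where F: "computable (k * (2 * b) + K * (k * (2 * b) + 2 * (N * \<beta>))) F"
    "\<forall>\<mu> \<nu>. (\<forall>e\<in>items m \<inter> sym_diff_set (holdings m \<mu>) (holdings m \<nu>). 1 \<le> g e \<mu> \<nu> \<and> g e \<mu> \<nu> \<le> 1 + 4 * \<rho>) \<longrightarrow>
       9 / 10 \<le> measure_pmf.prob (F \<mu> \<nu>)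
         {z. (\<Sum>e\<in>items m \<inter> sym_diff_set (holdings m \<mu>) (holdings m \<nu>). w e * g e \<mu> \<nu>) \<le> z \<and>
             z \<le> 16 * (\<Sum>e\<in>items m \<inter> sym_diff_set (holdings m \<mu>) (holdings m \<nu>). w e * g e \<mu> \<nu>)}"
    by (elim exE conjE) (rule that)
  have "9 / 10 \<le> measure_pmf.prob (F \<mu> \<nu>) {z. total_cost (\<lambda>p. \<mu> p - \<nu> p) \<le> z \<and>
             z \<le> 16 * total_cost (\<lambda>p. \<mu> p - \<nu> p)}"
    if \<mu>: "\<mu> \<in> unit_distributions m X" and \<nu>: "\<nu> \<in> unit_distributions m X" for \<mu> \<nu>
  proof -
    let ?\<sigma> = "\<lambda>p. \<mu> p - \<nu> p"
    have s: "s \<mu> \<nu> S = sum ?\<sigma> S" if "S \<subseteq> X" for S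
    proof -
      note u = units_eq[OF \<mu> that finite_X] units_eq[OF \<nu> that finite_X]
      have "units m \<mu> S mod 2 ^ \<beta> = units m \<mu> S" "units m \<nu> S mod 2 ^ \<beta> = units m \<nu> S"
        using u m by auto
      then show ?thesis using m(1) by (simp add: s_def u sum_subtractf flip: right_diff_distrib)
    qed
    have g: "g (i, S, t) \<mu> \<nu> = ratio i (parent i S) (sum ?\<sigma>)" if "S \<in> parts i" for i S t
      unfolding g_def fst_conv snd_conv
    proof (rule ratio_cong)
      fix T assume "T \<in> kids i (parent i S)"
      then show "s \<mu> \<nu> T = sum ?\<sigma> T" using in_part by (intro s) (auto simp: kids_def)
    qed
    have "1 \<le> g e \<mu> \<nu> \<and> g e \<mu> \<nu> \<le> 1 + 4 * \<rho>"
      if "e \<in> items m \<inter> sym_diff_set (holdings m \<mu>) (holdings m \<nu>)" for e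
    proof -
      obtain i S t where e: "e = (i, S, t)" by (cases e)
      have iS: "i < L" "S \<in> parts i" using that e by (auto simp: items_def active_def)
      have "units m \<mu> S \<noteq> units m \<nu> S" using that e by (auto simp: sym_diff_set_def holdings_def)
      moreover have SX: "S \<subseteq> X" using in_part[OF iS(2)] by auto
      ultimately have "real m * sum \<mu> S \<noteq> real m * sum \<nu> S"
        unfolding units_eq(1)[OF \<mu> SX finite_X, symmetric] units_eq(1)[OF \<nu> SX finite_X, symmetric] by simp
      then have "sum ?\<sigma> S \<noteq> 0" by (auto simp: sum_subtractf)
      then show ?thesis
        unfolding e g[OF iS(2)] using parent_kids[OF iS(2)] by (intro ratio_bounds[OF iS(1)]) auto
    qed
    note Fg = F(2)[THEN spec, THEN spec, THEN mp, OF ballI[OF this]]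
    have "(\<Sum>e\<in>items m \<inter> sym_diff_set (holdings m \<mu>) (holdings m \<nu>). w e * g e \<mu> \<nu>)
        = (\<Sum>e\<in>items m \<inter> sym_diff_set (holdings m \<mu>) (holdings m \<nu>).
             R (fst e) * ratio (fst e) (parent (fst e) (fst (snd e))) (sum ?\<sigma>) / real m)"
    proof (intro sum.cong refl)
      fix e assume "e \<in> items m \<inter> sym_diff_set (holdings m \<mu>) (holdings m \<nu>)"
      then have "fst (snd e) \<in> parts (fst e)" by (auto simp: items_def)
      from g[OF this, of "snd (snd e)"]
      show "w e * g e \<mu> \<nu> = R (fst e) * ratio (fst e) (parent (fst e) (fst (snd e))) (sum ?\<sigma>) / real m"
        by (simp add: w_def)
    qed
    also have "\<dots> = total_cost ?\<sigma>"
      unfolding total_cost_ratio[symmetric]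
      by (rule sum_items[OF \<mu> \<nu> m(1), of "\<lambda>i S. R i * ratio i (parent i S) (sum ?\<sigma>)"])
    finally show ?thesis using Fg by simp
  qed
  then show ?thesis using F(1) by (intro exI[of _ F]) simp
qed

end

subsection \<open>Random decompositions\<close>

text \<open>An element with maximal \<open>f\<close> has rank \<open>card X\<close>; removing it
  does not increase any other rank. Ties only enlarge ranks.\<close>

lemma sum_inverse_rank_le_harm:
  fixes f :: "'a \<Rightarrow> real"
  assumes "finite X"
  shows "(\<Sum>u\<in>X. 1 / real (card {v\<in>X. f v \<le> f u})) \<le> harm (card X)"
  using assms
proof (induction "card X" arbitrary: X)
  case 0
  then show ?case by (simp add: harm_def)
next
  case (Suc n)
  then have ne: "X \<noteq> {}" by auto
  have "Max (f ` X) \<in> f ` X" using Suc.prems ne by (intro Max_in) auto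
  then obtain w where "w \<in> X" "f w = Max (f ` X)" by auto
  then have w: "w \<in> X" "\<And>u. u \<in> X \<Longrightarrow> f u \<le> f w" using Suc.prems by auto
  have card: "card (X - {w}) = n" using Suc w(1) by simp
  have "(\<Sum>u\<in>X. 1 / real (card {v\<in>X. f v \<le> f u}))
      = 1 / real (card {v\<in>X. f v \<le> f w}) + (\<Sum>u\<in>X - {w}. 1 / real (card {v\<in>X. f v \<le> f u}))"
    by (rule sum.remove[OF Suc.prems w(1)])
  also have "{v\<in>X. f v \<le> f w} = X" using w(2) by auto
  also have "(\<Sum>u\<in>X - {w}. 1 / real (card {v\<in>X. f v \<le> f u}))
      \<le> (\<Sum>u\<in>X - {w}. 1 / real (card {v\<in>X - {w}. f v \<le> f u}))"
  proof (intro sum_mono divide_left_mono)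
    fix u assume u: "u \<in> X - {w}"
    show "real (card {v\<in>X - {w}. f v \<le> f u}) \<le> real (card {v\<in>X. f v \<le> f u})"
      using Suc.prems by (auto intro!: card_mono)
    have "0 < card {v\<in>X - {w}. f v \<le> f u}" "0 < card {v\<in>X. f v \<le> f u}"
      using u Suc.prems by (auto simp: card_gt_0_iff)
    then show "0 < real (card {v\<in>X. f v \<le> f u}) * real (card {v\<in>X - {w}. f v \<le> f u})" by simp
  qed simp
  also have "\<dots> \<le> harm n" using Suc.hyps(1)[of "X - {w}"] card Suc.prems by simp
  finally show ?case unfolding Suc.hyps(2)[symmetric] harm_Suc by (simp add: inverse_eq_divide)
qed

text \<open>Transposing \<open>u\<close> and \<open>v\<close> injects the permutations in which
  \<open>u\<close> is the first element of \<open>A\<close> into those in which \<open>v\<close> is;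
  the latter classes are disjoint for distinct \<open>v\<close>.\<close>

lemma card_first_in_permutation:
  assumes "finite X" "A \<subseteq> X" "u \<in> A"
  shows "real (card {xs\<in>permutations_of_set X. hd (filter (\<lambda>v. v \<in> A) xs) = u}) * real (card A)
    \<le> real (card (permutations_of_set X))"
proof -
  let ?P = "permutations_of_set X"
  define E where "E v = {xs\<in>?P. hd (filter (\<lambda>v. v \<in> A) xs) = v}" for v
  have fin: "finite (E v)" for v by (simp add: E_def)
  have "card (E u) \<le> card (E v)" if v: "v \<in> A" for v
  proof (rule card_inj_on_le[where f = "map (Transposition.transpose u v)"])
    show "inj_on (map (Transposition.transpose u v)) (E u)"
      by (rule inj_on_subset[of _ UNIV]) (auto intro!: inj_mapI)
    show "map (Transposition.transpose u v) ` E u \<subseteq> E v"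
    proof (intro image_subsetI)
      fix xs assume "xs \<in> E u"
      then have xs: "set xs = X" "distinct xs" "hd (filter (\<lambda>v. v \<in> A) xs) = u"
        by (auto simp: E_def permutations_of_set_def)
      have pres: "Transposition.transpose u v z \<in> A \<longleftrightarrow> z \<in> A" for z
        using assms(3) v by (auto simp: Transposition.transpose_def)
      have "Transposition.transpose u v ` X = X"
        using assms v by (intro transpose_image_eq) auto
      moreover have "filter (\<lambda>v. v \<in> A) xs \<noteq> []" using assms xs by (auto simp: filter_empty_conv)
      ultimately show "map (Transposition.transpose u v) xs \<in> E v"
        using xs by (auto simp: E_def permutations_of_set_def filter_map o_def pres hd_map distinct_map
            intro: inj_on_subset[OF inj_transpose])
    qed
  qed (rule fin)
  then have "(\<Sum>v\<in>A. card (E u)) \<le> (\<Sum>v\<in>A. card (E v))" by (rule sum_mono)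
  also have "\<dots> = card (\<Union>v\<in>A. E v)"
    using finite_subset[OF assms(2,1)] fin by (intro card_UN_disjoint[symmetric]) (auto simp: E_def)
  also have "\<dots> \<le> card ?P" by (intro card_mono) (auto simp: E_def)
  finally have "card A * card (E u) \<le> card ?P" by simp
  then have "real (card A * card (E u)) \<le> real (card ?P)" by (rule of_nat_mono)
  then show ?thesis by (simp add: E_def mult.commute)
qed

text \<open>
  The radii form a geometric progression with a random, logarithmically uniform offset. A given
  interval \<open>[lo, hi)\<close> then contributes its length divided by \<open>ln \<rho>\<close>, up to discretisation.
\<close>

lemma sum_geometric_window:
  fixes q s lo hi :: real
  assumes "1 < q" "0 < s" "0 \<le> lo" "lo \<le> hi"
  shows "(q - 1) * (\<Sum>k<n. s * q ^ k * of_bool (lo \<le> s * q ^ k \<and> s * q ^ k < hi)) \<le> (hi - lo) + (q - 1) * hi"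
proof -
  \<comment> \<open>The term \<open>(q - 1) * s * q ^ k\<close> is the length of the gap from
    \<open>s * q ^ k\<close> to the next radius. The gaps that start in the window are disjoint and
    lie between \<open>lo\<close> and \<open>q * hi\<close>.\<close>
  have "(q - 1) * (\<Sum>k<n. s * q ^ k * of_bool (lo \<le> s * q ^ k \<and> s * q ^ k < hi))
      \<le> max 0 (min (s * q ^ n) (q * hi) - lo)"
  proof (induction n)
    case (Suc n)
    have inc: "s * q ^ n \<le> s * q ^ Suc n" using assms by simp
    show ?case
    proof (cases "lo \<le> s * q ^ n \<and> s * q ^ n < hi")
      case True
      have "s * q ^ Suc n \<le> q * hi" using True assms by simp
      moreover have "s * q ^ n \<le> q * hi" using calculation inc by linarith
      ultimately show ?thesis using Suc True inc by (simp add: algebra_simps min_def max_def)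
    next
      case False
      then have "(\<Sum>k<Suc n. s * q ^ k * of_bool (lo \<le> s * q ^ k \<and> s * q ^ k < hi))
         = (\<Sum>k<n. s * q ^ k * of_bool (lo \<le> s * q ^ k \<and> s * q ^ k < hi))" by simp
      then show ?thesis using Suc inc by (simp only:)
    qed
  qed (use assms in auto)
  also have "\<dots> \<le> (hi - lo) + (q - 1) * hi"
  proof -
    have "1 * hi \<le> q * hi" using assms by (intro mult_right_mono) auto
    moreover have "(hi - lo) + (q - 1) * hi = q * hi - lo" by (simp add: algebra_simps)
    ultimately show ?thesis using assms by (auto simp: max_def min_def)
  qed
  finally show ?thesis .
qed

lemma sum_nat_blocks:
  fixes f :: "nat \<Rightarrow> real"
  shows "(\<Sum>j\<le>l. \<Sum>t<M. f (t + M * j)) = (\<Sum>k<M * Suc l. f k)"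
proof (induction l)
  case (Suc l)
  have "(\<Sum>k<M * Suc (Suc l). f k) = (\<Sum>k<M * Suc l. f k) + (\<Sum>k\<in>{M * Suc l..<M * Suc l + M}. f k)"
    using sum.atLeastLessThan_concat[of 0 "M * Suc l" "M * Suc l + M" f]
    by (simp add: atLeast0LessThan algebra_simps)
  also have "(\<Sum>k\<in>{M * Suc l..<M * Suc l + M}. f k) = (\<Sum>t<M. f (t + M * Suc l))"
    using sum.shift_bounds_nat_ivl[of f 0 "M * Suc l" M] by (simp add: atLeast0LessThan add.commute)
  finally show ?case using Suc by simp
qed simp

text \<open>The exponents \<open>t + M * j\<close> run once through an initial segment, so the
  double sum is one geometric sum with ratio \<open>q = root M \<rho>\<close>, where
  \<open>q - 1 \<ge> ln \<rho> / M\<close>. The discretisation error \<open>hi\<close> is absorbed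
  by taking \<open>M\<close> large, which doubles the bound.\<close>

lemma log_uniform_window:
  fixes \<rho> s lo hi \<Delta> :: real
  assumes "1 < \<rho>" "0 < s" "0 \<le> lo" "lo \<le> hi" "0 < M" "hi * ln \<rho> \<le> real M * \<Delta>" "hi - lo \<le> \<Delta>"
  shows "(\<Sum>t<M. \<Sum>j\<le>l. s * root M \<rho> ^ (t + M * j) *
      of_bool (lo \<le> s * root M \<rho> ^ (t + M * j) \<and> s * root M \<rho> ^ (t + M * j) < hi))
    \<le> real M * (2 * \<Delta> / ln \<rho>)"
proof -
  define q where "q = root M \<rho>"
  have q1: "1 < q" unfolding q_def using assms by simp
  have lnq: "ln q = ln \<rho> / real M" unfolding q_def using assms by (simp add: ln_root)
  have lnp: "0 < ln \<rho>" using assms by simp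
  have "ln q \<le> q - 1" using q1 by (intro ln_le_minus_one) auto
  then have qM: "ln \<rho> \<le> real M * (q - 1)" unfolding lnq using assms by (simp add: field_simps)
  define \<Sigma> where "\<Sigma> = (\<Sum>k<M * Suc l. s * q ^ k * of_bool (lo \<le> s * q ^ k \<and> s * q ^ k < hi))"
  have main: "(q - 1) * \<Sigma> \<le> (hi - lo) + (q - 1) * hi"
    unfolding \<Sigma>_def by (rule sum_geometric_window[OF q1 assms(2-4)])
  have "\<Sigma> \<le> (hi - lo) / (q - 1) + hi" using main q1 by (simp add: field_simps)
  also have "(hi - lo) / (q - 1) \<le> \<Delta> / (ln \<rho> / real M)"
    using assms lnp qM q1 by (intro frac_le) (auto simp: field_simps)
  also have "hi \<le> real M * \<Delta> / ln \<rho>" using assms(6) lnp by (simp add: field_simps)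
  finally have "\<Sigma> \<le> real M * (2 * \<Delta> / ln \<rho>)" using assms by (simp add: field_simps)
  then show ?thesis
    unfolding \<Sigma>_def sum_nat_blocks[of _ M l, symmetric] q_def by (subst sum.swap)
qed

lemma harm_le: "0 < n \<Longrightarrow> harm n \<le> 1 + ln (real n)"
proof (induction n rule: nat_induct_non_zero)
  case 1
  show ?case by (simp add: harm_def)
next
  case (Suc n)
  have "ln (real n / real (Suc n)) \<le> real n / real (Suc n) - 1"
    using Suc by (intro ln_le_minus_one) auto
  then have "1 / real (Suc n) \<le> ln (real (Suc n)) - ln (real n)"
    using Suc by (simp add: ln_div field_simps)
  then show ?case using Suc by (simp add: harm_Suc inverse_eq_divide)
qed

section \<open>Covers, packings and nets in doubling spaces\<close>

context finite_metric
begin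

lemma mcball_subset_all: "0 < r \<Longrightarrow> mcball x r \<subseteq> (\<Union>c\<in>X. mcball c (r / 2))"
proof
  fix z assume "0 < r" "z \<in> mcball x r"
  then have "z \<in> X" "z \<in> mcball z (r / 2)" by auto
  then show "z \<in> (\<Union>c\<in>X. mcball c (r / 2))" by blast
qed

text \<open>Attainment of the infimum: cardinalities are integers, so a \<open>t\<close> with
  \<open>2 powr t\<close> below the next integer after \<open>2 powr doubling_dim X d\<close>
  already gives the bound.\<close>

lemma doubling_dim_cover:
  assumes "x \<in> X" "0 < r"
  shows "\<exists>C\<subseteq>X. finite C \<and> real (card C) \<le> 2 powr doubling_dim X d \<and>
    mcball x r \<subseteq> (\<Union>c\<in>C. mcball c (r / 2))"
proof -
  let ?T = "{t. \<forall>x\<in>X. \<forall>r>0. \<exists>C\<subseteq>X. finite C \<and> real (card C) \<le> 2 powr t \<and>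
     mcball x r \<subseteq> (\<Union>c\<in>C. mcball c (r / 2))}"
  have \<alpha>: "doubling_dim X d = Inf ?T" by (simp add: doubling_dim_def)
  have "X \<noteq> {}" using assms by auto
  then have "real (card X) \<le> 2 powr (log 2 (real (card X)))"
    using finite_X by (simp add: card_gt_0_iff)
  then have ne: "log 2 (real (card X)) \<in> ?T"
    using finite_X by (intro CollectI ballI allI impI exI[of _ X] conjI mcball_subset_all) auto
  define N where "N = nat \<lfloor>2 powr doubling_dim X d\<rfloor>"
  have "2 powr doubling_dim X d < real N + 1" unfolding N_def by linarith
  then have "doubling_dim X d < log 2 (real N + 1)"
    by (subst less_log_iff) auto
  moreover have "?T \<noteq> {}" using ne by blast
  ultimately obtain t where t: "t \<in> ?T" "t < log 2 (real N + 1)"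
    unfolding \<alpha> using cInf_lessD[of ?T "log 2 (real N + 1)"] by blast
  then obtain C where C: "C \<subseteq> X" "finite C" "real (card C) \<le> 2 powr t" "mcball x r \<subseteq> (\<Union>c\<in>C. mcball c (r / 2))"
    using assms by blast
  have "2 powr t < real N + 1" using t(2) by (subst (asm) less_log_iff) auto
  then have "card C \<le> N" using C(3) by linarith
  then have "real (card C) \<le> 2 powr doubling_dim X d" unfolding N_def
    by (smt (verit) of_nat_le_iff of_nat_nat of_int_floor_le powr_ge_zero zero_le_floor of_int_of_nat_eq)
  then show ?thesis using C by blast
qed

text \<open>Take a closest pair and the ball around one end that just reaches the other. Balls of
  half the radius contain only their centres, so at least two are needed. The bound lets additive
  constants be absorbed into \<open>\<alpha> / \<epsilon>\<close>.\<close>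

lemma doubling_dim_ge_1:
  assumes "2 \<le> card X"
  shows "1 \<le> doubling_dim X d"
  unfolding doubling_dim_def
proof (rule cInf_greatest)
  have "real (card X) \<le> 2 powr (log 2 (real (card X)))"
    using assms by simp
  then have "log 2 (real (card X)) \<in> {t. \<forall>x\<in>X. \<forall>r>0. \<exists>C\<subseteq>X. finite C \<and> real (card C) \<le> 2 powr t \<and>
     mcball x r \<subseteq> (\<Union>c\<in>C. mcball c (r / 2))}"
    using finite_X by (intro CollectI ballI allI impI exI[of _ X] conjI mcball_subset_all) auto
  then show "{t. \<forall>x\<in>X. \<forall>r>0. \<exists>C\<subseteq>X. finite C \<and> real (card C) \<le> 2 powr t \<and>
     mcball x r \<subseteq> (\<Union>c\<in>C. mcball c (r / 2))} \<noteq> {}" by blast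
next
  fix t assume t: "t \<in> {t. \<forall>x\<in>X. \<forall>r>0. \<exists>C\<subseteq>X. finite C \<and> real (card C) \<le> 2 powr t \<and>
     mcball x r \<subseteq> (\<Union>c\<in>C. mcball c (r / 2))}"
  let ?D = "(\<lambda>(x, y). d x y) ` {(x, y). x \<in> X \<and> y \<in> X \<and> x \<noteq> y}"
  obtain x0 y0 where "x0 \<in> X" "y0 \<in> X" "x0 \<noteq> y0"
    using assms by (metis card_le_Suc0_iff_eq finite_X not_less_eq_eq numeral_2_eq_2)
  then have ne: "?D \<noteq> {}" by auto
  have "{(x, y). x \<in> X \<and> y \<in> X \<and> x \<noteq> y} \<subseteq> X \<times> X" by auto
  then have fin: "finite ?D" using finite_X by (meson finite_SigmaI finite_imageI finite_subset)
  from Min_in[OF fin ne] obtain x y where xy: "x \<in> X" "y \<in> X" "x \<noteq> y" "Min ?D = d x y" by auto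
  have min: "d x y \<le> d u v" if "u \<in> X" "v \<in> X" "u \<noteq> v" for u v
    using Min_le[OF fin, of "d u v"] that xy(4) by auto
  have pos: "0 < d x y" using xy by (simp add: mdist_pos_eq)
  from t xy(1) pos obtain C where C: "C \<subseteq> X" "finite C" "real (card C) \<le> 2 powr t"
      "mcball x (d x y) \<subseteq> (\<Union>c\<in>C. mcball c (d x y / 2))" by blast
  have inC: "z \<in> C" if "z \<in> X" "d x z \<le> d x y" for z
  proof -
    have "z \<in> mcball x (d x y)" using that xy(1) by simp
    then obtain c where c: "c \<in> C" "z \<in> mcball c (d x y / 2)" using C(4) by blast
    then have "c = z" using min[of c z] that C(1) pos by auto
    then show ?thesis using c by simp
  qed
  have "{x, y} \<subseteq> C" using inC xy pos by auto
  then have "card {x, y} \<le> card C" using C(2) by (intro card_mono)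
  then have "2 powr 1 \<le> 2 powr t" using C(3) xy(3) by simp
  then show "1 \<le> t" by (subst (asm) powr_le_cancel_iff) auto
qed

lemma iterated_cover:
  assumes "x \<in> X" "0 < r"
  shows "\<exists>C\<subseteq>X. finite C \<and> real (card C) \<le> (2 powr doubling_dim X d) ^ k \<and>
    mcball x r \<subseteq> (\<Union>c\<in>C. mcball c (r / 2 ^ k))"
proof (induction k)
  case 0
  show ?case using assms by (intro exI[of _ "{x}"]) auto
next
  case (Suc k)
  let ?a = "2 powr doubling_dim X d"
  from Suc obtain C where C: "C \<subseteq> X" "finite C" "real (card C) \<le> ?a ^ k" "mcball x r \<subseteq> (\<Union>c\<in>C. mcball c (r / 2 ^ k))" by blast
  have "\<exists>B\<subseteq>X. finite B \<and> real (card B) \<le> ?a \<and> mcball c (r / 2 ^ k) \<subseteq> (\<Union>b\<in>B. mcball b (r / 2 ^ k / 2))" if "c \<in> C" for c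
    using C(1) that assms(2) by (intro doubling_dim_cover) auto
  then obtain B where B: "\<And>c. c \<in> C \<Longrightarrow> B c \<subseteq> X \<and> finite (B c) \<and> real (card (B c)) \<le> ?a \<and>
      mcball c (r / 2 ^ k) \<subseteq> (\<Union>b\<in>B c. mcball b (r / 2 ^ k / 2))" by metis
  have "real (card (\<Union>c\<in>C. B c)) \<le> (\<Sum>c\<in>C. real (card (B c)))"
    using card_UN_le[OF C(2), of B] by (metis of_nat_le_iff of_nat_sum)
  also have "\<dots> \<le> real (card C) * ?a" using B by (intro sum_bounded_above) auto
  also have "\<dots> \<le> ?a ^ k * ?a" using C(3) by (intro mult_right_mono) auto
  finally have card: "real (card (\<Union>c\<in>C. B c)) \<le> ?a ^ Suc k" by (simp add: mult.commute)
  have cover: "mcball x r \<subseteq> (\<Union>b\<in>(\<Union>c\<in>C. B c). mcball b (r / 2 ^ Suc k))"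
  proof
    fix z assume "z \<in> mcball x r"
    then obtain c where c: "c \<in> C" "z \<in> mcball c (r / 2 ^ k)" using C(4) by auto
    then obtain b where "b \<in> B c" "z \<in> mcball b (r / 2 ^ k / 2)" using B[OF c(1)] by auto
    then show "z \<in> (\<Union>b\<in>(\<Union>c\<in>C. B c). mcball b (r / 2 ^ Suc k))" using c(1) by (auto simp: field_simps)
  qed
  show ?case using card cover B C(2) by (intro exI[of _ "\<Union>c\<in>C. B c"]) auto
qed

text \<open>After \<open>k\<close> halvings with \<open>2 * c \<le> 2 ^ k \<le> 4 * c\<close> the
  covering balls have radius at most \<open>\<epsilon> / 2\<close> and hold at most one separated
  point each.\<close>

lemma card_separated_le:
  assumes "x \<in> X" "0 < \<epsilon>" "1 \<le> c" "N \<subseteq> mcball x (c * \<epsilon>)"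
    and sep: "\<And>p q. p \<in> N \<Longrightarrow> q \<in> N \<Longrightarrow> p \<noteq> q \<Longrightarrow> \<epsilon> < d p q"
  shows "real (card N) \<le> (4 * c) powr doubling_dim X d"
proof -
  define k where "k = nat \<lceil>log 2 (2 * c)\<rceil>"
  have l0: "0 \<le> log 2 (2 * c)" using assms(3) by simp
  have k1: "log 2 (2 * c) \<le> real k" and k2: "real k < log 2 (2 * c) + 1"
    unfolding k_def using l0 by linarith+
  have p1: "2 * c \<le> 2 ^ k" using k1 assms(3) by (subst (asm) log_le_iff) (auto simp: powr_realpow)
  have "2 powr real k \<le> 2 powr (log 2 (2 * c) + 1)" using k2 by simp
  also have "\<dots> = 4 * c" using assms(3) by (simp add: powr_add)
  finally have p2: "2 ^ k \<le> 4 * c" by (simp add: powr_realpow)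
  have "0 < c * \<epsilon>" using assms by simp
  from iterated_cover[OF assms(1) this, of k] obtain C where C: "C \<subseteq> X" "finite C"
    "real (card C) \<le> (2 powr doubling_dim X d) ^ k" "mcball x (c * \<epsilon>) \<subseteq> (\<Union>b\<in>C. mcball b (c * \<epsilon> / 2 ^ k))" by blast
  have "\<exists>b\<in>C. p \<in> mcball b (c * \<epsilon> / 2 ^ k)" if "p \<in> N" for p
    using C(4) assms(4) that by blast
  then obtain b where b: "\<And>p. p \<in> N \<Longrightarrow> b p \<in> C \<and> p \<in> mcball (b p) (c * \<epsilon> / 2 ^ k)" by metis
  have small: "c * \<epsilon> / 2 ^ k \<le> \<epsilon> / 2" using p1 assms(2) by (simp add: field_simps)
  have "inj_on b N"
  proof (rule inj_onI, rule ccontr)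
    fix p q assume pq: "p \<in> N" "q \<in> N" "b p = b q" "p \<noteq> q"
    have "d p q \<le> d p (b p) + d (b p) q" using b[OF pq(1)] b[OF pq(2)] pq(3) by (intro triangle) (auto simp: in_mcball)
    also have "\<dots> \<le> \<epsilon> / 2 + \<epsilon> / 2"
      using b[OF pq(1)] b[OF pq(2)] pq(3) small commute[of p] by (intro add_mono order_trans[OF _ small]) auto
    finally show False using sep[OF pq(1,2,4)] by simp
  qed
  moreover have "b ` N \<subseteq> C" using b by auto
  ultimately have "card N \<le> card C" using C(2) card_inj_on_le by blast
  then have "real (card N) \<le> (2 powr doubling_dim X d) ^ k" using C(3) by linarith
  also have "\<dots> = (2 ^ k) powr doubling_dim X d"
    by (simp add: powr_realpow[symmetric] powr_powr mult.commute)
  also have "\<dots> \<le> (4 * c) powr doubling_dim X d"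
  proof (rule powr_mono2[OF _ _ p2])
    have "1 \<le> 2 powr doubling_dim X d"
    proof -
      obtain B where B: "finite B" "real (card B) \<le> 2 powr doubling_dim X d" "mcball x 1 \<subseteq> (\<Union>c\<in>B. mcball c (1 / 2))"
        using doubling_dim_cover[OF assms(1), of 1] by auto
      have "x \<in> mcball x 1" using assms(1) by simp
      then have "B \<noteq> {}" using B(3) by blast
      then have "1 \<le> card B" using B(1) by (simp add: Suc_leI card_gt_0_iff)
      then show ?thesis using B(2) by linarith
    qed
    then have "2 powr 0 \<le> 2 powr doubling_dim X d" by simp
    then show "0 \<le> doubling_dim X d" by (subst (asm) powr_le_cancel_iff) auto
  qed simp
  finally show ?thesis .
qed

definition is_net :: "real \<Rightarrow> 'a set \<Rightarrow> bool" where
  "is_net r N \<longleftrightarrow> N \<subseteq> X \<and> (\<forall>p\<in>N. \<forall>q\<in>N. p \<noteq> q \<longrightarrow> r < d p q) \<and> (\<forall>u\<in>X. \<exists>p\<in>N. d u p \<le> r)"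

lemma ex_net:
  assumes "0 < r"
  shows "\<exists>N. is_net r N"
proof -
  let ?S = "{N. N \<subseteq> X \<and> (\<forall>p\<in>N. \<forall>q\<in>N. p \<noteq> q \<longrightarrow> r < d p q)}"
  have "finite ?S" by (rule finite_subset[of _ "Pow X"]) (use finite_X in auto)
  moreover have "{} \<in> ?S" by simp
  then have "?S \<noteq> {}" by (metis empty_iff)
  ultimately have "\<exists>N\<in>?S. \<forall>M\<in>?S. N \<subseteq> M \<longrightarrow> N = M" by (rule finite_has_maximal)
  then obtain N where N: "N \<in> ?S" "\<forall>M\<in>?S. N \<subseteq> M \<longrightarrow> N = M" by (elim bexE) (rule that)
  have "\<exists>p\<in>N. d u p \<le> r" if u: "u \<in> X" for u
  proof (rule ccontr)
    assume *: "\<not> ?thesis"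
    then have far1: "r < d u p" if "p \<in> N" for p using that by (meson not_le)
    have far2: "r < d p u" if "p \<in> N" for p using far1[OF that] commute[of u p] by simp
    have "insert u N \<in> ?S" using N(1) u far1 far2 by simp
    moreover have "N \<subseteq> insert u N" by blast
    ultimately have "N = insert u N" by (rule N(2)[rule_format])
    then have "u \<in> N" by (metis insertI1)
    then show False using far1[of u] u assms by simp
  qed
  moreover have "N \<subseteq> X" "\<forall>p\<in>N. \<forall>q\<in>N. p \<noteq> q \<longrightarrow> r < d p q" using N(1) by simp_all
  ultimately have "is_net r N" by (simp add: is_net_def)
  then show ?thesis ..
qed

definition net :: "real \<Rightarrow> 'a set" where
  "net r = (SOME N. is_net r N)"

definition net_point :: "real \<Rightarrow> 'a \<Rightarrow> 'a" where
  "net_point r u = (SOME p. p \<in> net r \<and> d u p \<le> r)"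

lemma is_net_net: "0 < r \<Longrightarrow> is_net r (net r)"
  unfolding net_def by (rule someI_ex) (rule ex_net)

lemma net_point:
  assumes "0 < r" "u \<in> X"
  shows "net_point r u \<in> net r" "net_point r u \<in> X" "d u (net_point r u) \<le> r"
proof -
  have "\<exists>p. p \<in> net r \<and> d u p \<le> r" using is_net_net[OF assms(1)] assms(2) by (auto simp: is_net_def)
  then have *: "net_point r u \<in> net r \<and> d u (net_point r u) \<le> r" unfolding net_point_def by (rule someI_ex)
  then show "net_point r u \<in> net r" "d u (net_point r u) \<le> r" by auto
  then show "net_point r u \<in> X" using is_net_net[OF assms(1)] by (auto simp: is_net_def)
qed

section \<open>Clusters around the first centres of a random permutation\<close>

definition first_center :: "'a list \<Rightarrow> real \<Rightarrow> 'a \<Rightarrow> 'a" where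
  "first_center xs r x = hd (filter (\<lambda>u. d u x \<le> r) xs)"

lemma first_center:
  assumes "xs \<in> permutations_of_set X" "x \<in> X" "0 < r"
  shows "first_center xs r x \<in> X" "d (first_center xs r x) x \<le> r"
proof -
  have "x \<in> set (filter (\<lambda>u. d u x \<le> r) xs)" using assms by (auto simp: permutations_of_set_def)
  then have "hd (filter (\<lambda>u. d u x \<le> r) xs) \<in> set (filter (\<lambda>u. d u x \<le> r) xs)"
    by (intro hd_in_set) (auto simp: filter_empty_conv)
  then show "first_center xs r x \<in> X" "d (first_center xs r x) x \<le> r"
    using assms(1) by (auto simp: first_center_def permutations_of_set_def)
qed

lemma hd_filter_mono:
  assumes "\<And>u. P u \<Longrightarrow> Q u" "filter Q xs \<noteq> []" "P (hd (filter Q xs))"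
  shows "hd (filter P xs) = hd (filter Q xs)"
  using assms by (induction xs) (auto split: if_splits)

text \<open>Let \<open>u\<close> be the first point in the union of the two balls. If it lay in both
  balls, it would be the first centre of \<open>x\<close> and of \<open>y\<close>.\<close>

lemma first_center_differ:
  assumes "xs \<in> permutations_of_set X" "x \<in> X" "y \<in> X" "0 < r" "first_center xs r x \<noteq> first_center xs r y"
  defines "u \<equiv> hd (filter (\<lambda>v. v \<in> {v\<in>X. min (d v x) (d v y) \<le> r}) xs)"
  shows "u \<in> X" "min (d u x) (d u y) \<le> r" "r < max (d u x) (d u y)"
proof -
  let ?Q = "\<lambda>v. v \<in> {v\<in>X. min (d v x) (d v y) \<le> r}"
  have set: "set xs = X" using assms(1) by (auto simp: permutations_of_set_def)
  have "x \<in> set (filter ?Q xs)" using assms set by auto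
  then have ne: "filter ?Q xs \<noteq> []" by (metis empty_iff list.set(1))
  then have "u \<in> set (filter ?Q xs)" unfolding u_def by (rule hd_in_set)
  then show u: "u \<in> X" "min (d u x) (d u y) \<le> r" by auto
  have f: "first_center xs r z = hd (filter (\<lambda>v. v \<in> X \<and> d v z \<le> r) xs)" for z
    unfolding first_center_def using set by (intro arg_cong[of _ _ hd] filter_cong) auto
  show "r < max (d u x) (d u y)"
  proof (rule ccontr)
    assume "\<not> ?thesis"
    then have le: "d u x \<le> r" "d u y \<le> r" by auto
    have "first_center xs r z = u" if "z = x \<or> z = y" for z
      unfolding f u_def
    proof (rule hd_filter_mono[OF _ ne])
      show "?Q v" if "v \<in> X \<and> d v z \<le> r" for v
        using that \<open>z = x \<or> z = y\<close> by (auto simp: min_le_iff_disj)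
      show "hd (filter ?Q xs) \<in> X \<and> d (hd (filter ?Q xs)) z \<le> r"
        using u(1) le that unfolding u_def by blast
    qed
    then show False using assms(5) by simp
  qed
qed

definition radius :: "real \<Rightarrow> real \<Rightarrow> nat \<Rightarrow> nat \<Rightarrow> nat \<Rightarrow> real" where
  "radius \<rho> s M t j = s * root M \<rho> ^ (t + M * j)"

text \<open>First centres may be arbitrarily close to each other. Rounding them to a net makes the
  labels separated, so a packing bound limits their number in a cluster; merging cannot create new
  separations.\<close>

definition label :: "'a list \<Rightarrow> real \<Rightarrow> 'a \<Rightarrow> 'a" where
  "label xs r x = net_point r (first_center xs r x)"

lemma label_props:
  assumes "xs \<in> permutations_of_set X" "x \<in> X" "0 < r"
  shows "label xs r x \<in> net r" "label xs r x \<in> X" "d x (label xs r x) \<le> 2 * r"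
proof -
  note c = first_center[OF assms]
  note n = net_point[OF assms(3) c(1)]
  show "label xs r x \<in> net r" "label xs r x \<in> X" using n by (auto simp: label_def)
  have "d x (label xs r x) \<le> d x (first_center xs r x) + d (first_center xs r x) (label xs r x)"
    using assms c n by (intro triangle) (auto simp: label_def)
  then show "d x (label xs r x) \<le> 2 * r" using c(2) n(3) commute[of x] by (simp add: label_def)
qed

text \<open>
  The element \<open>u\<close> that separates \<open>x\<close> and \<open>y\<close> is the first one of the permutation in the union of the
  two balls. This union contains every point at least as close to \<open>{x, y}\<close> as \<open>u\<close>, so \<open>u\<close> comes first
  with probability at most the inverse of its rank; the ranks sum up to a harmonic number.
\<close>

lemma sum_separation_le:
  assumes \<rho>: "1 < \<rho>" and s: "0 < s" and M: "0 < M" and xy: "x \<in> X" "y \<in> X" "x \<noteq> y"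
    and M_large: "\<And>u v. u \<in> X \<Longrightarrow> v \<in> X \<Longrightarrow> d u v * ln \<rho> \<le> real M * d x y"
  shows "(\<Sum>(xs, t)\<in>permutations_of_set X \<times> {..<M}.
      \<Sum>j\<le>l. radius \<rho> s M t j * of_bool (label xs (radius \<rho> s M t j) x \<noteq> label xs (radius \<rho> s M t j) y))
    \<le> real (card (permutations_of_set X)) * real M * (2 * harm (card X) / ln \<rho> * d x y)"
proof -
  let ?P = "permutations_of_set X"
  let ?r = "radius \<rho> s M"
  have rpos: "0 < ?r t j" for t j using \<rho> s M by (simp add: radius_def)
  define lo where "lo u = min (d u x) (d u y)" for u
  define hi where "hi u = max (d u x) (d u y)" for u
  define rk where "rk u = real (card {v\<in>X. lo v \<le> lo u})" for u
  define win where "win u r = (of_bool (lo u \<le> r \<and> r < hi u) :: real)" for u r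
  define hit where "hit u r xs = (of_bool (hd (filter (\<lambda>v. v \<in> {v\<in>X. lo v \<le> r}) xs) = u) :: real)" for u r xs
  have 1: "of_bool (label xs r x \<noteq> label xs r y) \<le> (\<Sum>u\<in>X. win u r * hit u r xs)"
    if xs: "xs \<in> ?P" and r: "0 < r" for xs r
  proof (cases "first_center xs r x = first_center xs r y")
    case True
    then show ?thesis by (simp add: label_def win_def hit_def sum_nonneg)
  next
    case False
    let ?u = "hd (filter (\<lambda>v. v \<in> {v\<in>X. lo v \<le> r}) xs)"
    from first_center_differ[OF xs xy(1,2) r False]
    have u: "?u \<in> X" "lo ?u \<le> r" "r < hi ?u" unfolding lo_def hi_def by blast+
    have "win ?u r * hit ?u r xs \<le> (\<Sum>u\<in>X. win u r * hit u r xs)"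
      using u(1) finite_X by (intro member_le_sum) (auto simp: win_def hit_def)
    moreover have "win ?u r * hit ?u r xs = 1" using u(2,3) by (simp add: win_def hit_def)
    ultimately show ?thesis by (simp add: of_bool_def)
  qed
  have 2: "win u r * (\<Sum>xs\<in>?P. hit u r xs) \<le> win u r * (real (card ?P) / rk u)" if u: "u \<in> X" for u r
  proof (cases "lo u \<le> r \<and> r < hi u")
    case True
    let ?A = "{v\<in>X. lo v \<le> r}"
    have uA: "u \<in> ?A" using True u by auto
    have "0 < card {v\<in>X. lo v \<le> lo u}" using u finite_X by (auto simp: card_gt_0_iff)
    then have rk0: "0 < rk u" by (simp add: rk_def)
    have "card {v\<in>X. lo v \<le> lo u} \<le> card ?A" using True finite_X by (intro card_mono) auto
    then have rkA: "rk u \<le> real (card ?A)" by (simp add: rk_def)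
    have sum: "(\<Sum>xs\<in>?P. hit u r xs) = real (card {xs\<in>?P. hd (filter (\<lambda>v. v \<in> ?A) xs) = u})"
      unfolding hit_def by (simp add: of_bool_def sum.If_cases Int_def)
    have "(\<Sum>xs\<in>?P. hit u r xs) * rk u \<le> (\<Sum>xs\<in>?P. hit u r xs) * real (card ?A)"
      using rkA by (intro mult_left_mono) (simp_all add: sum)
    also have "\<dots> \<le> real (card ?P)"
      unfolding sum by (rule card_first_in_permutation[OF finite_X _ uA]) auto
    finally have "(\<Sum>xs\<in>?P. hit u r xs) \<le> real (card ?P) / rk u" using rk0 by (simp add: field_simps)
    then show ?thesis by (intro mult_left_mono) (auto simp: win_def)
  qed (auto simp: win_def)
  \<comment> \<open>The radii for which \<open>u\<close> can separate the pair form a window of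
    length at most \<open>d x y\<close> by the triangle inequality, however far away
    \<open>u\<close> is.\<close>
  have 3: "(\<Sum>t<M. \<Sum>j\<le>l. ?r t j * win u (?r t j)) \<le> real M * (2 * d x y / ln \<rho>)" if u: "u \<in> X" for u
    unfolding radius_def win_def
  proof (rule log_uniform_window)
    show "hi u * ln \<rho> \<le> real M * d x y" using M_large[of u x] M_large[of u y] u xy by (auto simp: hi_def max_def)
    have "d u x \<le> d u y + d y x" "d u y \<le> d u x + d x y" using u xy by (auto intro!: triangle)
    then show "hi u - lo u \<le> d x y" using commute[of x y] by (auto simp: hi_def lo_def)
  qed (use \<rho> s M u xy in \<open>auto simp: lo_def hi_def\<close>)
  have "(\<Sum>(xs, t)\<in>?P \<times> {..<M}. \<Sum>j\<le>l. ?r t j * of_bool (label xs (?r t j) x \<noteq> label xs (?r t j) y))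
      \<le> (\<Sum>(xs, t)\<in>?P \<times> {..<M}. \<Sum>j\<le>l. ?r t j * (\<Sum>u\<in>X. win u (?r t j) * hit u (?r t j) xs))"
    unfolding case_prod_beta
    by (intro sum_mono mult_left_mono 1) (auto simp: rpos less_imp_le)
  also have "\<dots> = (\<Sum>xs\<in>?P. \<Sum>t<M. \<Sum>j\<le>l. \<Sum>u\<in>X. ?r t j * (win u (?r t j) * hit u (?r t j) xs))"
    unfolding sum.cartesian_product[symmetric] sum_distrib_left ..
  also have "\<dots> = (\<Sum>t<M. \<Sum>j\<le>l. \<Sum>u\<in>X. \<Sum>xs\<in>?P. ?r t j * (win u (?r t j) * hit u (?r t j) xs))"
    by (subst sum.swap, intro sum.cong refl, subst sum.swap, intro sum.cong refl, subst sum.swap, rule refl)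
  also have "\<dots> = (\<Sum>t<M. \<Sum>j\<le>l. \<Sum>u\<in>X. ?r t j * (win u (?r t j) * (\<Sum>xs\<in>?P. hit u (?r t j) xs)))"
    unfolding sum_distrib_left ..
  also have "\<dots> \<le> (\<Sum>t<M. \<Sum>j\<le>l. \<Sum>u\<in>X. ?r t j * (win u (?r t j) * (real (card ?P) / rk u)))"
    by (intro sum_mono mult_left_mono 2) (auto simp: rpos less_imp_le)
  also have "\<dots> = (\<Sum>u\<in>X. \<Sum>t<M. \<Sum>j\<le>l. ?r t j * win u (?r t j) * (real (card ?P) / rk u))"
    by (subst sum.swap[of _ X "{..l}"], subst sum.swap[of _ X "{..<M}"]) (simp only: mult.assoc)
  also have "\<dots> = (\<Sum>u\<in>X. (real (card ?P) / rk u) * (\<Sum>t<M. \<Sum>j\<le>l. ?r t j * win u (?r t j)))"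
    by (simp add: sum_distrib_left mult_ac)
  also have "\<dots> \<le> (\<Sum>u\<in>X. (real (card ?P) / rk u) * (real M * (2 * d x y / ln \<rho>)))"
    by (intro sum_mono mult_left_mono 3) (auto simp: rk_def)
  also have "\<dots> = real (card ?P) * real M * (2 / ln \<rho> * d x y) * (\<Sum>u\<in>X. 1 / rk u)"
    unfolding sum_distrib_left by (intro sum.cong refl) (simp add: mult_ac)
  also have "\<dots> \<le> real (card ?P) * real M * (2 / ln \<rho> * d x y) * harm (card X)"
    unfolding rk_def using \<rho>
    by (intro mult_left_mono sum_inverse_rank_le_harm[OF finite_X]) auto
  finally show ?thesis by (simp add: mult_ac)
qed

lemma random_hierarchy:
  assumes n: "2 \<le> card X" and \<rho>: "2 \<le> \<rho>"
  shows "\<exists>(\<Omega> :: ('a list \<times> nat) pmf) lab L R. finite (set_pmf \<Omega>) \<and>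
    (\<forall>\<omega>\<in>set_pmf \<Omega>. hierarchy X d (lab \<omega>) L (R \<omega>) \<rho> \<and>
       (\<forall>i<L. \<forall>C\<in>hierarchy.parts X (lab \<omega>) L (Suc i).
          real (card (hierarchy.kids X (lab \<omega>) L i C)) \<le> (20 * \<rho>) powr doubling_dim X d)) \<and>
    (\<forall>x\<in>X. \<forall>y\<in>X. measure_pmf.expectation \<Omega> (\<lambda>\<omega>. \<Sum>j\<le>L. R \<omega> j * of_bool (lab \<omega> j x \<noteq> (lab \<omega> j y :: 'a)))
       \<le> 2 * harm (card X) / ln \<rho> * d x y)"
proof -
  let ?P = "permutations_of_set X"
  let ?D = "(\<lambda>(x, y). d x y) ` {(x, y). x \<in> X \<and> y \<in> X \<and> x \<noteq> y}"
  obtain x0 y0 where xy0: "x0 \<in> X" "y0 \<in> X" "x0 \<noteq> y0"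
    using n by (metis card_le_Suc0_iff_eq finite_X not_less_eq_eq numeral_2_eq_2)
  then have ne: "?D \<noteq> {}" by auto
  have "{(x, y). x \<in> X \<and> y \<in> X \<and> x \<noteq> y} \<subseteq> X \<times> X" by auto
  then have fin: "finite ?D" using finite_X by (meson finite_SigmaI finite_imageI finite_subset)
  define mn where "mn = Min ?D"
  define mx where "mx = Max ?D"
  have mn_le: "mn \<le> d x y" if "x \<in> X" "y \<in> X" "x \<noteq> y" for x y
    unfolding mn_def using that by (intro Min_le[OF fin]) auto
  have le_mx: "d x y \<le> mx" if "x \<in> X" "y \<in> X" "x \<noteq> y" for x y
    unfolding mx_def using that by (intro Max_ge[OF fin]) auto
  have "mn \<in> ?D" unfolding mn_def using fin ne by (rule Min_in)
  then have mn0: "0 < mn" by auto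
  have mx0: "0 < mx" using mn0 mn_le[of x0 y0] le_mx[of x0 y0] xy0 by linarith
  have le_mx': "d x y \<le> mx" if "x \<in> X" "y \<in> X" for x y
    using le_mx[OF that] that mx0 by (cases "x = y") auto
  \<comment> \<open>For every offset \<open>R \<omega> 0 \<le> s * \<rho> = mn / 8\<close>, so
    clusters of the bottom level have diameter below the least distance.\<close>
  define s where "s = mn / (8 * \<rho>)"
  have s0: "0 < s" unfolding s_def using mn0 \<rho> by simp
  have ln0: "0 < ln \<rho>" using \<rho> by simp
  \<comment> \<open>The offsets are fine enough for the discretisation condition of
    \<open>sum_separation_le\<close> to hold for the largest against the smallest distance.\<close>
  obtain M0 :: nat where M0: "mx * ln \<rho> / mn \<le> real M0" using real_arch_simple by blast
  define M where "M = Suc M0"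
  have M: "0 < M" by (simp add: M_def)
  have "mx * ln \<rho> / mn \<le> real M" using M0 by (simp add: M_def)
  then have Mlarge: "mx * ln \<rho> \<le> real M * mn" using mn0 by (simp add: field_simps)
  \<comment> \<open>At level \<open>L\<close> every ball is the whole space, so all points share the
    first centre.\<close>
  obtain L where L: "mx / s < \<rho> ^ L" using real_arch_pow[of \<rho>] \<rho> by auto
  define R where "R \<omega> = radius \<rho> s M (snd \<omega>)" for \<omega> :: "'a list \<times> nat"
  define lab where "lab \<omega> j = label (fst \<omega>) (R \<omega> j)" for \<omega> :: "'a list \<times> nat" and j
  define \<Omega> where "\<Omega> = pmf_of_set (?P \<times> {..<M})"
  have finP: "finite (?P \<times> {..<M})" using finite_X by simp
  have neP: "?P \<times> {..<M} \<noteq> {}" using finite_X M by (auto simp: permutations_of_set_empty_iff)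
  have set\<Omega>: "set_pmf \<Omega> = ?P \<times> {..<M}" unfolding \<Omega>_def by (rule set_pmf_of_set[OF neP finP])
  have q: "root M \<rho> ^ M = \<rho>" using M \<rho> by simp
  have q1: "1 \<le> root M \<rho>" using M \<rho> by simp
  have Rpos: "0 < R \<omega> j" for \<omega> j unfolding R_def radius_def using s0 \<rho> M by simp
  have R_Suc: "R \<omega> (Suc j) = \<rho> * R \<omega> j" for \<omega> j
    unfolding R_def radius_def by (simp add: power_add q algebra_simps)
  have R_eq: "R \<omega> j = s * root M \<rho> ^ snd \<omega> * \<rho> ^ j" for \<omega> j
    unfolding R_def radius_def by (simp add: power_add power_mult q)
  have hier: "hierarchy X d (lab \<omega>) L (R \<omega>) \<rho>" if \<omega>: "\<omega> \<in> set_pmf \<Omega>" for \<omega>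
  proof -
    have xs: "fst \<omega> \<in> ?P" and t: "snd \<omega> < M" using \<omega> unfolding set\<Omega> by auto
    have diam: "d x y \<le> 4 * R \<omega> i" if "x \<in> X" "y \<in> X" "lab \<omega> i x = lab \<omega> i y" for i x y
    proof -
      note lx = label_props[OF xs that(1) Rpos[of \<omega> i]] and ly = label_props[OF xs that(2) Rpos[of \<omega> i]]
      have "d x y \<le> d x (lab \<omega> i x) + d (lab \<omega> i x) y"
        using that lx by (intro triangle) (auto simp: lab_def)
      also have "\<dots> \<le> 2 * R \<omega> i + 2 * R \<omega> i"
        using lx(3) ly(3) that(3) commute[of y "lab \<omega> i y"] by (intro add_mono) (simp_all add: lab_def)
      finally show ?thesis by simp
    qed
    have "root M \<rho> ^ snd \<omega> \<le> root M \<rho> ^ M" using q1 t by (intro power_increasing) auto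
    then have "R \<omega> 0 \<le> s * \<rho>" unfolding R_eq q using s0 by simp
    then have R0: "4 * R \<omega> 0 < mn" unfolding s_def using mn0 \<rho> by simp
    have "1 \<le> root M \<rho> ^ snd \<omega>" using q1 by simp
    then have "s * 1 * \<rho> ^ L \<le> R \<omega> L" unfolding R_eq using s0 \<rho> by (intro mult_right_mono mult_left_mono) auto
    then have RL: "mx \<le> R \<omega> L" using L s0 by (simp add: field_simps)
    show ?thesis
    proof (unfold_locales)
      show "2 \<le> \<rho>" by (rule \<rho>)
      show "0 < R \<omega> i" for i by (rule Rpos)
      show "R \<omega> (Suc i) = \<rho> * R \<omega> i" for i by (rule R_Suc)
      show "d x y \<le> 4 * R \<omega> i" if "i \<le> L" "x \<in> X" "y \<in> X" "lab \<omega> i x = lab \<omega> i y" for i x y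
        by (rule diam[OF that(2-4)])
      show "x = y" if "x \<in> X" "y \<in> X" "lab \<omega> 0 x = lab \<omega> 0 y" for x y
        using diam[OF that] mn_le[OF that(1,2)] R0 by linarith
      show "lab \<omega> L x = lab \<omega> L y" if "x \<in> X" "y \<in> X" for x y
      proof -
        have "filter (\<lambda>u. d u z \<le> R \<omega> L) (fst \<omega>) = fst \<omega>" if "z \<in> X" for z
          using le_mx'[OF _ that] RL xs order_trans[OF _ RL]
          by (intro filter_True ballI) (simp add: permutations_of_set_def)
        then show ?thesis using that by (simp add: lab_def label_def first_center_def)
      qed
    qed
  qed
  have kids: "real (card (hierarchy.kids X (lab \<omega>) L i C)) \<le> (20 * \<rho>) powr doubling_dim X d"
    if \<omega>: "\<omega> \<in> set_pmf \<Omega>" and i: "i < L" and C: "C \<in> hierarchy.parts X (lab \<omega>) L (Suc i)" for \<omega> i C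
  proof -
    interpret H: hierarchy X d "lab \<omega>" L "R \<omega>" \<rho> by (rule hier[OF \<omega>])
    have xs: "fst \<omega> \<in> ?P" using \<omega> unfolding set\<Omega> by auto
    define c where "c = H.cen C"
    have c: "c \<in> C" "c \<in> X" unfolding c_def using H.cen_in[OF C] H.cen_in_X[OF C] by auto
    \<comment> \<open>Labels of points of \<open>C\<close> lie within
      \<open>4 * R (Suc i) + 2 * R i \<le> 5 * \<rho> * R i\<close> of its centre; the packing bound
      contributes the other factor 4 of 20.\<close>
    have "real (card (lab \<omega> i ` C)) \<le> (4 * (5 * \<rho>)) powr doubling_dim X d"
    proof (rule card_separated_le[OF c(2) Rpos[of \<omega> i]])
      show "1 \<le> 5 * \<rho>" using \<rho> by simp
      show "lab \<omega> i ` C \<subseteq> mcball c (5 * \<rho> * R \<omega> i)"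
      proof (intro image_subsetI)
        fix x assume x: "x \<in> C"
        have xX: "x \<in> X" "H.cls (Suc i) c = H.cls (Suc i) x" using H.in_part[OF C x] H.in_part[OF C c(1)] by auto
        have "H.same (Suc i) c x" using xX H.cls_eq_iff c(2) by blast
        then have dc: "d c x \<le> 4 * R \<omega> (Suc i)" using H.same_diam[of "Suc i"] i c xX by auto
        note l = label_props[OF xs xX(1) Rpos[of \<omega> i]]
        have "d c (lab \<omega> i x) \<le> d c x + d x (lab \<omega> i x)" using c xX l by (intro triangle) (auto simp: lab_def)
        also have "\<dots> \<le> 4 * (\<rho> * R \<omega> i) + 2 * R \<omega> i" using dc l unfolding R_Suc by (intro add_mono) (auto simp: lab_def)
        also have "2 * R \<omega> i \<le> \<rho> * R \<omega> i" using \<rho> Rpos[of \<omega> i] by (intro mult_right_mono) auto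
        finally show "lab \<omega> i x \<in> mcball c (5 * \<rho> * R \<omega> i)" using c l by (simp add: lab_def)
      qed
      have "is_net (R \<omega> i) (net (R \<omega> i))" by (rule is_net_net[OF Rpos])
      moreover have "lab \<omega> i ` C \<subseteq> net (R \<omega> i)"
        using label_props(1)[OF xs _ Rpos[of \<omega> i]] H.in_part[OF C] by (auto simp: lab_def)
      ultimately show "R \<omega> i < d p q" if "p \<in> lab \<omega> i ` C" "q \<in> lab \<omega> i ` C" "p \<noteq> q" for p q
        using that unfolding is_net_def by blast
    qed
    then show ?thesis using H.card_kids[OF i C] by simp
  qed
  have expect: "measure_pmf.expectation \<Omega> (\<lambda>\<omega>. \<Sum>j\<le>L. R \<omega> j * of_bool (lab \<omega> j x \<noteq> lab \<omega> j y))
       \<le> 2 * harm (card X) / ln \<rho> * d x y" if xy: "x \<in> X" "y \<in> X" for x y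
  proof (cases "x = y")
    case True
    then show ?thesis using xy by simp
  next
    case False
    have "d u v * ln \<rho> \<le> real M * d x y" if "u \<in> X" "v \<in> X" for u v
    proof -
      have "d u v * ln \<rho> \<le> mx * ln \<rho>" using le_mx'[OF that] ln0 by (intro mult_right_mono) auto
      also have "\<dots> \<le> real M * mn" by (rule Mlarge)
      also have "\<dots> \<le> real M * d x y" using mn_le[OF xy False] by (intro mult_left_mono) auto
      finally show ?thesis .
    qed
    from sum_separation_le[OF _ s0 M xy False this, where l = L] \<rho>
    have *: "(\<Sum>\<omega>\<in>?P \<times> {..<M}. \<Sum>j\<le>L. R \<omega> j * of_bool (lab \<omega> j x \<noteq> lab \<omega> j y))
        \<le> real (card ?P) * real M * (2 * harm (card X) / ln \<rho> * d x y)"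
      by (simp add: R_def lab_def case_prod_beta)
    have "measure_pmf.expectation \<Omega> (\<lambda>\<omega>. \<Sum>j\<le>L. R \<omega> j * of_bool (lab \<omega> j x \<noteq> lab \<omega> j y))
      = (\<Sum>\<omega>\<in>?P \<times> {..<M}. \<Sum>j\<le>L. R \<omega> j * of_bool (lab \<omega> j x \<noteq> lab \<omega> j y)) / real (card (?P \<times> {..<M}))"
      unfolding \<Omega>_def by (rule integral_pmf_of_set[OF neP finP])
    also have "\<dots> \<le> real (card ?P) * real M * (2 * harm (card X) / ln \<rho> * d x y) / real (card (?P \<times> {..<M}))"
      using * by (rule divide_right_mono) simp
    also have "\<dots> = 2 * harm (card X) / ln \<rho> * d x y"
    proof -
      have "?P \<noteq> {}" using neP by blast
      then have "real (card ?P) * real M \<noteq> 0" using M by simp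
      then show ?thesis by (simp add: card_cartesian_product)
    qed
    finally show ?thesis .
  qed
  have fin\<Omega>: "finite (set_pmf \<Omega>)" unfolding set\<Omega> by (rule finP)
  show ?thesis
    by (intro exI[of _ \<Omega>] exI[of _ lab] exI[of _ L] exI[of _ R] conjI ballI allI impI fin\<Omega> hier kids expect)
qed

end

subsection \<open>Assembling the protocol\<close>

lemma transport_plans_nonempty:
  assumes "\<mu> \<in> unit_distributions m X" "\<nu> \<in> unit_distributions m X"
  shows "transport_plans X \<mu> \<nu> \<noteq> {}"
proof -
  have "(\<lambda>p q. \<mu> p * \<nu> q) \<in> transport_plans X \<mu> \<nu>"
    using assms by (auto simp: transport_plans_def unit_distributions_def simp flip: sum_distrib_left sum_distrib_right)
  then show ?thesis by blast
qed

context finite_metric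
begin

lemma EMD_nonneg:
  assumes "\<mu> \<in> unit_distributions m X" "\<nu> \<in> unit_distributions m X"
  shows "0 \<le> EMD X d \<mu> \<nu>"
  unfolding EMD_def
  by (rule cINF_greatest[OF transport_plans_nonempty[OF assms]])
     (auto simp: transport_plans_def intro!: sum_nonneg)

text \<open>The lower estimate holds for every hierarchy. By Markov's inequality the cost is at most
  10 times its expected bound with probability \<open>9 / 10\<close>, and given this the protocol
  succeeds with probability \<open>9 / 10\<close>.\<close>

lemma randomized_protocol:
  fixes \<Omega> :: "'c pmf" and lab :: "'c \<Rightarrow> nat \<Rightarrow> 'a \<Rightarrow> 'b" and G \<kappa> :: real
  assumes fin: "finite (set_pmf \<Omega>)"
    and hier: "\<And>\<omega>. \<omega> \<in> set_pmf \<Omega> \<Longrightarrow> hierarchy X d (lab \<omega>) L (R \<omega>) \<rho>"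
    and sep: "\<And>x y. x \<in> X \<Longrightarrow> y \<in> X \<Longrightarrow>
      measure_pmf.expectation \<Omega> (\<lambda>\<omega>. \<Sum>j\<le>L. R \<omega> j * of_bool (lab \<omega> j x \<noteq> lab \<omega> j y)) \<le> \<kappa> * d x y"
    and \<kappa>: "0 \<le> \<kappa>" and G: "0 \<le> G"
    and prot: "\<And>\<omega>. \<omega> \<in> set_pmf \<Omega> \<Longrightarrow> \<exists>F. computable c F \<and>
      (\<forall>\<mu>\<in>unit_distributions m X. \<forall>\<nu>\<in>unit_distributions m X.
         9 / 10 \<le> measure_pmf.prob (F \<mu> \<nu>)
           {z. hierarchy.total_cost X d (lab \<omega>) L (R \<omega>) (\<lambda>p. \<mu> p - \<nu> p) \<le> z \<and>
               z \<le> G * hierarchy.total_cost X d (lab \<omega>) L (R \<omega>) (\<lambda>p. \<mu> p - \<nu> p)})"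
  shows "\<exists>P. comm_complexity_le P (real c) \<and>
    (\<forall>\<mu>\<in>unit_distributions m X. \<forall>\<nu>\<in>unit_distributions m X.
       2 / 3 \<le> measure_pmf.prob P {p. EMD X d \<mu> \<nu> \<le> run p \<mu> \<nu> \<and>
         run p \<mu> \<nu> \<le> G * (10 * (1 + 36 * \<kappa>) * EMD X d \<mu> \<nu>)})"
proof -
  define tc where "tc \<omega> \<mu> \<nu> = hierarchy.total_cost X d (lab \<omega>) L (R \<omega>) (\<lambda>p. \<mu> p - \<nu> p)" for \<omega> \<mu> \<nu>
  from prot have "\<forall>\<omega>\<in>set_pmf \<Omega>. \<exists>F. computable c F \<and>
      (\<forall>\<mu>\<in>unit_distributions m X. \<forall>\<nu>\<in>unit_distributions m X.
         9 / 10 \<le> measure_pmf.prob (F \<mu> \<nu>) {z. tc \<omega> \<mu> \<nu> \<le> z \<and> z \<le> G * tc \<omega> \<mu> \<nu>})"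
    unfolding tc_def by blast
  from bchoice[OF this] obtain F where F: "\<forall>\<omega>\<in>set_pmf \<Omega>. computable c (F \<omega>) \<and>
      (\<forall>\<mu>\<in>unit_distributions m X. \<forall>\<nu>\<in>unit_distributions m X.
         9 / 10 \<le> measure_pmf.prob (F \<omega> \<mu> \<nu>) {z. tc \<omega> \<mu> \<nu> \<le> z \<and> z \<le> G * tc \<omega> \<mu> \<nu>})"
    by (elim exE) (rule that)
  have "computable c (\<lambda>\<mu> \<nu>. bind_pmf \<Omega> (\<lambda>\<omega>. F \<omega> \<mu> \<nu>))"
    by (rule computable_coins) (use F in blast)
  then obtain P where P: "\<forall>p\<in>set_pmf P. comm_cost p \<le> c"
      "\<And>\<mu> \<nu>. map_pmf (\<lambda>p. run p \<mu> \<nu>) P = bind_pmf \<Omega> (\<lambda>\<omega>. F \<omega> \<mu> \<nu>)"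
    unfolding computable_def by blast
  have "2 / 3 \<le> measure_pmf.prob P {p. EMD X d \<mu> \<nu> \<le> run p \<mu> \<nu> \<and>
         run p \<mu> \<nu> \<le> G * (10 * (1 + 36 * \<kappa>) * EMD X d \<mu> \<nu>)}"
    if \<mu>: "\<mu> \<in> unit_distributions m X" and \<nu>: "\<nu> \<in> unit_distributions m X" for \<mu> \<nu>
  proof -
    let ?e = "EMD X d \<mu> \<nu>" and ?B = "10 * (1 + 36 * \<kappa>)"
    define A where "A = {z. ?e \<le> z \<and> z \<le> G * (?B * ?e)}"
    define good where "good = {\<omega>. tc \<omega> \<mu> \<nu> \<le> ?B * ?e}"
    have e0: "0 \<le> ?e" by (rule EMD_nonneg[OF \<mu> \<nu>])
    have int: "integrable (measure_pmf \<Omega>) f" for f :: "'c \<Rightarrow> real"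
      by (rule integrable_measure_pmf_finite[OF fin])
    have le_tc: "?e \<le> tc \<omega> \<mu> \<nu>" if "\<omega> \<in> set_pmf \<Omega>" for \<omega>
      unfolding tc_def
    proof (rule hierarchy.EMD_le_total_cost[OF hier[OF that]])
      show "0 \<le> \<mu> p \<and> 0 \<le> \<nu> p" if "p \<in> X" for p using that \<mu> \<nu> by (auto simp: unit_distributions_def)
      show "sum \<mu> X = sum \<nu> X" using \<mu> \<nu> by (simp add: unit_distributions_def)
    qed
    have "measure_pmf.expectation \<Omega> (\<lambda>\<omega>. tc \<omega> \<mu> \<nu>) \<le> (1 + 36 * \<kappa>) * plan_cost X d \<pi>"
      if \<pi>: "\<pi> \<in> transport_plans X \<mu> \<nu>" for \<pi>
    proof -
      define s where "s \<omega> z = (\<Sum>j\<le>L. R \<omega> j * of_bool (lab \<omega> j (fst z) \<noteq> lab \<omega> j (snd z)))" for \<omega> z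
      have nn: "0 \<le> \<pi> x y" if "x \<in> X" "y \<in> X" for x y using \<pi> that by (auto simp: transport_plans_def)
      have "measure_pmf.expectation \<Omega> (\<lambda>\<omega>. tc \<omega> \<mu> \<nu>)
          \<le> measure_pmf.expectation \<Omega> (\<lambda>\<omega>. \<Sum>z\<in>X \<times> X. \<pi> (fst z) (snd z) * (d (fst z) (snd z) + 36 * s \<omega> z))"
        using hierarchy.total_cost_le_pairs[OF hier \<pi>]
        by (intro integral_mono_AE int) (auto simp: AE_measure_pmf_iff tc_def s_def case_prod_beta)
      also have "\<dots> = (\<Sum>z\<in>X \<times> X. measure_pmf.expectation \<Omega> (\<lambda>\<omega>. \<pi> (fst z) (snd z) * (d (fst z) (snd z) + 36 * s \<omega> z)))"
        by (rule Bochner_Integration.integral_sum[OF int])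
      also have "\<dots> = (\<Sum>z\<in>X \<times> X. \<pi> (fst z) (snd z) * (d (fst z) (snd z) + 36 * measure_pmf.expectation \<Omega> (\<lambda>\<omega>. s \<omega> z)))"
        by (simp add: Bochner_Integration.integral_add[OF int int])
      also have "\<dots> \<le> (\<Sum>z\<in>X \<times> X. \<pi> (fst z) (snd z) * (d (fst z) (snd z) + 36 * (\<kappa> * d (fst z) (snd z))))"
        using sep nn unfolding s_def by (intro sum_mono mult_left_mono add_left_mono) auto
      also have "\<dots> = (1 + 36 * \<kappa>) * (\<Sum>z\<in>X \<times> X. d (fst z) (snd z) * \<pi> (fst z) (snd z))"
        unfolding sum_distrib_left by (intro sum.cong refl) (simp add: algebra_simps)
      also have "(\<Sum>z\<in>X \<times> X. d (fst z) (snd z) * \<pi> (fst z) (snd z)) = plan_cost X d \<pi>"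
        unfolding plan_cost_def sum.cartesian_product case_prod_beta ..
      finally show ?thesis .
    qed
    then have "measure_pmf.expectation \<Omega> (\<lambda>\<omega>. tc \<omega> \<mu> \<nu>) / (1 + 36 * \<kappa>) \<le> plan_cost X d \<pi>"
      if "\<pi> \<in> transport_plans X \<mu> \<nu>" for \<pi>
      using that \<kappa> by (simp add: field_simps)
    then have "measure_pmf.expectation \<Omega> (\<lambda>\<omega>. tc \<omega> \<mu> \<nu>) / (1 + 36 * \<kappa>) \<le> ?e"
      unfolding EMD_def by (intro cINF_greatest transport_plans_nonempty[OF \<mu> \<nu>]) (simp add: plan_cost_def)
    then have Etc: "measure_pmf.expectation \<Omega> (\<lambda>\<omega>. tc \<omega> \<mu> \<nu>) \<le> (1 + 36 * \<kappa>) * ?e"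
      using \<kappa> by (simp add: field_simps)
    have tc0: "0 \<le> tc \<omega> \<mu> \<nu>" if "\<omega> \<in> set_pmf \<Omega>" for \<omega> using le_tc[OF that] e0 by simp
    \<comment> \<open>For distance \<open>0\<close> Markov's inequality says nothing; there the cost
      is nonnegative with expectation \<open>0\<close>, hence almost surely
      \<open>0\<close>.\<close>
    have good: "9 / 10 \<le> measure_pmf.prob \<Omega> good"
    proof (cases "?e = 0")
      case True
      then have "measure_pmf.expectation \<Omega> (\<lambda>\<omega>. tc \<omega> \<mu> \<nu>) \<le> 0" using Etc by simp
      moreover have "0 \<le> measure_pmf.expectation \<Omega> (\<lambda>\<omega>. tc \<omega> \<mu> \<nu>)"
        using tc0 by (intro integral_nonneg_AE) (simp add: AE_measure_pmf_iff)
      ultimately have "AE \<omega> in \<Omega>. tc \<omega> \<mu> \<nu> = 0"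
        using integral_nonneg_eq_0_iff_AE[OF int, of "\<lambda>\<omega>. tc \<omega> \<mu> \<nu>"] tc0
        by (simp add: AE_measure_pmf_iff)
      then have "set_pmf \<Omega> \<subseteq> good" using True by (auto simp: good_def AE_measure_pmf_iff)
      then have "measure_pmf.prob \<Omega> good = 1" by (auto simp: measure_pmf.prob_eq_1 AE_measure_pmf_iff)
      then show ?thesis by simp
    next
      case False
      then have epos: "0 < ?B * ?e" using e0 \<kappa> by simp
      have "measure_pmf.prob \<Omega> {\<omega>. ?B * ?e \<le> tc \<omega> \<mu> \<nu>} \<le> measure_pmf.expectation \<Omega> (\<lambda>\<omega>. tc \<omega> \<mu> \<nu>) / (?B * ?e)"
        using integral_Markov_inequality_measure[OF int[of "\<lambda>\<omega>. tc \<omega> \<mu> \<nu>"], of "{}" "?B * ?e"] epos tc0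
        by (simp add: AE_measure_pmf_iff)
      also have "\<dots> \<le> ((1 + 36 * \<kappa>) * ?e) / (?B * ?e)" using Etc epos by (intro divide_right_mono) auto
      also have "\<dots> = 1 / 10"
      proof -
        define c where "c = (1 + 36 * \<kappa>) * ?e"
        have c: "?B * ?e = 10 * c" by (simp only: c_def mult.assoc)
        have "0 < c" using epos unfolding c by simp
        then show ?thesis unfolding c c_def[symmetric] by simp
      qed
      finally have "measure_pmf.prob \<Omega> {\<omega>. ?B * ?e \<le> tc \<omega> \<mu> \<nu>} \<le> 1 / 10" .
      moreover have "measure_pmf.prob \<Omega> (- {\<omega>. ?B * ?e \<le> tc \<omega> \<mu> \<nu>}) = 1 - measure_pmf.prob \<Omega> {\<omega>. ?B * ?e \<le> tc \<omega> \<mu> \<nu>}"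
        using measure_pmf.prob_compl[of "{\<omega>. ?B * ?e \<le> tc \<omega> \<mu> \<nu>}" \<Omega>] by (simp add: Compl_eq_Diff_UNIV)
      moreover have "measure_pmf.prob \<Omega> (- {\<omega>. ?B * ?e \<le> tc \<omega> \<mu> \<nu>}) \<le> measure_pmf.prob \<Omega> good"
        by (intro measure_pmf.finite_measure_mono) (auto simp: good_def)
      ultimately show ?thesis by linarith
    qed
    have cond: "9 / 10 * indicator good \<omega> \<le> measure_pmf.prob (F \<omega> \<mu> \<nu>) A" if \<omega>: "\<omega> \<in> set_pmf \<Omega>" for \<omega>
    proof (cases "\<omega> \<in> good")
      case True
      have "G * tc \<omega> \<mu> \<nu> \<le> G * (?B * ?e)" using True G by (intro mult_left_mono) (auto simp: good_def)
      then have "{z. tc \<omega> \<mu> \<nu> \<le> z \<and> z \<le> G * tc \<omega> \<mu> \<nu>} \<subseteq> A" using le_tc[OF \<omega>] by (auto simp: A_def)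
      then have "measure_pmf.prob (F \<omega> \<mu> \<nu>) {z. tc \<omega> \<mu> \<nu> \<le> z \<and> z \<le> G * tc \<omega> \<mu> \<nu>} \<le> measure_pmf.prob (F \<omega> \<mu> \<nu>) A"
        by (intro measure_pmf.finite_measure_mono) auto
      moreover have "9 / 10 \<le> measure_pmf.prob (F \<omega> \<mu> \<nu>) {z. tc \<omega> \<mu> \<nu> \<le> z \<and> z \<le> G * tc \<omega> \<mu> \<nu>}"
        using F \<omega> \<mu> \<nu> by blast
      ultimately show ?thesis using True by simp
    qed simp
    \<comment> \<open>Together the success probability is at least \<open>81 / 100\<close>, more
      than the required \<open>2 / 3\<close>.\<close>
    have "9 / 10 * measure_pmf.prob \<Omega> good = measure_pmf.expectation \<Omega> (\<lambda>\<omega>. 9 / 10 * indicator good \<omega>)" by simp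
    also have "\<dots> \<le> measure_pmf.expectation \<Omega> (\<lambda>\<omega>. measure_pmf.prob (F \<omega> \<mu> \<nu>) A)"
      using cond by (intro integral_mono_AE int) (simp add: AE_measure_pmf_iff)
    also have "\<dots> = measure_pmf.expectation \<Omega> (\<lambda>\<omega>. measure_pmf.expectation (F \<omega> \<mu> \<nu>) (indicator A))" by simp
    also have "\<dots> = measure_pmf.expectation (bind_pmf \<Omega> (\<lambda>\<omega>. F \<omega> \<mu> \<nu>)) (indicator A)"
      by (rule expectation_bind_pmf_bounded[symmetric, where B = 1]) (auto simp: indicator_def)
    also have "\<dots> = measure_pmf.prob (map_pmf (\<lambda>p. run p \<mu> \<nu>) P) A" unfolding P(2) by simp
    also have "\<dots> = measure_pmf.prob P {p. ?e \<le> run p \<mu> \<nu> \<and> run p \<mu> \<nu> \<le> G * (?B * ?e)}"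
      by (simp add: A_def vimage_def)
    finally show ?thesis using good by simp
  qed
  moreover have "comm_complexity_le P (real c)" using P(1) by (simp add: comm_complexity_le_def)
  ultimately show ?thesis by blast
qed

end

text \<open>
  If \<open>n\<^sup>a\<close> is not an integer, the sum of a grid distribution can only be \<open>1\<close> if it is a point mass.
\<close>

lemma grid_distributions_units:
  assumes "finite X" "X \<noteq> {}" "0 < a"
  shows "\<exists>m::nat. 0 < m \<and> real m \<le> real (card X) powr a \<and> grid_distributions a X \<subseteq> unit_distributions m X"
proof -
  define n where "n = real (card X) powr a"
  have "1 \<le> card X" using assms by (simp add: Suc_leI card_gt_0_iff)
  then have n1: "1 \<le> n" unfolding n_def using assms(3) by (intro ge_one_powr_ge_zero) auto
  have val: "\<mu> x = 1 \<or> (\<exists>k::nat. \<mu> x = real k / n)" if "\<mu> \<in> grid_distributions a X" "x \<in> X" for \<mu> x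
    using that unfolding grid_distributions_def n_def by (auto dest!: PiE_mem)
  have sum1: "sum \<mu> X = 1" if "\<mu> \<in> grid_distributions a X" for \<mu>
    using that by (auto simp: grid_distributions_def)
  have nn: "0 \<le> \<mu> x" if "\<mu> \<in> grid_distributions a X" "x \<in> X" for \<mu> x
    using val[OF that] n1 by auto
  show ?thesis
  proof (cases "\<exists>m::nat. real m = n")
    case True
    then obtain m :: nat where m: "real m = n" by blast
    have "grid_distributions a X \<subseteq> unit_distributions m X"
    proof
      fix \<mu> assume \<mu>: "\<mu> \<in> grid_distributions a X"
      have "\<exists>k::nat. real m * \<mu> x = real k" if x: "x \<in> X" for x
        using val[OF \<mu> x] m n1 by auto
      then show "\<mu> \<in> unit_distributions m X" using nn[OF \<mu>] sum1[OF \<mu>] by (auto simp: unit_distributions_def)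
    qed
    then show ?thesis using m n1 unfolding n_def by (intro exI[of _ m]) auto
  next
    case False
    have "grid_distributions a X \<subseteq> unit_distributions 1 X"
    proof
      fix \<mu> assume \<mu>: "\<mu> \<in> grid_distributions a X"
      have "\<exists>x0\<in>X. \<mu> x0 = 1"
      proof (rule ccontr)
        assume "\<not> ?thesis"
        then have "\<forall>x\<in>X. \<exists>k::nat. \<mu> x = real k / n" using val[OF \<mu>] by blast
        from bchoice[OF this] obtain k :: "'a \<Rightarrow> nat" where k: "\<forall>x\<in>X. \<mu> x = real (k x) / n" by blast
        have "1 = (\<Sum>x\<in>X. real (k x) / n)" using sum1[OF \<mu>] k by simp
        also have "\<dots> = real (sum k X) / n" by (simp add: sum_divide_distrib)
        finally have "real (sum k X) = n" using n1 by (simp add: field_simps)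
        then show False using False by blast
      qed
      then obtain x0 where x0: "x0 \<in> X" "\<mu> x0 = 1" by blast
      have "sum \<mu> X = \<mu> x0 + sum \<mu> (X - {x0})" by (rule sum.remove[OF assms(1) x0(1)])
      then have "sum \<mu> (X - {x0}) = 0" using sum1[OF \<mu>] x0(2) by simp
      then have "\<forall>x\<in>X - {x0}. \<mu> x = 0" using nn[OF \<mu>] assms(1) by (subst (asm) sum_nonneg_eq_0_iff) auto
      then have "\<exists>k::nat. real 1 * \<mu> x = real k" if "x \<in> X" for x
        using that x0(2) by (cases "x = x0") (auto intro: exI[of _ 0] exI[of _ 1])
      then show "\<mu> \<in> unit_distributions 1 X" using nn[OF \<mu>] sum1[OF \<mu>] by (auto simp: unit_distributions_def)
    qed
    then show ?thesis using n1 unfolding n_def by (intro exI[of _ 1]) auto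
  qed
qed

section \<open>Choice of the parameters and the final bounds\<close>

lemma ex_power_of_two:
  assumes "1 \<le> y"
  shows "\<exists>k::nat. y < 2 ^ k \<and> real k \<le> 1 + log 2 y"
proof -
  define k where "k = nat \<lfloor>log 2 y\<rfloor> + 1"
  have "0 \<le> log 2 y" using assms by simp
  then have k: "log 2 y < real k" "real k \<le> 1 + log 2 y" unfolding k_def by linarith+
  have "y < 2 powr real k" using k(1) assms by (subst (asm) log_less_iff) auto
  then show ?thesis using k(2) by (auto simp: powr_realpow)
qed

lemma ln_bounds:
  assumes "2 \<le> n"
  shows "1 / 2 \<le> ln (real n)" "log 2 (real n) \<le> 2 * ln (real n)"
proof -
  have "ln (1 / 2) \<le> 1 / 2 - (1 :: real)" by (intro ln_le_minus_one) auto
  then have ln2: "1 / 2 \<le> ln (2 :: real)" by (simp add: ln_div)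
  also have "ln 2 \<le> ln (real n)" using assms by simp
  finally show 1: "1 / 2 \<le> ln (real n)" .
  have "ln (real n) / ln 2 \<le> ln (real n) / (1 / 2)" using ln2 1 by (intro divide_left_mono) auto
  then show "log 2 (real n) \<le> 2 * ln (real n)" by (simp add: log_def)
qed

context finite_metric
begin

lemma protocol_exists:
  assumes n: "2 \<le> card X" and a: "0 < a" and \<epsilon>: "0 < \<epsilon>" "\<epsilon> < 1"
  defines "c1 \<equiv> 2 * (3 + a)"
  defines "c2 \<equiv> 2 * (3 + log 2 (100040 * c1))"
  shows "\<exists>P. comm_complexity_le P ((9004 * (c1 * c2) + 18004 * c1) * (real (card X) powr \<epsilon> * ln (real (card X)) ^ 2)) \<and>
    (\<forall>\<mu>\<in>grid_distributions a X. \<forall>\<nu>\<in>grid_distributions a X.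
       2 / 3 \<le> measure_pmf.prob P {p. EMD X d \<mu> \<nu> \<le> run p \<mu> \<nu> \<and>
         run p \<mu> \<nu> \<le> 13687200 * (doubling_dim X d / \<epsilon>) * EMD X d \<mu> \<nu>})"
proof -
  define nn where "nn = real (card X)"
  define l where "l = ln nn"
  define \<alpha> where "\<alpha> = doubling_dim X d"
  \<comment> \<open>The exponent \<epsilon> is split in halves: both the number of trials and the
    number of children of a cluster are \<open>O(s)\<close>, and the cost contains their
    product.\<close>
  define s where "s = nn powr (\<epsilon> / 2)"
  have nn2: "2 \<le> nn" using n by (simp add: nn_def)
  have l: "1 / 2 \<le> l" "log 2 nn \<le> 2 * l" using ln_bounds[OF n] by (auto simp: l_def nn_def)
  have l_le: "l \<le> nn" unfolding l_def using nn2 ln_le_minus_one[of nn] by simp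
  have log1: "1 \<le> log 2 nn" using nn2 by simp
  have \<alpha>1: "1 \<le> \<alpha>" unfolding \<alpha>_def by (rule doubling_dim_ge_1[OF n])
  have \<alpha>\<epsilon>: "1 \<le> \<alpha> / \<epsilon>" using \<alpha>1 \<epsilon> by simp
  have s1: "1 \<le> s" unfolding s_def using nn2 \<epsilon> by (intro ge_one_powr_ge_zero) auto
  have ss: "s * s = nn powr \<epsilon>" unfolding s_def by (simp flip: powr_add)
  have s_le: "s \<le> s * s" using s1 by simp
  have c1: "6 \<le> c1" unfolding c1_def using a by simp
  have "1 \<le> 100040 * c1" using c1 by simp
  then have logc: "0 \<le> log 2 (100040 * c1)" by simp
  then have c2: "6 \<le> c2" unfolding c2_def by simp
  have "X \<noteq> {}" using n by auto
  from grid_distributions_units[OF finite_X this a] obtain m where m: "0 < m" "real m \<le> nn powr a"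
    "grid_distributions a X \<subseteq> unit_distributions m X" unfolding nn_def by blast
  have y1: "1 \<le> nn * (nn * real m)"
  proof -
    have "1 * (1 * 1) \<le> nn * (nn * real m)" using nn2 m(1) by (intro mult_mono) auto
    then show ?thesis by simp
  qed
  obtain k :: nat where k: "nn * (nn * real m) < 2 ^ k" "real k \<le> 1 + log 2 (nn * (nn * real m))"
    using ex_power_of_two[OF y1] by blast
  have "real (card X * (card X * m)) < real (2 ^ k)" using k(1) by (simp add: nn_def)
  then have k': "card X * (card X * m) < 2 ^ k" by (rule of_nat_less_imp_less)
  have "card X * (card X * m) \<ge> 1 * (1 * m)" using n by (intro mult_mono) auto
  then have mk: "m < 2 ^ k" using k' by linarith
  have kl: "real k \<le> c1 * l"
  proof -
    have "log 2 (nn * (nn * real m)) = 2 * log 2 nn + log 2 (real m)"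
      using nn2 m(1) by (simp add: log_mult)
    also have "log 2 (real m) \<le> log 2 (nn powr a)" using m nn2 by simp
    also have "log 2 (nn powr a) = a * log 2 nn" using nn2 by (simp add: log_powr)
    finally have "real k \<le> (3 + a) * log 2 nn" using k(2) log1 by (simp add: algebra_simps)
    also have "\<dots> \<le> (3 + a) * (2 * l)" using l(2) a by (intro mult_left_mono) auto
    finally show ?thesis by (simp add: c1_def algebra_simps)
  qed
  have z1: "1 \<le> 100040 * c1 * (nn * nn)"
  proof -
    have "1 * (1 * 1) \<le> 100040 * c1 * (nn * nn)" using nn2 c1 by (intro mult_mono) auto
    then show ?thesis by simp
  qed
  \<comment> \<open>The number of rounds per equality test; \<open>100040 = 20 * 5002\<close>
    matches the error \<open>1 / 20\<close> and the bound \<open>5002 * nn\<close> on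
    \<open>K + 1\<close> below.\<close>
  obtain b :: nat where b: "100040 * c1 * (nn * nn) < 2 ^ b" "real b \<le> 1 + log 2 (100040 * c1 * (nn * nn))"
    using ex_power_of_two[OF z1] by blast
  have bl: "real b \<le> c2 * l"
  proof -
    have "log 2 (100040 * c1 * (nn * nn)) = log 2 (100040 * c1) + 2 * log 2 nn"
      using nn2 c1 by (simp add: log_mult)
    moreover have "log 2 (100040 * c1) * 1 \<le> log 2 (100040 * c1) * log 2 nn"
      using logc log1 by (intro mult_left_mono) auto
    ultimately have "real b \<le> (3 + log 2 (100040 * c1)) * log 2 nn"
      using b(2) log1 by (simp add: algebra_simps)
    also have "\<dots> \<le> (3 + log 2 (100040 * c1)) * (2 * l)" using l(2) logc by (intro mult_left_mono) auto
    finally show ?thesis by (simp add: c2_def algebra_simps)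
  qed
  have \<delta>: "(real K + 1) * (real k * (1 / 2) ^ b) \<le> 1 / 20" if K: "real K + 1 \<le> 5002 * nn" for K
  proof -
    have "real k \<le> c1 * nn" 
      by (rule order_trans[OF kl mult_left_mono[OF l_le]]) (use c1 in simp)
    then have "(real K + 1) * real k \<le> (5002 * nn) * (c1 * nn)" using K nn2 by (intro mult_mono) auto
    then have "20 * ((real K + 1) * real k) \<le> 2 ^ b" using b(1) by (simp add: algebra_simps)
    then show ?thesis by (simp add: field_simps power_one_over)
  qed
  \<comment> \<open>Here \<open>9004 = 2 + 2 * 4501\<close> and \<open>18004 = 2 * 4501 * 2\<close>,
    the last factor from \<open>l \<le> 2 * l\<^sup>2\<close>. The bound \<open>4501 * s\<close>
    comes from \<open>K \<le> 4000 * \<rho> + 1001\<close>.\<close>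
  have cost: "real (k * (2 * b) + K * (k * (2 * b) + 2 * (N * k)))
      \<le> (9004 * (c1 * c2) + 18004 * c1) * (nn powr \<epsilon> * l ^ 2)"
    if K: "real K \<le> 4501 * s" and N: "real N \<le> s" for K N
  proof -
    have l0: "0 \<le> l" using l(1) by simp
    have kb: "real k * real b \<le> c1 * c2 * (l * l)"
      using mult_mono[OF kl bl] c1 l0 by (simp add: mult_ac)
    have "l * 1 \<le> l * (2 * l)" using l by (intro mult_left_mono) auto
    then have "c1 * l \<le> c1 * (2 * (l * l))" using c1 by (intro mult_left_mono) (auto simp: mult_ac)
    then have kl2: "real k \<le> 2 * c1 * (l * l)" using kl by simp
    have K2: "real K \<le> 4501 * (s * s)" using K s_le by simp
    have KN: "real K * real N \<le> 4501 * (s * s)" using mult_mono[OF K N] s1 by simp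
    have cc: "0 \<le> c1 * c2 * (l * l)" using c1 c2 l0 by simp
    have t1: "real k * real b \<le> (s * s) * (c1 * c2 * (l * l))"
    proof -
      have "1 * (c1 * c2 * (l * l)) \<le> (s * s) * (c1 * c2 * (l * l))"
        by (rule mult_right_mono[OF order_trans[OF s1 s_le] cc])
      then show ?thesis using kb by simp
    qed
    have t2: "real K * (real k * real b) \<le> 4501 * (s * s) * (c1 * c2 * (l * l))"
      by (rule mult_mono[OF K2 kb]) (use s1 in simp_all)
    have t3: "real K * real N * real k \<le> 4501 * (s * s) * (2 * c1 * (l * l))"
      by (rule mult_mono[OF KN kl2]) (use s1 in simp_all)
    have "real (k * (2 * b) + K * (k * (2 * b) + 2 * (N * k)))
        = 2 * (real k * real b) + 2 * (real K * (real k * real b)) + 2 * (real K * real N * real k)"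
      by (simp add: algebra_simps)
    also have "\<dots> \<le> 2 * ((s * s) * (c1 * c2 * (l * l))) + 2 * (4501 * (s * s) * (c1 * c2 * (l * l)))
        + 2 * (4501 * (s * s) * (2 * c1 * (l * l)))"
      using t1 t2 t3 by linarith
    also have "\<dots> = (9004 * (c1 * c2) + 18004 * c1) * (nn powr \<epsilon> * l ^ 2)"
      unfolding ss[symmetric] by (simp add: algebra_simps power2_eq_square)
    finally show ?thesis .
  qed
  have harm: "harm (card X) \<le> 3 * l" using harm_le[of "card X"] n l(1) by (simp add: l_def nn_def)
  have harm0: "0 \<le> (harm (card X) :: real)" by (simp add: harm_nonneg)
  define T where "T = (9004 * (c1 * c2) + 18004 * c1) * (nn powr \<epsilon> * l ^ 2)"
  have conclude: "\<exists>P. comm_complexity_le P T \<and>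
      (\<forall>\<mu>\<in>grid_distributions a X. \<forall>\<nu>\<in>grid_distributions a X.
         2 / 3 \<le> measure_pmf.prob P {p. EMD X d \<mu> \<nu> \<le> run p \<mu> \<nu> \<and>
           run p \<mu> \<nu> \<le> 13687200 * (\<alpha> / \<epsilon>) * EMD X d \<mu> \<nu>})"
    if P: "comm_complexity_le P (real c)" "real c \<le> T"
      "\<forall>\<mu>\<in>unit_distributions m X. \<forall>\<nu>\<in>unit_distributions m X.
       2 / 3 \<le> measure_pmf.prob P {p. EMD X d \<mu> \<nu> \<le> run p \<mu> \<nu> \<and>
         run p \<mu> \<nu> \<le> G * (10 * (1 + 36 * \<kappa>) * EMD X d \<mu> \<nu>)}"
      and G: "G * (10 * (1 + 36 * \<kappa>)) \<le> 13687200 * (\<alpha> / \<epsilon>)" for P c G \<kappa>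
  proof (intro exI[of _ P] conjI ballI)
    show "comm_complexity_le P T" using P(1) order_trans[OF _ P(2)] by (simp add: comm_complexity_le_def)
    fix \<mu> \<nu> assume "\<mu> \<in> grid_distributions a X" "\<nu> \<in> grid_distributions a X"
    then have \<mu>: "\<mu> \<in> unit_distributions m X" and \<nu>: "\<nu> \<in> unit_distributions m X" using m(3) by auto
    have "G * (10 * (1 + 36 * \<kappa>) * EMD X d \<mu> \<nu>) \<le> 13687200 * (\<alpha> / \<epsilon>) * EMD X d \<mu> \<nu>"
      using mult_right_mono[OF G EMD_nonneg[OF \<mu> \<nu>]] by (simp only: mult.assoc)
    then have "measure_pmf.prob P {p. EMD X d \<mu> \<nu> \<le> run p \<mu> \<nu> \<and>
         run p \<mu> \<nu> \<le> G * (10 * (1 + 36 * \<kappa>) * EMD X d \<mu> \<nu>)}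
      \<le> measure_pmf.prob P {p. EMD X d \<mu> \<nu> \<le> run p \<mu> \<nu> \<and>
           run p \<mu> \<nu> \<le> 13687200 * (\<alpha> / \<epsilon>) * EMD X d \<mu> \<nu>}"
      by (intro measure_pmf.finite_measure_mono) auto
    moreover have "2 / 3 \<le> measure_pmf.prob P {p. EMD X d \<mu> \<nu> \<le> run p \<mu> \<nu> \<and>
         run p \<mu> \<nu> \<le> G * (10 * (1 + 36 * \<kappa>) * EMD X d \<mu> \<nu>)}"
      using P(3) \<mu> \<nu> by blast
    ultimately show "2 / 3 \<le> measure_pmf.prob P {p. EMD X d \<mu> \<nu> \<le> run p \<mu> \<nu> \<and>
           run p \<mu> \<nu> \<le> 13687200 * (\<alpha> / \<epsilon>) * EMD X d \<mu> \<nu>}"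
      by (rule order_trans[rotated])
  qed
  define q where "q = \<alpha> / \<epsilon>"
  \<comment> \<open>If \<open>N0\<close> is bounded, then \<open>ln n = O(\<alpha> / \<epsilon>)\<close> and a tree approximation (\<open>\<rho> = 2\<close>) suffices.
     Otherwise \<open>\<rho>\<close> is chosen so that a cluster has at most \<open>n powr (\<epsilon> / 2)\<close> children.\<close>
  define N0 where "N0 = nn powr (\<epsilon> / (2 * \<alpha>))"
  have "\<exists>P. comm_complexity_le P T \<and>
      (\<forall>\<mu>\<in>grid_distributions a X. \<forall>\<nu>\<in>grid_distributions a X.
         2 / 3 \<le> measure_pmf.prob P {p. EMD X d \<mu> \<nu> \<le> run p \<mu> \<nu> \<and>
           run p \<mu> \<nu> \<le> 13687200 * (\<alpha> / \<epsilon>) * EMD X d \<mu> \<nu>})"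
  proof (cases "N0 < 1600")
    case True
    define \<kappa> where "\<kappa> = 2 * harm (card X) / ln (2 :: real)"
    from random_hierarchy[OF n order_refl] obtain \<Omega> :: "('a list \<times> nat) pmf" and lab :: "'a list \<times> nat \<Rightarrow> nat \<Rightarrow> 'a \<Rightarrow> 'a" and L R
      where \<Omega>: "finite (set_pmf \<Omega>)" and H: "\<forall>\<omega>\<in>set_pmf \<Omega>. hierarchy X d (lab \<omega>) L (R \<omega>) 2 \<and>
       (\<forall>i<L. \<forall>C\<in>hierarchy.parts X (lab \<omega>) L (Suc i).
          real (card (hierarchy.kids X (lab \<omega>) L i C)) \<le> (20 * 2) powr doubling_dim X d)"
      and E: "\<forall>x\<in>X. \<forall>y\<in>X. measure_pmf.expectation \<Omega> (\<lambda>\<omega>. \<Sum>j\<le>L. R \<omega> j * of_bool (lab \<omega> j x \<noteq> lab \<omega> j y))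
       \<le> 2 * harm (card X) / ln 2 * d x y"
      by (elim exE conjE) (rule that)
    have ln2: "1 / 2 \<le> ln (2 :: real)" using ln_bounds(1)[of 2] by simp
    have \<kappa>0: "0 \<le> \<kappa>" unfolding \<kappa>_def using harm0 ln2 by simp
    have \<delta>K: "(real 1000 + 1) * (real k * (1 / 2) ^ b) \<le> 1 / 20" by (rule \<delta>) (use nn2 in simp)
    \<comment> \<open>The factor is \<open>144 = 16 * (1 + 4 * 2)\<close>, as \<rho> is 2 in this
      case.\<close>
    have prot: "\<exists>F. computable (k * (2 * b) + 1000 * (k * (2 * b))) F \<and>
      (\<forall>\<mu>\<in>unit_distributions m X. \<forall>\<nu>\<in>unit_distributions m X.
         9 / 10 \<le> measure_pmf.prob (F \<mu> \<nu>)
           {z. hierarchy.total_cost X d (lab \<omega>) L (R \<omega>) (\<lambda>p. \<mu> p - \<nu> p) \<le> z \<and>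
               z \<le> 144 * hierarchy.total_cost X d (lab \<omega>) L (R \<omega>) (\<lambda>p. \<mu> p - \<nu> p)})"
      if "\<omega> \<in> set_pmf \<Omega>" for \<omega>
    proof -
      have "hierarchy X d (lab \<omega>) L (R \<omega>) 2" using H that by blast
      from hierarchy.coarse_protocol[OF this m(1) k' order_refl \<delta>K] show ?thesis by simp
    qed
    have "\<exists>P. comm_complexity_le P (real (k * (2 * b) + 1000 * (k * (2 * b)))) \<and>
      (\<forall>\<mu>\<in>unit_distributions m X. \<forall>\<nu>\<in>unit_distributions m X.
       2 / 3 \<le> measure_pmf.prob P {p. EMD X d \<mu> \<nu> \<le> run p \<mu> \<nu> \<and>
         run p \<mu> \<nu> \<le> 144 * (10 * (1 + 36 * \<kappa>) * EMD X d \<mu> \<nu>)})"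
    proof (rule randomized_protocol[OF \<Omega> _ _ \<kappa>0])
      show "hierarchy X d (lab \<omega>) L (R \<omega>) 2" if "\<omega> \<in> set_pmf \<Omega>" for \<omega> using H that by blast
      show "measure_pmf.expectation \<Omega> (\<lambda>\<omega>. \<Sum>j\<le>L. R \<omega> j * of_bool (lab \<omega> j x \<noteq> lab \<omega> j y)) \<le> \<kappa> * d x y"
        if "x \<in> X" "y \<in> X" for x y unfolding \<kappa>_def using E that by blast
    qed (use prot in simp_all)
    then obtain P where P: "comm_complexity_le P (real (k * (2 * b) + 1000 * (k * (2 * b))))"
      "\<forall>\<mu>\<in>unit_distributions m X. \<forall>\<nu>\<in>unit_distributions m X.
       2 / 3 \<le> measure_pmf.prob P {p. EMD X d \<mu> \<nu> \<le> run p \<mu> \<nu> \<and>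
         run p \<mu> \<nu> \<le> 144 * (10 * (1 + 36 * \<kappa>) * EMD X d \<mu> \<nu>)}"
      by (elim exE conjE) (rule that)
    have le: "real (k * (2 * b) + 1000 * (k * (2 * b))) \<le> T"
      using cost[of 1000 0] s1 unfolding T_def by simp
    have "\<kappa> \<le> 2 * (3 * l) / (1 / 2)"
      unfolding \<kappa>_def using harm ln2 harm0 l(1) by (intro frac_le mult_left_mono) auto
    then have \<kappa>l: "\<kappa> \<le> 12 * l" by simp
    \<comment> \<open>Since \<open>1600 < 2048\<close>, a small \<open>N0\<close> forces
      \<open>l \<le> 22 * (\<alpha> / \<epsilon>)\<close>.\<close>
    have "ln N0 \<le> ln (2 ^ 11)" using True nn2 unfolding N0_def by (intro ln_mono) auto
    also have "\<dots> = 11 * ln 2" by (subst ln_realpow) auto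
    also have "\<dots> \<le> 11" using ln_2_less_1 by simp
    finally have "\<epsilon> / (2 * \<alpha>) * l \<le> 11" unfolding N0_def l_def using nn2 by (simp add: ln_powr)
    then have "l \<le> 22 * (\<alpha> / \<epsilon>)" using \<alpha>1 \<epsilon> by (simp add: field_simps)
    \<comment> \<open>\<open>9505 = 1 + 36 * 12 * 22\<close>, using \<open>q \<ge> 1\<close>. This
      case determines the final constant: \<open>144 * 10 * 9505 = 13687200\<close>.\<close>
    then have "1 + 36 * \<kappa> \<le> 9505 * q" using \<kappa>l \<alpha>\<epsilon> unfolding q_def[symmetric] by linarith
    then have G: "144 * (10 * (1 + 36 * \<kappa>)) \<le> 13687200 * (\<alpha> / \<epsilon>)"
      unfolding q_def[symmetric] by simp
    show ?thesis by (rule conclude[OF P(1) le P(2) G])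
  next
    case False
    \<comment> \<open>The number of children is at most
      \<open>(20 * \<rho>) powr \<alpha> = N0 powr \<alpha> = s\<close>.\<close>
    define \<rho> where "\<rho> = N0 / 20"
    define K where "K = nat \<lceil>1000 * (1 + 4 * \<rho>)\<rceil>"
    define N where "N = nat \<lfloor>(20 * \<rho>) powr \<alpha>\<rfloor>"
    define \<kappa> where "\<kappa> = 2 * harm (card X) / ln \<rho>"
    have N0: "1600 \<le> N0" using False by simp
    have \<rho>: "80 \<le> \<rho>" unfolding \<rho>_def using N0 by simp
    have \<rho>2: "2 \<le> \<rho>" using \<rho> by simp
    have "N0 \<le> nn powr (\<epsilon> / 2)"
      unfolding N0_def using nn2 \<alpha>1 \<epsilon> by (intro powr_mono) (auto simp: field_simps)
    then have \<rho>s: "\<rho> \<le> s" unfolding \<rho>_def s_def using N0 by simp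
    have "s \<le> nn powr 1" unfolding s_def using nn2 \<epsilon> by (intro powr_mono) auto
    then have s_nn: "s \<le> nn" using nn2 by simp
    have K: "1000 * (1 + 4 * \<rho>) \<le> real K" "real K \<le> 1000 * (1 + 4 * \<rho>) + 1"
      unfolding K_def using \<rho> of_nat_ceiling[of "1000 * (1 + 4 * \<rho>)"]
        ceiling_correct[of "1000 * (1 + 4 * \<rho>)"] by (auto simp: of_nat_nat)
    have "(20 * \<rho>) powr \<alpha> = s" unfolding \<rho>_def N0_def s_def using \<alpha>1 by (simp add: powr_powr)
    then have N: "real N \<le> s" "\<And>c. real c \<le> (20 * \<rho>) powr \<alpha> \<Longrightarrow> c \<le> N"
      unfolding N_def using s1 by (simp, linarith)+
    from random_hierarchy[OF n \<rho>2] obtain \<Omega> :: "('a list \<times> nat) pmf" and lab :: "'a list \<times> nat \<Rightarrow> nat \<Rightarrow> 'a \<Rightarrow> 'a" and L R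
      where \<Omega>: "finite (set_pmf \<Omega>)" and H: "\<forall>\<omega>\<in>set_pmf \<Omega>. hierarchy X d (lab \<omega>) L (R \<omega>) \<rho> \<and>
       (\<forall>i<L. \<forall>C\<in>hierarchy.parts X (lab \<omega>) L (Suc i).
          real (card (hierarchy.kids X (lab \<omega>) L i C)) \<le> (20 * \<rho>) powr doubling_dim X d)"
      and E: "\<forall>x\<in>X. \<forall>y\<in>X. measure_pmf.expectation \<Omega> (\<lambda>\<omega>. \<Sum>j\<le>L. R \<omega> j * of_bool (lab \<omega> j x \<noteq> lab \<omega> j y))
       \<le> 2 * harm (card X) / ln \<rho> * d x y"
      by (elim exE conjE) (rule that)
    have ln\<rho>: "0 < ln \<rho>" using \<rho> by simp
    have \<kappa>0: "0 \<le> \<kappa>" unfolding \<kappa>_def using harm0 ln\<rho> by simp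
    have \<delta>K: "(real K + 1) * (real k * (1 / 2) ^ b) \<le> 1 / 20"
      by (rule \<delta>) (use K(2) \<rho>s s_nn nn2 in simp)
    have prot: "\<exists>F. computable (k * (2 * b) + K * (k * (2 * b) + 2 * (N * k))) F \<and>
      (\<forall>\<mu>\<in>unit_distributions m X. \<forall>\<nu>\<in>unit_distributions m X.
         9 / 10 \<le> measure_pmf.prob (F \<mu> \<nu>)
           {z. hierarchy.total_cost X d (lab \<omega>) L (R \<omega>) (\<lambda>p. \<mu> p - \<nu> p) \<le> z \<and>
               z \<le> 16 * hierarchy.total_cost X d (lab \<omega>) L (R \<omega>) (\<lambda>p. \<mu> p - \<nu> p)})"
      if \<omega>: "\<omega> \<in> set_pmf \<Omega>" for \<omega>
    proof -
      have h: "hierarchy X d (lab \<omega>) L (R \<omega>) \<rho>" using H \<omega> by blast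
      show ?thesis
        by (rule hierarchy.fine_protocol[OF h m(1) mk k' K(1) \<delta>K])
           (use H \<omega> N(2) in \<open>auto simp: \<alpha>_def\<close>)
    qed
    have "\<exists>P. comm_complexity_le P (real (k * (2 * b) + K * (k * (2 * b) + 2 * (N * k)))) \<and>
      (\<forall>\<mu>\<in>unit_distributions m X. \<forall>\<nu>\<in>unit_distributions m X.
       2 / 3 \<le> measure_pmf.prob P {p. EMD X d \<mu> \<nu> \<le> run p \<mu> \<nu> \<and>
         run p \<mu> \<nu> \<le> 16 * (10 * (1 + 36 * \<kappa>) * EMD X d \<mu> \<nu>)})"
    proof (rule randomized_protocol[OF \<Omega> _ _ \<kappa>0])
      show "hierarchy X d (lab \<omega>) L (R \<omega>) \<rho>" if "\<omega> \<in> set_pmf \<Omega>" for \<omega> using H that by blast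
      show "measure_pmf.expectation \<Omega> (\<lambda>\<omega>. \<Sum>j\<le>L. R \<omega> j * of_bool (lab \<omega> j x \<noteq> lab \<omega> j y)) \<le> \<kappa> * d x y"
        if "x \<in> X" "y \<in> X" for x y unfolding \<kappa>_def using E that by blast
    qed (use prot in simp_all)
    then obtain P where P: "comm_complexity_le P (real (k * (2 * b) + K * (k * (2 * b) + 2 * (N * k))))"
      "\<forall>\<mu>\<in>unit_distributions m X. \<forall>\<nu>\<in>unit_distributions m X.
       2 / 3 \<le> measure_pmf.prob P {p. EMD X d \<mu> \<nu> \<le> run p \<mu> \<nu> \<and>
         run p \<mu> \<nu> \<le> 16 * (10 * (1 + 36 * \<kappa>) * EMD X d \<mu> \<nu>)}"
      by (elim exE conjE) (rule that)
    have "real K \<le> 4501 * s" using K(2) \<rho> \<rho>s by simp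
    then have le: "real (k * (2 * b) + K * (k * (2 * b) + 2 * (N * k))) \<le> T"
      unfolding T_def by (rule cost[OF _ N(1)])
    have lnN0: "ln N0 = \<epsilon> / (2 * \<alpha>) * l" unfolding N0_def l_def using nn2 by (simp add: ln_powr)
    \<comment> \<open>Dividing \<open>N0\<close> by 20 costs at most half of the logarithm:
      \<open>N0 \<le> \<rho> * \<rho>\<close>, hence
      \<open>ln \<rho> \<ge> ln N0 / 2\<close>.\<close>
    have "N0 * 1600 \<le> N0 * N0" using N0 by (intro mult_left_mono) auto
    then have "N0 \<le> \<rho> * \<rho>" unfolding \<rho>_def using N0 by simp
    then have "ln N0 \<le> ln (\<rho> * \<rho>)" using N0 by (intro ln_mono) auto
    also have "\<dots> = 2 * ln \<rho>" using \<rho> by (simp add: ln_mult)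
    finally have "\<epsilon> / (4 * \<alpha>) * l \<le> ln \<rho>" unfolding lnN0 by simp
    moreover have pos: "0 < \<epsilon> / (4 * \<alpha>) * l" using \<epsilon> \<alpha>1 l(1) by simp
    ultimately have "\<kappa> \<le> 2 * (3 * l) / (\<epsilon> / (4 * \<alpha>) * l)"
      unfolding \<kappa>_def using harm harm0 l(1) by (intro frac_le mult_left_mono) auto
    also have "\<dots> = 24 * (\<alpha> / \<epsilon>)" using \<epsilon> \<alpha>1 l(1) by (simp add: field_simps)
    finally have "1 + 36 * \<kappa> \<le> 865 * q" using \<alpha>\<epsilon> unfolding q_def[symmetric] by linarith
    moreover have "0 \<le> q" using \<alpha>\<epsilon> unfolding q_def[symmetric] by linarith
    ultimately have G: "16 * (10 * (1 + 36 * \<kappa>)) \<le> 13687200 * (\<alpha> / \<epsilon>)"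
      unfolding q_def[symmetric] by simp
    show ?thesis by (rule conclude[OF P(1) le P(2) G])
  qed
  then show ?thesis unfolding T_def \<alpha>_def nn_def l_def .
qed

end

lemma EMD_singleton:
  assumes "Metric_space X d" "X = {x}" "\<mu> \<in> grid_distributions a X" "\<nu> \<in> grid_distributions a X"
  shows "EMD X d \<mu> \<nu> = 0"
proof -
  interpret Metric_space X d by (rule assms(1))
  have "\<mu> x = 1" "\<nu> x = 1" using assms by (auto simp: grid_distributions_def)
  then have "(\<lambda>_ _. 1) \<in> transport_plans X \<mu> \<nu>" using assms(2) by (simp add: transport_plans_def)
  then have "transport_plans X \<mu> \<nu> \<noteq> {}" by blast
  moreover have "(\<Sum>p\<in>X. \<Sum>q\<in>X. d p q * \<pi> p q) = 0" for \<pi> using assms(2) by simp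
  ultimately show ?thesis by (simp add: EMD_def)
qed

theorem theorem3:
  fixes a :: real
  assumes "a > 0"
  shows "\<exists>C>0. \<forall>\<epsilon>::real. 0 < \<epsilon> \<and> \<epsilon> < 1 \<longrightarrow>
    (\<exists>T \<in> soft_O (\<lambda>n. real n powr \<epsilon>).
      \<forall>(X :: 'a set) d. finite X \<and> Metric_space X d \<longrightarrow>
        (\<exists>R :: ('a \<Rightarrow> real, 'a \<Rightarrow> real, real) protocol pmf.
          comm_complexity_le R (T (card X)) \<and>
          (\<forall>\<mu> \<in> grid_distributions a X. \<forall>\<nu> \<in> grid_distributions a X.
            measure_pmf.prob R
              {P. EMD X d \<mu> \<nu> \<le> run P \<mu> \<nu> \<and>
                  run P \<mu> \<nu> \<le> C * (doubling_dim X d / \<epsilon>) * EMD X d \<mu> \<nu>} \<ge> 2 / 3)))"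
proof (intro exI[of _ "13687200 :: real"] conjI allI impI)
  fix \<epsilon> :: real assume \<epsilon>: "0 < \<epsilon> \<and> \<epsilon> < 1"
  define c1 where "c1 = 2 * (3 + a)"
  define c2 where "c2 = 2 * (3 + log 2 (100040 * c1))"
  define T where "T n = (9004 * (c1 * c2) + 18004 * c1) * (real n powr \<epsilon> * ln (real n) ^ 2)" for n
  show "\<exists>T \<in> soft_O (\<lambda>n. real n powr \<epsilon>).
      \<forall>(X :: 'a set) d. finite X \<and> Metric_space X d \<longrightarrow>
        (\<exists>R :: ('a \<Rightarrow> real, 'a \<Rightarrow> real, real) protocol pmf.
          comm_complexity_le R (T (card X)) \<and>
          (\<forall>\<mu> \<in> grid_distributions a X. \<forall>\<nu> \<in> grid_distributions a X.
            measure_pmf.prob R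
              {P. EMD X d \<mu> \<nu> \<le> run P \<mu> \<nu> \<and>
                  run P \<mu> \<nu> \<le> 13687200 * (doubling_dim X d / \<epsilon>) * EMD X d \<mu> \<nu>} \<ge> 2 / 3))"
  proof (intro bexI[of _ T] allI impI)
    have "T \<in> O(\<lambda>n. real n powr \<epsilon> * ln (real n) ^ 2)" unfolding T_def by simp
    then show "T \<in> soft_O (\<lambda>n. real n powr \<epsilon>)" unfolding soft_O_def by blast
  next
    fix X :: "'a set" and d assume X: "finite X \<and> Metric_space X d"
    interpret finite_metric X d using X by (simp add: finite_metric_def finite_metric_axioms_def)
    show "\<exists>R. comm_complexity_le R (T (card X)) \<and>
          (\<forall>\<mu> \<in> grid_distributions a X. \<forall>\<nu> \<in> grid_distributions a X.
            measure_pmf.prob R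
              {P. EMD X d \<mu> \<nu> \<le> run P \<mu> \<nu> \<and>
                  run P \<mu> \<nu> \<le> 13687200 * (doubling_dim X d / \<epsilon>) * EMD X d \<mu> \<nu>} \<ge> 2 / 3)"
    proof (cases "2 \<le> card X")
      case True
      show ?thesis using protocol_exists[OF True assms] \<epsilon> unfolding T_def c2_def c1_def by blast
    next
      case False
      then consider "card X = 0" | "card X = 1" by linarith
      \<comment> \<open>For at most one point the bound \<open>T\<close> is \<open>0\<close>, so the
        protocol has to be silent. This is correct: there are no distributions on the empty set and
        only one on a singleton.\<close>
      then have T0: "T (card X) = 0" and E0: "\<And>\<mu> \<nu>. \<mu> \<in> grid_distributions a X \<Longrightarrow> \<nu> \<in> grid_distributions a X \<Longrightarrow> EMD X d \<mu> \<nu> = 0"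
      proof (atomize (full), cases)
        case 1
        then show "T (card X) = 0 \<and> (\<forall>\<mu> \<nu>. \<mu> \<in> grid_distributions a X \<longrightarrow> \<nu> \<in> grid_distributions a X \<longrightarrow> EMD X d \<mu> \<nu> = 0)"
          using X by (auto simp: T_def grid_distributions_def)
      next
        case 2
        then obtain x where "X = {x}" by (auto simp: card_1_singleton_iff)
        then show "T (card X) = 0 \<and> (\<forall>\<mu> \<nu>. \<mu> \<in> grid_distributions a X \<longrightarrow> \<nu> \<in> grid_distributions a X \<longrightarrow> EMD X d \<mu> \<nu> = 0)"
          using EMD_singleton[of X d x] X by (simp add: T_def)
      qed
      show ?thesis
        by (intro exI[of _ "return_pmf (Output 0)"]) (simp add: T0 E0 comm_complexity_le_def)
    qed
  qed
qed simp

end
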